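(* Let $F$ be a field of characteristic zero. For every $r\ge1$ and all compositions $\lambda,\eta$, one has in $\mathrm{NSym}$ (over $F$) $$\Psi_r\,\mathbf s_{\lambda/\eta}=\sum_{\rho:\ \rho/\!/\lambda\in\mathrm{NCB}^0_r}(-1)^{\operatorname{ht}_{\mathrm{nc}}(\rho/\!/\lambda)}\,\mathbf s_{\rho/\eta}-\sum_{\mu:\ \eta/\!/\mu\in\mathrm{NCB}^0_r}(-1)^{\operatorname{ht}_{\mathrm{nc}}(\eta/\!/\mu)}\,\mathbf s_{\lambda/\mu}.$$
   Context: **Algebra.** $\mathrm{NSym}=F\langle H_1,H_2,\dots\rangle$ with $\Delta(H_r)=\sum_{i+j=r}H_i\otimes H_j$ ($H_0=1$), graded Hopf dual to $\mathrm{QSym}$ via $\langle H_\alpha,M_\beta\rangle=\delta_{\alpha\beta}$ ($H_\alpha=H_{\alpha_1}H_{\alpha_2}\cdots$, $M_\beta$ monomial quasisymmetric functions). The noncommutative Schur functions $\mathbf s_\alpha$ are the basis of $\mathrm{NSym}$ dual to the quasisymmetric Schur functions $\mathcal S_\alpha$, where $\mathcal S_\alpha=\sum_Tx^T$ over fillings $T$ of the diagram of $\alpha$ (row $i$ from the top has $\alpha_i$ left-justified boxes) by positive integers with rows weakly decreasing left to right, first column strictly increasing top to bottom, and, extending $T$ by zeros to a rectangle, for $i<j$, $c\ge2$: $T(j,c)\ne0$ and $T(j,c)\ge T(i,c)$ imply $T(j,c)>T(i,c-1)$. Skew elements: $\Delta(\mathbf s_\lambda)=\sum_\eta\mathbf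 s_{\lambda/\eta}\otimes\mathbf s_\eta$. The noncommutative ribbon Schur functions are $\mathbf r_\gamma=\sum_\beta(-1)^{\ell(\gamma)-\ell(\beta)}H_\beta$ over all coarsenings $\beta$ of $\gamma$ (obtained by summing adjacent parts), and $\Psi_r=\sum_{a=0}^{r-1}(-1)^a\mathbf r_{(1^a,r-a)}$. **Skew reverse composition shapes.** Composition diagrams have rows numbered top to bottom and columns left to right. Write $\alpha\lessdot_c\beta$ if either $\beta=(1,\alpha_1,\dots,\alpha_\ell)$, or $\beta=(\alpha_1,\dots,\alpha_p+1,\dots,\alpha_\ell)$ for some $p$ with $\alpha_j\ne\alpha_p$ for all $j<p$; $<_c$ is the transitive closure. For $\alpha<_c\beta$, $\beta/\!/\alpha$ is the set of boxes of $\beta$ remaining after placing the diagram of $\alpha$ in the bottom-left corner of $\beta$. It is an interval shape if the set of columns containing a box is an interval of integers. An interval shape is an nc border strip if: (i) whenever it contains $(i,1)$ and $(i,2)$, $(i,1)$ is the bottommost box in column $1$; (ii) whenever it contains $(i,j)$ and $(i,j+1)$ with $j\ge2$, $(i,j)$ is the topmost box in column $j$. Its height is $\operatorname{ht}_{\mathrm{nc}}=\#\{\text{rows meeting it}\}-1$. Column $j+1$ is north-east of column $j$ if both columns are nonempty and $i_1<i_2$ for all boxes $(i_1,j+1),(i_2,j)$ of the shape; $\mathrm{NE}(\beta/\!/\alpha)$ is the set of $j$ such that column $j+1$ is north-east of column $j$. $\beta/\!/\alpha\in\mathrm{NCB}^0_r$ means: $\alpha<_c\beta$, $\beta/\!/\alpha$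 is an nc border strip with $r$ boxes, and $\mathrm{NE}(\beta/\!/\alpha)=\varnothing$. *)

theory Defs
  imports Complex_Main "HOL-Library.Poly_Mapping" "HOL-Library.Product_Plus"
begin

section \<open>Compositions\<close>

typedef composition = "{xs :: nat list. 0 \<notin> set xs}"
  morphisms parts Comp
  by (rule exI[of _ "[]"]) simp

text \<open>Addition is concatenation, so compositions form the free (noncommutative) monoid
  on the positive integers.\<close>

instantiation composition :: monoid_add
begin

definition zero_composition :: composition where
  "zero_composition = Comp []"

definition plus_composition :: "composition \<Rightarrow> composition \<Rightarrow> composition" where
  "plus_composition \<alpha> \<beta> = Comp (parts \<alpha> @ parts \<beta>)"

instance
proof
  have parts_plus: "parts (a + b) = parts a @ parts b" for a b :: composition
    using parts[of a] parts[of b] by (auto simp: plus_composition_def Comp_inverse)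
  have parts_zero: "parts 0 = []"
    by (simp add: zero_composition_def Comp_inverse)
  fix a b c :: composition
  show "a + b + c = a + (b + c)" "0 + a = a" "a + 0 = a"
    by (simp_all flip: parts_inject add: parts_plus parts_zero)
qed

end

definition len :: "composition \<Rightarrow> nat" where
  "len \<alpha> = length (parts \<alpha>)"

text \<open>Boxes are pairs (row, column), both counted from 1, rows from top to bottom.\<close>

definition diagram :: "composition \<Rightarrow> (nat \<times> nat) set" where
  "diagram \<alpha> = {(i, c). 1 \<le> i \<and> i \<le> len \<alpha> \<and> 1 \<le> c \<and> c \<le> parts \<alpha> ! (i - 1)}"

definition coarsening :: "composition \<Rightarrow> composition \<Rightarrow> bool" where
  "coarsening \<beta> \<gamma> \<longleftrightarrow>
     (\<exists>blocks. [] \<notin> set blocks \<and> concat blocks = parts \<gamma> \<and> map sum_list blocks = parts \<beta>)"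


section \<open>Noncommutative symmetric functions\<close>

text \<open>The free algebra on \<open>H\<^sub>1, H\<^sub>2, \<dots>\<close> is the monoid algebra of the free monoid of compositions;
  the basis element at \<open>\<alpha>\<close> is \<open>H\<^sub>\<alpha>\<close>. The product is the convolution product of
  finitely supported functions. Likewise the tensor square, with its componentwise product,
  is the monoid algebra of the direct product monoid.\<close>

type_synonym 'a nsym = "composition \<Rightarrow>\<^sub>0 'a"
type_synonym 'a nsym2 = "(composition \<times> composition) \<Rightarrow>\<^sub>0 'a"

definition Hcomp :: "composition \<Rightarrow> 'a::comm_ring_1 nsym" where
  "Hcomp \<alpha> = Poly_Mapping.single \<alpha> 1"

definition H :: "nat \<Rightarrow> 'a::comm_ring_1 nsym" where
  "H n = (if n = 0 then 1 else Hcomp (Comp [n]))"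

definition tensor :: "'a::comm_ring_1 nsym \<Rightarrow> 'a nsym \<Rightarrow> 'a nsym2" (infixr \<open>\<otimes>\<close> 75) where
  "u \<otimes> v = (\<Sum>\<alpha>\<in>Poly_Mapping.keys u. \<Sum>\<beta>\<in>Poly_Mapping.keys v.
     Poly_Mapping.single (\<alpha>, \<beta>) (Poly_Mapping.lookup u \<alpha> * Poly_Mapping.lookup v \<beta>))"

definition comult_H :: "nat \<Rightarrow> 'a::comm_ring_1 nsym2" where
  "comult_H n = (\<Sum>i\<le>n. H i \<otimes> H (n - i))"

text \<open>The extension of \<^const>\<open>comult_H\<close> to an algebra homomorphism; the scalar \<open>c\<close> is the
  element \<open>single 0 c\<close> of the monoid algebra.\<close>

definition comult :: "'a::comm_ring_1 nsym \<Rightarrow> 'a nsym2" where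
  "comult u = (\<Sum>\<alpha>\<in>Poly_Mapping.keys u.
     Poly_Mapping.single 0 (Poly_Mapping.lookup u \<alpha>) * prod_list (map comult_H (parts \<alpha>)))"

definition ribbon :: "composition \<Rightarrow> 'a::comm_ring_1 nsym" where
  "ribbon \<gamma> = (\<Sum>\<beta> | coarsening \<beta> \<gamma>. (-1) ^ (len \<gamma> - len \<beta>) * Hcomp \<beta>)"

definition Psi :: "nat \<Rightarrow> 'a::comm_ring_1 nsym" where
  "Psi r = (\<Sum>a<r. (-1) ^ a * ribbon (Comp (replicate a 1 @ [r - a])))"


section \<open>Quasisymmetric functions\<close>

text \<open>Formal power series in \<open>x\<^sub>1, x\<^sub>2, \<dots>\<close> are given by their coefficient functions; a monomial
  is its finitely supported exponent vector. The index 0 is not used by any variable.\<close>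

type_synonym 'a power_series = "(nat \<Rightarrow>\<^sub>0 nat) \<Rightarrow> 'a"

definition monomial_qsym :: "composition \<Rightarrow> 'a::comm_ring_1 power_series" where
  "monomial_qsym \<beta> m =
     (if \<exists>is. length is = len \<beta> \<and> sorted_wrt (<) is \<and> 0 \<notin> set is \<and>
             m = (\<Sum>k<len \<beta>. Poly_Mapping.single (is ! k) (parts \<beta> ! k))
      then 1 else 0)"

text \<open>The coordinates of a quasisymmetric function in the basis \<open>M\<^sub>\<beta>\<close>; unspecified if the power
  series is not quasisymmetric.\<close>

definition M_coords :: "'a::comm_ring_1 power_series \<Rightarrow> (composition \<Rightarrow>\<^sub>0 'a)" where
  "M_coords f = (THE c. \<forall>m. f m =
     (\<Sum>\<beta>\<in>Poly_Mapping.keys c. Poly_Mapping.lookup c \<beta> * monomial_qsym \<beta> m))"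

text \<open>The bilinear pairing of NSym and QSym with \<open>\<langle>H\<^sub>\<alpha>, M\<^sub>\<beta>\<rangle> = \<delta>\<^sub>\<alpha>\<^sub>\<beta>\<close>.\<close>

definition pairing :: "'a::comm_ring_1 nsym \<Rightarrow> 'a power_series \<Rightarrow> 'a" where
  "pairing u f = (\<Sum>\<alpha>\<in>Poly_Mapping.keys u.
     Poly_Mapping.lookup u \<alpha> * Poly_Mapping.lookup (M_coords f) \<alpha>)"

text \<open>Fillings are extended by zero to all pairs (row, column). In the triple condition this
  amounts to extending them to a rectangle: the condition is void where \<open>T (j, c) = 0\<close>.\<close>

definition composition_tableau :: "composition \<Rightarrow> (nat \<times> nat \<Rightarrow> nat) \<Rightarrow> bool" where
  "composition_tableau \<alpha> T \<longleftrightarrow>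
     (\<forall>b. b \<in> diagram \<alpha> \<longleftrightarrow> T b > 0) \<and>
     (\<forall>i c. (i, c) \<in> diagram \<alpha> \<and> (i, c + 1) \<in> diagram \<alpha> \<longrightarrow> T (i, c) \<ge> T (i, c + 1)) \<and>
     (\<forall>i j. 1 \<le> i \<and> i < j \<and> j \<le> len \<alpha> \<longrightarrow> T (i, 1) < T (j, 1)) \<and>
     (\<forall>i j c. 1 \<le> i \<and> i < j \<and> j \<le> len \<alpha> \<and> 2 \<le> c \<longrightarrow>
        T (j, c) \<noteq> 0 \<and> T (j, c) \<ge> T (i, c) \<longrightarrow> T (j, c) > T (i, c - 1))"

definition content :: "composition \<Rightarrow> (nat \<times> nat \<Rightarrow> nat) \<Rightarrow> (nat \<Rightarrow>\<^sub>0 nat)" where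
  "content \<alpha> T = (\<Sum>b\<in>diagram \<alpha>. Poly_Mapping.single (T b) 1)"

definition quasi_schur :: "composition \<Rightarrow> 'a::comm_ring_1 power_series" where
  "quasi_schur \<alpha> m = of_nat (card {T. composition_tableau \<alpha> T \<and> content \<alpha> T = m})"


section \<open>Noncommutative Schur functions\<close>

text \<open>The basis of NSym dual to the basis of quasisymmetric Schur functions of QSym: because the
  latter is a basis, the duality relations determine the family.\<close>

definition nc_schur :: "composition \<Rightarrow> 'a::field_char_0 nsym" where
  "nc_schur = (THE s. \<forall>\<alpha> \<beta>. pairing (s \<alpha>) (quasi_schur \<beta>) = (if \<alpha> = \<beta> then 1 else 0))"

text \<open>\<open>skew_schur \<kappa> \<eta>\<close> is \<open>s\<^sub>\<kappa>\<^sub>/\<^sub>\<eta>\<close>. The family \<open>\<eta> \<mapsto> s\<^sub>\<kappa>\<^sub>/\<^sub>\<eta>\<close> is finitely supported, and it is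
  determined by the coproduct of \<open>s\<^sub>\<kappa>\<close> because the \<open>s\<^sub>\<eta>\<close> form a basis.\<close>

definition skew_schur :: "composition \<Rightarrow> composition \<Rightarrow> 'a::field_char_0 nsym" where
  "skew_schur \<kappa> \<eta> = Poly_Mapping.lookup
     (THE u. comult (nc_schur \<kappa>) =
        (\<Sum>\<beta>\<in>Poly_Mapping.keys u. Poly_Mapping.lookup u \<beta> \<otimes> nc_schur \<beta>)) \<eta>"


section \<open>Skew reverse composition shapes\<close>

definition cover_c :: "composition \<Rightarrow> composition \<Rightarrow> bool" where
  "cover_c \<alpha> \<beta> \<longleftrightarrow>
     parts \<beta> = 1 # parts \<alpha> \<or>
     (\<exists>p<len \<alpha>. parts \<beta> = (parts \<alpha>)[p := parts \<alpha> ! p + 1] \<and>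
        (\<forall>j<p. parts \<alpha> ! j \<noteq> parts \<alpha> ! p))"

definition less_c :: "composition \<Rightarrow> composition \<Rightarrow> bool" where
  "less_c = tranclp cover_c"

text \<open>The diagram of \<open>\<alpha>\<close> is placed in the bottom-left corner of \<open>\<beta>\<close>, that is, moved down by
  \<open>len \<beta> - len \<alpha>\<close> rows.\<close>

definition skew_shape :: "composition \<Rightarrow> composition \<Rightarrow> (nat \<times> nat) set" where
  "skew_shape \<beta> \<alpha> = diagram \<beta> - (\<lambda>(i, c). (i + (len \<beta> - len \<alpha>), c)) ` diagram \<alpha>"

definition interval_shape :: "(nat \<times> nat) set \<Rightarrow> bool" where
  "interval_shape S \<longleftrightarrow> (\<exists>a b. snd ` S = {a..b})"

definition nc_border_strip :: "(nat \<times> nat) set \<Rightarrow> bool" where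
  "nc_border_strip S \<longleftrightarrow> interval_shape S \<and>
     (\<forall>i. (i, 1) \<in> S \<and> (i, 2) \<in> S \<longrightarrow> (\<forall>k. (k, 1) \<in> S \<longrightarrow> k \<le> i)) \<and>
     (\<forall>i j. 2 \<le> j \<and> (i, j) \<in> S \<and> (i, j + 1) \<in> S \<longrightarrow> (\<forall>k. (k, j) \<in> S \<longrightarrow> i \<le> k))"

definition ht_nc :: "(nat \<times> nat) set \<Rightarrow> nat" where
  "ht_nc S = card (fst ` S) - 1"

definition NE :: "(nat \<times> nat) set \<Rightarrow> nat set" where
  "NE S = {j. (\<exists>i. (i, j) \<in> S) \<and> (\<exists>i. (i, j + 1) \<in> S) \<and>
     (\<forall>i1 i2. (i1, j + 1) \<in> S \<and> (i2, j) \<in> S \<longrightarrow> i1 < i2)}"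

text \<open>\<open>NCB0 r \<beta> \<alpha>\<close> says that \<open>\<beta>//\<alpha>\<close> belongs to \<open>NCB\<^sup>0\<^sub>r\<close>.\<close>

definition NCB0 :: "nat \<Rightarrow> composition \<Rightarrow> composition \<Rightarrow> bool" where
  "NCB0 r \<beta> \<alpha> \<longleftrightarrow> less_c \<alpha> \<beta> \<and> nc_border_strip (skew_shape \<beta> \<alpha>) \<and>
     card (skew_shape \<beta> \<alpha>) = r \<and> NE (skew_shape \<beta> \<alpha>) = {}"

end

(* Pairing with the quasisymmetric Schur functions turns left multiplication by H_n into the removal
   of horizontal strips, the cells with entry 1 of a tableau. Signed removal of vertical strips
   inverts this operation. Since Psi_r is the sum of the (r - i) E_i H_(r-i), where the series of the
   E_i is inverse to that of the H_i, the coefficient of s_rho in Psi_r s_lambda is a signed sum over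
   the compositions tau that arise from lambda by adding a horizontal strip and from which a
   vertical strip leads to rho. Such a tau adds to lambda the first box of each column in some set
   X. Deciding whether the last column of rho//lambda lies in X is a sign-reversing involution up to
   the weights; the remaining sum factors over pairs of neighbouring columns, and its factors are
   nonzero exactly when rho//lambda is an nc border strip without north-east columns.

   As the logarithmic derivative of a grouplike series, Psi_r is primitive. Taking the coefficient
   of s_eta in the right factor of (Psi_r (x) 1 + 1 (x) Psi_r) Delta(s_lambda) gives the two terms. *)
theory Submission
  imports Defs "HOL-Computational_Algebra.Formal_Power_Series"
begin

section \<open>Rows and columns of composition diagrams\<close>

text \<open>The weight r - i comes from counting hooks: the coarsenings of (1^a, r - a) are the
  compositions of r whose last part is at least r - a, so (-1)^a times the hook ribbon is the sum of
  the E_i H_(r-i) with i \<le> a, and a fixed i occurs for the r - i values a = i, ..., r - 1. One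
  toggle of the last column serves twice: with constant weight the pairs cancel, which proves that
  signed vertical strips invert horizontal ones; with weight |X| = r - i each pair leaves -1 up to
  its sign. The rest factors because a horizontal strip has at most one box per column and the
  requirements on a column involve X only through the column to its left. A second obstacle is that
  coordinates in the M-basis, noncommutative Schur functions and skew elements are given by definite
  descriptions. The numbers of tableaux of given shape and content are the M-coordinates of the
  quasisymmetric Schur functions. They form a unitriangular matrix when compositions are compared by
  length, then lexicographically, which yields the dual basis by well-founded recursion and lets
  linear maps replace the descriptions.\<close>

lemma parts_plus [simp]: "parts (\<mu> + \<nu>) = parts \<mu> @ parts \<nu>"
  using parts[of \<mu>] parts[of \<nu>] by (auto simp: plus_composition_def Comp_inverse)

lemma parts_zero [simp]: "parts 0 = []"
  by (simp add: zero_composition_def Comp_inverse)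

lemma zero_notin_parts [simp]: "0 \<notin> set (parts \<mu>)"
  using parts[of \<mu>] by simp

lemma parts_Comp: "0 \<notin> set xs \<Longrightarrow> parts (Comp xs) = xs"
  by (simp add: Comp_inverse)

definition csize :: "composition \<Rightarrow> nat" where
  "csize \<mu> = sum_list (parts \<mu>)"

lemma csize_plus [simp]: "csize (\<mu> + \<nu>) = csize \<mu> + csize \<nu>"
  by (simp add: csize_def)

lemma csize_zero [simp]: "csize 0 = 0"
  by (simp add: csize_def)

lemma finite_csize_le: "finite {\<mu>. csize \<mu> \<le> n}"
proof -
  have "length xs \<le> sum_list xs" if "0 \<notin> set xs" for xs :: "nat list"
    using that by (induction xs) auto
  then have "parts ` {\<mu>. csize \<mu> \<le> n} \<subseteq> {xs. set xs \<subseteq> {..n} \<and> length xs \<le> n}"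
    by (auto simp: csize_def dest: member_le_sum_list order.trans)
       (meson le_trans zero_notin_parts)
  moreover have "finite {xs. set xs \<subseteq> {..n} \<and> length xs \<le> n}"
    by (rule finite_lists_length_le) simp
  ultimately have "finite (parts ` {\<mu>. csize \<mu> \<le> n})"
    by (rule finite_subset)
  then show ?thesis
    by (rule finite_imageD) (simp add: inj_on_def parts_inject)
qed

lemma finite_csize_eq: "finite {\<mu>. csize \<mu> = n}"
  by (rule finite_subset[OF _ finite_csize_le[of n]]) auto

text \<open>Rows are counted from 0, starting at the bottom of the diagram: the inclusions between
  diagrams used for skew shapes align the bottom rows.\<close>

definition rowlen :: "composition \<Rightarrow> nat \<Rightarrow> nat" where
  "rowlen \<mu> i = (if i < len \<mu> then rev (parts \<mu>) ! i else 0)"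

lemma rowlen_pos_iff [simp]: "0 < rowlen \<mu> i \<longleftrightarrow> i < len \<mu>"
proof (cases "i < len \<mu>")
  case True
  then have "rev (parts \<mu>) ! i \<in> set (parts \<mu>)"
    using nth_mem[of i "rev (parts \<mu>)"] by (simp add: len_def)
  then have "rev (parts \<mu>) ! i \<noteq> 0"
    using zero_notin_parts[of \<mu>] by metis
  with True show ?thesis by (simp add: rowlen_def)
qed (simp add: rowlen_def)

lemma rowlen_eq_0_iff [simp]: "rowlen \<mu> i = 0 \<longleftrightarrow> len \<mu> \<le> i"
  using rowlen_pos_iff[of \<mu> i] by linarith

lemma rowlen_inject: "rowlen \<mu> = rowlen \<nu> \<longleftrightarrow> \<mu> = \<nu>"
proof
  assume eq: "rowlen \<mu> = rowlen \<nu>"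
  have "i < len \<mu> \<longleftrightarrow> i < len \<nu>" for i
    using eq rowlen_pos_iff[of \<mu> i] rowlen_pos_iff[of \<nu> i] by metis
  then have len: "len \<mu> = len \<nu>"
    by (meson linorder_neqE_nat less_irrefl)
  have "rev (parts \<mu>) = rev (parts \<nu>)"
  proof (rule nth_equalityI)
    show "length (rev (parts \<mu>)) = length (rev (parts \<nu>))"
      using len by (simp add: len_def)
    show "rev (parts \<mu>) ! i = rev (parts \<nu>) ! i" if "i < length (rev (parts \<mu>))" for i
      using that fun_cong[OF eq, of i] len by (simp add: rowlen_def len_def)
  qed
  then show "\<mu> = \<nu>"
    by (simp add: parts_inject)
qed simp

lemma rowlen_of_fun:
  assumes "\<And>i. 0 < f i \<longleftrightarrow> i < n"
  obtains \<mu> where "rowlen \<mu> = f" "len \<mu> = n"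
proof
  let ?xs = "map f (rev [0..<n])"
  have p: "parts (Comp ?xs) = ?xs"
    using assms by (intro parts_Comp) (auto simp: image_iff)
  show "len (Comp ?xs) = n"
    by (simp add: len_def p)
  show "rowlen (Comp ?xs) = f"
    using assms by (auto simp: rowlen_def len_def p fun_eq_iff rev_map)
qed

lemma csize_rowlen: "csize \<mu> = (\<Sum>i<len \<mu>. rowlen \<mu> i)"
proof -
  have "csize \<mu> = sum_list (rev (parts \<mu>))"
    by (simp add: csize_def)
  also have "\<dots> = (\<Sum>i<len \<mu>. rowlen \<mu> i)"
    by (simp add: sum_list_sum_nth rowlen_def len_def lessThan_atLeast0)
  finally show ?thesis .
qed

text \<open>The value at 0 is the set of all rows. It acts as a column to the left of the diagram,
  so that demanding a box on the left is void in the first column. Otherwise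
  \<open>col \<mu> (Suc c)\<close> is the column with index c when columns are counted from
  0.\<close>

definition col :: "composition \<Rightarrow> nat \<Rightarrow> nat set" where
  "col \<mu> c = {i. c \<le> rowlen \<mu> i}"

lemma col_0 [simp]: "col \<mu> 0 = UNIV"
  by (simp add: col_def)

lemma col_Suc_0: "col \<mu> (Suc 0) = {..<len \<mu>}"
  by (auto simp: col_def Suc_le_eq)

lemma col_antimono: "c \<le> d \<Longrightarrow> col \<mu> d \<subseteq> col \<mu> c"
  by (auto simp: col_def)

lemma col_Suc_subset: "col \<mu> (Suc c) \<subseteq> col \<mu> c"
  by (rule col_antimono) simp

lemma finite_col [simp]: "finite (col \<mu> (Suc c))"
  using col_antimono[of "Suc 0" "Suc c" \<mu>] by (auto simp: col_Suc_0 intro: finite_subset)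

lemma rowlen_le_csize: "rowlen \<mu> i \<le> csize \<mu>"
proof (cases "i < len \<mu>")
  case True
  then show ?thesis by (auto simp: csize_rowlen intro: member_le_sum)
next
  case False
  then show ?thesis by (simp add: rowlen_def)
qed

lemma col_empty: "csize \<mu> \<le> c \<Longrightarrow> col \<mu> (Suc c) = {}"
  using rowlen_le_csize[of \<mu>] by (auto simp: col_def) (meson Suc_n_not_le_n le_trans)

lemma csize_col: "csize \<mu> \<le> N \<Longrightarrow> csize \<mu> = (\<Sum>c<N. card (col \<mu> (Suc c)))"
proof -
  assume N: "csize \<mu> \<le> N"
  have "rowlen \<mu> i = card {c. c < N \<and> i \<in> col \<mu> (Suc c)}" for i
  proof -
    have "{c. c < N \<and> i \<in> col \<mu> (Suc c)} = {..<rowlen \<mu> i}"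
      using rowlen_le_csize[of \<mu> i] N by (auto simp: col_def)
    then show ?thesis by simp
  qed
  then have "csize \<mu> = (\<Sum>i<len \<mu>. card {c\<in>{..<N}. i \<in> col \<mu> (Suc c)})"
    by (simp add: csize_rowlen)
  also have "\<dots> = (\<Sum>c<N. card {i\<in>{..<len \<mu>}. i \<in> col \<mu> (Suc c)})"
    by (rule sum_multicount_gen) simp_all
  also have "\<dots> = (\<Sum>c<N. card (col \<mu> (Suc c)))"
    using col_antimono[of "Suc 0" _ \<mu>]
    by (intro sum.cong refl arg_cong[where f = card]) (auto simp: col_Suc_0)
  finally show ?thesis .
qed

lemma col_inject: "(\<And>c. col \<mu> (Suc c) = col \<nu> (Suc c)) \<Longrightarrow> \<mu> = \<nu>"
proof -
  assume eq: "\<And>c. col \<mu> (Suc c) = col \<nu> (Suc c)"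
  have "c \<le> rowlen \<mu> i \<longleftrightarrow> c \<le> rowlen \<nu> i" for c i
    using eq by (cases c) (auto simp: col_def set_eq_iff)
  then have "rowlen \<mu> = rowlen \<nu>"
    by (metis antisym order_refl ext)
  then show ?thesis by (simp add: rowlen_inject)
qed

text \<open>The rows of a composition may have any lengths, so only the first column must be an
  initial segment; the later ones are arbitrary as long as each lies inside its predecessor. Row i
  gets as many boxes as there are columns containing i.\<close>

lemma composition_of_cols:
  assumes mono: "\<And>c. C (Suc c) \<subseteq> C c" and first: "C (Suc 0) = {..<n}" and fin: "C (Suc N) = {}"
  obtains \<mu> where "\<And>c. col \<mu> (Suc c) = C (Suc c)"
proof -
  define f where "f i = card {c. i \<in> C (Suc c)}" for i
  have anti: "c \<le> d \<Longrightarrow> C d \<subseteq> C c" for c d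
    by (rule lift_Suc_antimono_le[of C]) (use mono in auto)
  have *: "{c. i \<in> C (Suc c)} = {..<f i}" for i
  proof -
    have "\<exists>k. {c. i \<in> C (Suc c)} = {..<k}"
    proof (intro exI)
      let ?k = "LEAST k. i \<notin> C (Suc k)"
      have "i \<notin> C (Suc ?k)"
        by (rule LeastI[of _ N]) (use fin in simp)
      then have "i \<in> C (Suc c) \<Longrightarrow> c < ?k" for c
        using anti[of "Suc ?k" "Suc c"] by (meson Suc_le_mono not_less subsetD)
      moreover have "c < ?k \<Longrightarrow> i \<in> C (Suc c)" for c
        using not_less_Least by blast
      ultimately show "{c. i \<in> C (Suc c)} = {..<?k}" by (intro set_eqI) (metis lessThan_iff mem_Collect_eq)
    qed
    then obtain k where "{c. i \<in> C (Suc c)} = {..<k}" ..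
    then show ?thesis unfolding f_def by simp
  qed
  have iff: "i \<in> C (Suc c) \<longleftrightarrow> c < f i" for i c
    using *[of i] by (auto simp: set_eq_iff)
  have "0 < f i \<longleftrightarrow> i < n" for i
    using iff[of i 0] first by auto
  then obtain \<mu> where "rowlen \<mu> = f" by (rule rowlen_of_fun)
  then have "col \<mu> (Suc c) = C (Suc c)" for c
    using iff by (auto simp: col_def)
  then show thesis by (rule that)
qed

section \<open>Horizontal and vertical strips\<close>

text \<open>The order in which the boxes of the \<open>c\<close>-th column (counted from 0) are filled: upwards in the
  first column, downwards in the others.\<close>

definition bef :: "nat \<Rightarrow> nat \<Rightarrow> nat \<Rightarrow> bool" where
  "bef c i j \<longleftrightarrow> (if c = 0 then i < j else j < i)"

lemma bef_asym: "bef c i j \<Longrightarrow> \<not> bef c j i"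
  by (auto simp: bef_def split: if_splits)

lemma bef_irrefl [simp]: "\<not> bef c i i"
  by (simp add: bef_def)

definition new_rows :: "composition \<Rightarrow> composition \<Rightarrow> nat \<Rightarrow> nat set" where
  "new_rows \<mu> \<nu> c = col \<nu> (Suc c) - col \<mu> (Suc c)"

text \<open>These are the conditions on the entries 1 of a tableau of shape \<nu> whose larger
  entries fill \<mu>. In the first column they leave only the row \<open>len \<mu>\<close>. In a
  later column the triple condition, applied to an entry 1, says that a higher row reaching the
  preceding column has a larger entry in this one, that is, belongs to \<mu> there.\<close>

definition horiz :: "composition \<Rightarrow> composition \<Rightarrow> bool" where
  "horiz \<mu> \<nu> \<longleftrightarrow> (\<forall>c. col \<mu> (Suc c) \<subseteq> col \<nu> (Suc c) \<and>
     (\<forall>j\<in>new_rows \<mu> \<nu> c. \<forall>i\<in>col \<nu> c - col \<mu> (Suc c). i = j \<or> bef c j i))"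

text \<open>The box to the left of a new box is old, so no row receives two boxes beyond its old
  end. Among the rows of \<mu> with exactly c > 0 boxes the prolonged ones lie above the others; in
  the first column any number of rows may be added.\<close>

definition vert :: "composition \<Rightarrow> composition \<Rightarrow> bool" where
  "vert \<mu> \<nu> \<longleftrightarrow> (\<forall>c. col \<mu> (Suc c) \<subseteq> col \<nu> (Suc c) \<and>
     (\<forall>j\<in>new_rows \<mu> \<nu> c. j \<in> col \<mu> c \<and> (\<forall>i\<in>col \<mu> c - col \<nu> (Suc c). bef c j i)))"

definition new_cols :: "composition \<Rightarrow> composition \<Rightarrow> nat set" where
  "new_cols \<mu> \<nu> = {c. new_rows \<mu> \<nu> c \<noteq> {}}"

definition first_row :: "composition \<Rightarrow> composition \<Rightarrow> nat \<Rightarrow> nat" where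
  "first_row \<mu> \<nu> c = (if c = 0 then Min (new_rows \<mu> \<nu> c) else Max (new_rows \<mu> \<nu> c))"

definition contained :: "composition \<Rightarrow> composition \<Rightarrow> bool" where
  "contained \<mu> \<nu> \<longleftrightarrow> (\<forall>c. col \<mu> c \<subseteq> col \<nu> c)"

lemma finite_new_rows [simp]: "finite (new_rows \<mu> \<nu> c)"
  by (simp add: new_rows_def)

lemma finite_new_cols [simp]: "finite (new_cols \<mu> \<nu>)"
proof (rule finite_subset)
  show "new_cols \<mu> \<nu> \<subseteq> {..<csize \<nu>}"
    using col_empty[of \<nu>] by (auto simp: new_cols_def new_rows_def intro: ccontr)
qed simp

lemma first_row_in: "c \<in> new_cols \<mu> \<nu> \<Longrightarrow> first_row \<mu> \<nu> c \<in> new_rows \<mu> \<nu> c"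
  by (cases "c = 0") (simp_all add: first_row_def new_cols_def)

lemma first_row_bef: "j \<in> new_rows \<mu> \<nu> c \<Longrightarrow> j = first_row \<mu> \<nu> c \<or> bef c (first_row \<mu> \<nu> c) j"
  using Min_le[of "new_rows \<mu> \<nu> c" j] Max_ge[of "new_rows \<mu> \<nu> c" j]
  by (cases "c = 0") (auto simp: first_row_def bef_def order_le_less)

lemma first_row_0:
  assumes "0 \<in> new_cols \<mu> \<nu>"
  shows "first_row \<mu> \<nu> 0 = len \<mu>"
proof -
  have "new_rows \<mu> \<nu> 0 = {len \<mu>..<len \<nu>}"
    by (auto simp: new_rows_def col_Suc_0)
  then have "first_row \<mu> \<nu> 0 = Min {len \<mu>..<len \<nu>}" "len \<mu> < len \<nu>"
    using assms by (simp_all add: first_row_def new_cols_def)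
  then show ?thesis by (simp add: Min_eq_iff)
qed

lemma containedI: "(\<And>c. col \<mu> (Suc c) \<subseteq> col \<nu> (Suc c)) \<Longrightarrow> contained \<mu> \<nu>"
  unfolding contained_def by (metis col_0 not0_implies_Suc subset_UNIV)

lemma containedD: "contained \<mu> \<nu> \<Longrightarrow> i \<in> col \<mu> c \<Longrightarrow> i \<in> col \<nu> c"
  by (auto simp: contained_def)

lemma contained_trans: "contained \<mu> \<nu> \<Longrightarrow> contained \<nu> \<xi> \<Longrightarrow> contained \<mu> \<xi>"
  by (auto simp: contained_def)

lemma horiz_contained: "horiz \<mu> \<nu> \<Longrightarrow> contained \<mu> \<nu>"
  by (rule containedI) (auto simp: horiz_def)

lemma vert_contained: "vert \<mu> \<nu> \<Longrightarrow> contained \<mu> \<nu>"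
  by (rule containedI) (auto simp: vert_def)

lemma horizD:
  "horiz \<mu> \<nu> \<Longrightarrow> j \<in> new_rows \<mu> \<nu> c \<Longrightarrow> i \<in> col \<nu> c - col \<mu> (Suc c) \<Longrightarrow> i = j \<or> bef c j i"
  by (auto simp: horiz_def)

lemma vertD:
  assumes "vert \<mu> \<nu>" "j \<in> new_rows \<mu> \<nu> c"
  shows "j \<in> col \<mu> c" "i \<in> col \<mu> c - col \<nu> (Suc c) \<Longrightarrow> bef c j i"
  using assms by (auto simp: vert_def)

lemma csize_contained:
  assumes "contained \<mu> \<nu>"
  shows "csize \<nu> = csize \<mu> + (\<Sum>c\<in>new_cols \<mu> \<nu>. card (new_rows \<mu> \<nu> c))"
proof -
  obtain N where N: "csize \<mu> \<le> N" "csize \<nu> \<le> N"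
    by (meson linear)
  have sub: "col \<mu> (Suc c) \<subseteq> col \<nu> (Suc c)" for c
    using assms by (simp add: contained_def)
  have "card (col \<nu> (Suc c)) = card (col \<mu> (Suc c)) + card (new_rows \<mu> \<nu> c)" for c
    using card_mono[OF _ sub[of c]] by (simp add: new_rows_def card_Diff_subset sub)
  then have "csize \<nu> = csize \<mu> + (\<Sum>c<N. card (new_rows \<mu> \<nu> c))"
    by (simp add: csize_col[OF N(1)] csize_col[OF N(2)] sum.distrib)
  also have "(\<Sum>c<N. card (new_rows \<mu> \<nu> c)) = (\<Sum>c\<in>new_cols \<mu> \<nu>. card (new_rows \<mu> \<nu> c))"
  proof (rule sum.mono_neutral_right)
    show "new_cols \<mu> \<nu> \<subseteq> {..<N}"
      using col_empty[of \<nu>] N(2)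
      by (auto simp: new_cols_def new_rows_def intro: ccontr)
  qed (auto simp: new_cols_def)
  finally show ?thesis .
qed

lemma contained_eqI: "contained \<mu> \<nu> \<Longrightarrow> new_cols \<mu> \<nu> = {} \<Longrightarrow> \<mu> = \<nu>"
  by (rule col_inject) (auto simp: contained_def new_cols_def new_rows_def)

lemma contained_csize_eq: "contained \<mu> \<nu> \<Longrightarrow> csize \<mu> = csize \<nu> \<Longrightarrow> \<mu> = \<nu>"
  using csize_contained[of \<mu> \<nu>] finite_new_cols[of \<mu> \<nu>]
  by (intro contained_eqI) (auto simp: sum_eq_0_iff new_cols_def)

lemma new_rows_refl [simp]: "new_rows \<mu> \<mu> c = {}"
  by (simp add: new_rows_def)

lemma new_cols_refl [simp]: "new_cols \<mu> \<mu> = {}"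
  by (simp add: new_cols_def)

lemma horiz_refl [simp]: "horiz \<mu> \<mu>"
  by (simp add: horiz_def)

lemma vert_refl [simp]: "vert \<mu> \<mu>"
  by (simp add: vert_def)

text \<open>A composition \<open>\<tau>\<close> with \<open>horiz \<mu> \<tau>\<close> and \<open>vert \<tau> \<nu>\<close> arises from \<open>\<mu>\<close> by adding, in the columns
  of a set \<open>X\<close>, the box filled first. The requirements on column \<open>c\<close> depend only on the truth value
  \<open>x\<close> of \<open>c - 1 \<in> X\<close>, and \<open>mid_col\<close> is column \<open>c - 1\<close> of \<open>\<tau>\<close>.\<close>

definition mid_col :: "composition \<Rightarrow> composition \<Rightarrow> nat \<Rightarrow> bool \<Rightarrow> nat set" where
  "mid_col \<mu> \<nu> c x = col \<mu> c \<union> (if x \<and> 0 < c then {first_row \<mu> \<nu> (c - 1)} else {})"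

definition col_ok :: "composition \<Rightarrow> composition \<Rightarrow> nat \<Rightarrow> bool \<Rightarrow> bool" where
  "col_ok \<mu> \<nu> c x \<longleftrightarrow> new_rows \<mu> \<nu> c \<subseteq> mid_col \<mu> \<nu> c x \<and>
     (\<forall>j\<in>new_rows \<mu> \<nu> c. \<forall>i\<in>mid_col \<mu> \<nu> c x - col \<nu> (Suc c). bef c j i)"

text \<open>The first new row f of the column lies in \<open>col \<tau> c\<close> in either case:
  through its box in \<tau>, or because a vertical strip only prolongs rows of \<tau>. Horizontality
  of \<tau> over \<mu> then excludes every new box of \<tau> that comes after f.\<close>

lemma horiz_vert_col:
  assumes h: "horiz \<mu> \<tau>" and v: "vert \<tau> \<nu>"
  shows "new_rows \<mu> \<tau> c = (if c \<in> new_cols \<mu> \<tau> then {first_row \<mu> \<nu> c} else {})"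
    and "c \<in> new_cols \<mu> \<tau> \<Longrightarrow> c \<in> new_cols \<mu> \<nu>"
proof -
  have sub: "new_rows \<mu> \<tau> c \<subseteq> new_rows \<mu> \<nu> c"
    using v by (auto simp: new_rows_def vert_def)
  then show J: "c \<in> new_cols \<mu> \<tau> \<Longrightarrow> c \<in> new_cols \<mu> \<nu>"
    by (auto simp: new_cols_def)
  have "j = first_row \<mu> \<nu> c" if j: "j \<in> new_rows \<mu> \<tau> c" for j
  proof (rule ccontr)
    let ?f = "first_row \<mu> \<nu> c"
    assume ne: "j \<noteq> ?f"
    have f: "?f \<in> new_rows \<mu> \<nu> c"
      using j sub by (intro first_row_in) (auto simp: new_cols_def)
    have "bef c ?f j"
      using first_row_bef[of j \<mu> \<nu> c] sub j ne by auto
    moreover have "?f \<in> col \<tau> c - col \<mu> (Suc c)"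
    proof (cases "?f \<in> col \<tau> (Suc c)")
      case True
      then show ?thesis using f col_Suc_subset[of \<tau> c] by (auto simp: new_rows_def)
    next
      case False
      then show ?thesis using f v by (auto simp: new_rows_def vert_def)
    qed
    ultimately show False
      using horizD[OF h j] ne bef_asym by blast
  qed
  then show "new_rows \<mu> \<tau> c = (if c \<in> new_cols \<mu> \<tau> then {first_row \<mu> \<nu> c} else {})"
    by (auto simp: new_cols_def)
qed

lemma horiz_vert_mid_col:
  assumes h: "horiz \<mu> \<tau>" and v: "vert \<tau> \<nu>"
  shows "col \<tau> c = mid_col \<mu> \<nu> c (0 < c \<and> c - 1 \<in> new_cols \<mu> \<tau>)"
proof (cases c)
  case (Suc d)
  have "col \<tau> (Suc d) = col \<mu> (Suc d) \<union> new_rows \<mu> \<tau> d"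
    using h by (auto simp: horiz_def new_rows_def)
  then show ?thesis
    using horiz_vert_col(1)[OF h v, of d] Suc by (auto simp: mid_col_def)
qed (simp add: mid_col_def)

lemma horiz_vert_col_ok:
  assumes h: "horiz \<mu> \<tau>" and v: "vert \<tau> \<nu>"
  shows "col_ok \<mu> \<nu> c (0 < c \<and> c - 1 \<in> new_cols \<mu> \<tau>)"
proof -
  have 1: "j \<in> col \<tau> c" if "j \<in> new_rows \<mu> \<nu> c" for j
    using that v col_Suc_subset[of \<tau> c] by (cases "j \<in> col \<tau> (Suc c)") (auto simp: new_rows_def vert_def)
  have 2: "bef c j i" if "j \<in> new_rows \<mu> \<nu> c" "i \<in> col \<tau> c" "i \<notin> col \<nu> (Suc c)" for i j
  proof (cases "j \<in> col \<tau> (Suc c)")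
    case True
    moreover have "i \<notin> col \<mu> (Suc c)"
      using that h v containedD horiz_contained vert_contained by blast
    ultimately show ?thesis
      using that horizD[OF h, of j c i] by (auto simp: new_rows_def)
  next
    case False
    then show ?thesis using that vertD(2)[OF v, of j c i] by (auto simp: new_rows_def)
  qed
  show ?thesis
    unfolding col_ok_def horiz_vert_mid_col[OF h v, symmetric] using 1 2 by auto
qed

text \<open>The inclusion in \<open>col_ok\<close> makes the columns prescribed by X nested, and the
  first one is an initial segment because its first new row is \<open>len \<mu>\<close>. For
  horizontality, the order condition in \<open>col_ok\<close> handles rows that are missing from the
  column of \<nu>, and the choice of \<open>first_row\<close> handles the others.\<close>

lemma horiz_vert_exists:
  assumes sub: "contained \<mu> \<nu>" and X: "X \<subseteq> new_cols \<mu> \<nu>"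
    and ok: "\<And>c. c \<in> new_cols \<mu> \<nu> \<Longrightarrow> col_ok \<mu> \<nu> c (0 < c \<and> c - 1 \<in> X)"
  obtains \<tau> where "horiz \<mu> \<tau>" "vert \<tau> \<nu>" "new_cols \<mu> \<tau> = X"
proof -
  define C where "C c = mid_col \<mu> \<nu> c (0 < c \<and> c - 1 \<in> X)" for c
  have C_Suc: "C (Suc c) = col \<mu> (Suc c) \<union> (if c \<in> X then {first_row \<mu> \<nu> c} else {})" for c
    by (simp add: C_def mid_col_def)
  have C_sup: "col \<mu> c \<subseteq> C c" for c
    by (auto simp: C_def mid_col_def)
  have R: "j \<in> C c" "i \<in> C c \<Longrightarrow> i \<notin> col \<nu> (Suc c) \<Longrightarrow> bef c j i" if "j \<in> new_rows \<mu> \<nu> c" for i j c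
    using ok[of c] that by (auto simp: col_ok_def C_def new_cols_def)
  have "C (Suc c) \<subseteq> C c" for c
    using C_sup[of c] col_Suc_subset[of \<mu> c] R(1)[of _ c] first_row_in[of c \<mu> \<nu>] X
    by (auto simp: C_Suc split: if_splits)
  moreover have "C (Suc 0) = {..<(if 0 \<in> X then Suc (len \<mu>) else len \<mu>)}"
  proof (cases "0 \<in> X")
    case True
    then have "first_row \<mu> \<nu> 0 = len \<mu>" using X first_row_0 by auto
    with True show ?thesis by (auto simp: C_Suc col_Suc_0)
  qed (simp add: C_Suc col_Suc_0)
  moreover have "C (Suc (csize \<mu> + csize \<nu>)) = {}"
  proof -
    have "csize \<mu> + csize \<nu> \<notin> new_cols \<mu> \<nu>"
      by (simp add: new_cols_def new_rows_def col_empty)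
    then show ?thesis using X by (auto simp: C_Suc col_empty)
  qed
  ultimately obtain \<tau> where \<tau>: "\<And>c. col \<tau> (Suc c) = C (Suc c)"
    by (rule composition_of_cols) blast
  then have \<tau>: "col \<tau> c = C c" for c
    by (cases c) (auto simp: C_def mid_col_def)
  have D: "new_rows \<mu> \<tau> c = (if c \<in> X then {first_row \<mu> \<nu> c} else {})" for c
    using first_row_in[of c \<mu> \<nu>] X by (auto simp: new_rows_def \<tau> C_Suc)
  have "horiz \<mu> \<tau>"
    unfolding horiz_def
  proof (intro allI conjI ballI)
    fix c j i assume j: "j \<in> new_rows \<mu> \<tau> c" and i: "i \<in> col \<tau> c - col \<mu> (Suc c)"
    have jf: "j = first_row \<mu> \<nu> c" "j \<in> new_rows \<mu> \<nu> c"
      using j X first_row_in[of c \<mu> \<nu>] by (auto simp: D split: if_splits)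
    show "i = j \<or> bef c j i"
    proof (cases "i \<in> col \<nu> (Suc c)")
      case True
      then show ?thesis using i jf first_row_bef[of i \<mu> \<nu> c] by (auto simp: new_rows_def)
    next
      case False
      then show ?thesis using i jf R(2)[of j c i] by (auto simp: \<tau>)
    qed
  qed (auto simp: \<tau> C_Suc)
  moreover have "vert \<tau> \<nu>"
    unfolding vert_def
  proof (intro allI conjI ballI)
    fix c
    show "col \<tau> (Suc c) \<subseteq> col \<nu> (Suc c)"
      using sub X first_row_in[of c \<mu> \<nu>]
      by (auto simp: \<tau> C_Suc contained_def new_rows_def split: if_splits)
    fix j assume "j \<in> new_rows \<tau> \<nu> c"
    then have j: "j \<in> new_rows \<mu> \<nu> c"
      by (auto simp: new_rows_def \<tau> C_Suc)
    then show "j \<in> col \<tau> c" using R(1) by (simp add: \<tau>)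
    fix i assume "i \<in> col \<tau> c - col \<nu> (Suc c)"
    then show "bef c j i" using R(2)[OF j] by (auto simp: \<tau>)
  qed
  moreover have "new_cols \<mu> \<tau> = X"
    by (auto simp: new_cols_def D)
  ultimately show thesis by (rule that)
qed

definition valid_cols :: "composition \<Rightarrow> composition \<Rightarrow> nat set set" where
  "valid_cols \<mu> \<nu> = {X. X \<subseteq> new_cols \<mu> \<nu> \<and>
     (\<forall>c\<in>new_cols \<mu> \<nu>. col_ok \<mu> \<nu> c (0 < c \<and> c - 1 \<in> X))}"

lemma bij_betw_horiz_vert:
  assumes "contained \<mu> \<nu>"
  shows "bij_betw (new_cols \<mu>) {\<tau>. horiz \<mu> \<tau> \<and> vert \<tau> \<nu>} (valid_cols \<mu> \<nu>)"
  unfolding bij_betw_def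
proof
  show "inj_on (new_cols \<mu>) {\<tau>. horiz \<mu> \<tau> \<and> vert \<tau> \<nu>}"
  proof (rule inj_onI, clarify)
    fix \<tau> \<epsilon> assume "horiz \<mu> \<tau>" "vert \<tau> \<nu>" "horiz \<mu> \<epsilon>" "vert \<epsilon> \<nu>" "new_cols \<mu> \<tau> = new_cols \<mu> \<epsilon>"
    then show "\<tau> = \<epsilon>"
      using horiz_vert_mid_col[of \<mu> \<tau> \<nu>] horiz_vert_mid_col[of \<mu> \<epsilon> \<nu>] by (intro col_inject) simp
  qed
  show "new_cols \<mu> ` {\<tau>. horiz \<mu> \<tau> \<and> vert \<tau> \<nu>} = valid_cols \<mu> \<nu>"
    using horiz_vert_col(2)[of \<mu> _ \<nu>] horiz_vert_col_ok[of \<mu> _ \<nu>]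
    by (fastforce simp: valid_cols_def elim: horiz_vert_exists[OF assms])
qed

lemma csize_horiz_vert:
  assumes "horiz \<mu> \<tau>" "vert \<tau> \<nu>"
  shows "csize \<tau> = csize \<mu> + card (new_cols \<mu> \<tau>)"
  using csize_contained[OF horiz_contained[OF assms(1)]] horiz_vert_col(1)[OF assms]
  by simp

section \<open>The sign-reversing involution\<close>

text \<open>When the product is expanded, X records the factors from which the subtracted term is
  taken. The terms separate because the condition at c sees X only through the truth value of its
  membership of c.\<close>

lemma sum_Pow_signed_prod:
  fixes P :: "'b \<Rightarrow> bool \<Rightarrow> bool"
  assumes "finite A"
  shows "(\<Sum>X\<in>Pow A. (-1) ^ card X * of_bool (\<forall>c\<in>A. P c (c \<in> X))) =
    (\<Prod>c\<in>A. of_bool (P c False) - of_bool (P c True) :: 'a::comm_ring_1)"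
  using assms
proof (induction A rule: finite_induct)
  case (insert a A)
  let ?w = "\<lambda>X. (-1) ^ card X * of_bool (\<forall>c\<in>A. P c (c \<in> X)) :: 'a"
  have "(\<Sum>X\<in>Pow (insert a A). (-1) ^ card X * of_bool (\<forall>c\<in>insert a A. P c (c \<in> X))) =
    (\<Sum>X\<in>Pow A. (-1) ^ card X * of_bool (\<forall>c\<in>insert a A. P c (c \<in> X)) :: 'a) +
    (\<Sum>X\<in>insert a ` Pow A. (-1) ^ card X * of_bool (\<forall>c\<in>insert a A. P c (c \<in> X)))"
    unfolding Pow_insert using insert by (intro sum.union_disjoint) auto
  also have "(\<Sum>X\<in>Pow A. (-1) ^ card X * of_bool (\<forall>c\<in>insert a A. P c (c \<in> X)) :: 'a) =
      (\<Sum>X\<in>Pow A. of_bool (P a False) * ?w X)"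
  proof (rule sum.cong)
    fix X assume "X \<in> Pow A"
    then have "a \<notin> X" using insert by auto
    then show "(-1) ^ card X * of_bool (\<forall>c\<in>insert a A. P c (c \<in> X)) = of_bool (P a False) * ?w X"
      by simp
  qed simp
  also have "(\<Sum>X\<in>insert a ` Pow A. (-1) ^ card X * of_bool (\<forall>c\<in>insert a A. P c (c \<in> X)) :: 'a) =
      (\<Sum>X\<in>Pow A. (-1) ^ card (insert a X) * of_bool (\<forall>c\<in>insert a A. P c (c \<in> insert a X)))"
    using insert by (subst sum.reindex) (auto simp: inj_on_def)
  also have "\<dots> = (\<Sum>X\<in>Pow A. - of_bool (P a True) * ?w X)"
  proof (rule sum.cong)
    fix X assume "X \<in> Pow A"
    then have X: "a \<notin> X" "finite X" using insert finite_subset by auto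
    have "c \<in> insert a X \<longleftrightarrow> c \<in> X" if "c \<in> A" for c
      using insert(2) that by auto
    then have "(\<forall>c\<in>A. P c (c \<in> insert a X)) \<longleftrightarrow> (\<forall>c\<in>A. P c (c \<in> X))"
      by simp
    then show "(-1) ^ card (insert a X) * of_bool (\<forall>c\<in>insert a A. P c (c \<in> insert a X)) =
        - of_bool (P a True) * ?w X"
      using X by simp
  qed simp
  finally show ?case
    unfolding sum_distrib_left[symmetric] insert.IH using insert.hyps by (simp add: left_diff_distrib)
qed simp

lemma prod_pm_one:
  assumes "finite A" "\<And>c. c \<in> A \<Longrightarrow> f c = (if P c then - of_bool (Q c) else of_bool (Q c))"
  shows "prod f A = (if \<forall>c\<in>A. Q c then (-1) ^ card {c \<in> A. P c} else 0 :: 'a::comm_ring_1)"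
  using assms
proof (induction A rule: finite_induct)
  case (insert a A)
  have "{c \<in> insert a A. P c} = (if P a then insert a {c \<in> A. P c} else {c \<in> A. P c})"
    by auto
  with insert show ?case by auto
qed simp

lemma sum_filter_of_bool:
  "finite A \<Longrightarrow> (\<Sum>X | X \<in> A \<and> (p \<and> Q X). f X) =
    (\<Sum>X\<in>A. of_bool p * (f X * of_bool (Q X)) :: 'a::comm_ring_1)"
  by (subst sum.inter_filter) (auto simp: of_bool_def intro!: sum.cong)

text \<open>The condition for the signed sum over \<open>valid_cols\<close> not to vanish: the sum is a product with one
  factor for each column of the shape, and the factor of column \<open>c\<close> compares the two values of
  \<open>col_ok\<close> for column \<open>c + 1\<close>.\<close>

definition border_strip_rows :: "composition \<Rightarrow> composition \<Rightarrow> bool" where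
  "border_strip_rows \<mu> \<nu> \<longleftrightarrow> contained \<mu> \<nu> \<and> \<mu> \<noteq> \<nu> \<and>
     (\<forall>c\<in>new_cols \<mu> \<nu>. c = 0 \<or> c - 1 \<notin> new_cols \<mu> \<nu> \<longrightarrow> col_ok \<mu> \<nu> c False) \<and>
     (\<forall>c\<in>new_cols \<mu> \<nu> - {Max (new_cols \<mu> \<nu>)}. Suc c \<in> new_cols \<mu> \<nu> \<and>
        (if first_row \<mu> \<nu> c \<in> new_rows \<mu> \<nu> (Suc c) then col_ok \<mu> \<nu> (Suc c) True
         else col_ok \<mu> \<nu> (Suc c) False \<and> (\<exists>j\<in>new_rows \<mu> \<nu> (Suc c). j < first_row \<mu> \<nu> c)))"

text \<open>In a nonvanishing product these are the columns with factor -1 instead of 1. They return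
  in the count of boxes by rows, which determines the final sign.\<close>

definition adjacent_cols :: "composition \<Rightarrow> composition \<Rightarrow> nat set" where
  "adjacent_cols \<mu> \<nu> = {c \<in> new_cols \<mu> \<nu>. first_row \<mu> \<nu> c \<in> new_rows \<mu> \<nu> (Suc c)}"

text \<open>If the first box of column c has a right neighbour in the shape, that neighbour needs c
  in X, so only the subtracted term can survive. Otherwise putting c into X merely adds the demand
  that all new rows of column c + 1 lie above the first row of column c, and the difference detects
  that this demand fails.\<close>

lemma col_ok_diff:
  assumes c: "c \<in> new_cols \<mu> \<nu>" and S: "Suc c \<in> new_cols \<mu> \<nu>"
  shows "of_bool (col_ok \<mu> \<nu> (Suc c) False) - of_bool (col_ok \<mu> \<nu> (Suc c) True) =
    (if first_row \<mu> \<nu> c \<in> new_rows \<mu> \<nu> (Suc c) then - of_bool (col_ok \<mu> \<nu> (Suc c) True)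
     else of_bool (col_ok \<mu> \<nu> (Suc c) False \<and>
       (\<exists>j\<in>new_rows \<mu> \<nu> (Suc c). j < first_row \<mu> \<nu> c)) :: 'a::comm_ring_1)"
proof -
  let ?f = "first_row \<mu> \<nu> c"
  have f: "?f \<in> col \<nu> (Suc c)" "?f \<notin> col \<mu> (Suc c)"
    using first_row_in[OF c] by (auto simp: new_rows_def)
  show ?thesis
  proof (cases "?f \<in> new_rows \<mu> \<nu> (Suc c)")
    case True
    then have "\<not> col_ok \<mu> \<nu> (Suc c) False"
      using f by (auto simp: col_ok_def mid_col_def)
    with True show ?thesis by simp
  next
    case False
    then have "?f \<notin> col \<nu> (Suc (Suc c))"
      using f col_Suc_subset[of \<mu> "Suc c"] by (auto simp: new_rows_def)
    then have "col_ok \<mu> \<nu> (Suc c) True \<longleftrightarrow>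
        col_ok \<mu> \<nu> (Suc c) False \<and> (\<forall>j\<in>new_rows \<mu> \<nu> (Suc c). ?f < j)"
      using False by (auto simp: col_ok_def mid_col_def bef_def)
    moreover have "(\<exists>j\<in>new_rows \<mu> \<nu> (Suc c). j < ?f) \<longleftrightarrow> \<not> (\<forall>j\<in>new_rows \<mu> \<nu> (Suc c). ?f < j)"
      using False by (metis linorder_neqE_nat order_less_asym)
    ultimately show ?thesis using False by auto
  qed
qed

lemma minus_one_power_diff:
  "m \<le> n \<Longrightarrow> (-1) ^ (n - m) = (-1 :: 'a::comm_ring_1) ^ (n + m)"
  by (simp add: minus_one_power_iff)

lemma finite_horiz_vert: "finite {\<tau>. horiz \<mu> \<tau> \<and> vert \<tau> \<nu>}"
proof (rule finite_subset)
  show "{\<tau>. horiz \<mu> \<tau> \<and> vert \<tau> \<nu>} \<subseteq> {\<tau>. csize \<tau> \<le> csize \<nu>}"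
    using csize_contained vert_contained by fastforce
qed (rule finite_csize_le)

lemma finite_valid_cols [simp]: "finite (valid_cols \<mu> \<nu>)"
  by (rule finite_subset[of _ "Pow (new_cols \<mu> \<nu>)"]) (auto simp: valid_cols_def)

text \<open>The strip from \<mu> to \<tau> has one box in each column of X, so its size is |X|, and
  the vertical strip that remains has |X| boxes fewer than the whole shape.\<close>

lemma sum_horiz_vert_valid_cols:
  fixes w :: "nat \<Rightarrow> 'a::comm_ring_1"
  assumes "contained \<mu> \<nu>"
  shows "(\<Sum>\<tau> | horiz \<mu> \<tau> \<and> vert \<tau> \<nu>. (-1) ^ (csize \<nu> - csize \<tau>) * w (csize \<tau> - csize \<mu>)) =
    (-1) ^ (csize \<nu> - csize \<mu>) * (\<Sum>X\<in>valid_cols \<mu> \<nu>. (-1) ^ card X * w (card X))"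
proof -
  have "(\<Sum>\<tau> | horiz \<mu> \<tau> \<and> vert \<tau> \<nu>. (-1) ^ (csize \<nu> - csize \<tau>) * w (csize \<tau> - csize \<mu>)) =
    (\<Sum>\<tau> | horiz \<mu> \<tau> \<and> vert \<tau> \<nu>. (-1) ^ (csize \<nu> - csize \<mu>) *
       ((-1) ^ card (new_cols \<mu> \<tau>) * w (card (new_cols \<mu> \<tau>))))"
  proof (rule sum.cong)
    fix \<tau> assume "\<tau> \<in> {\<tau>. horiz \<mu> \<tau> \<and> vert \<tau> \<nu>}"
    then have "csize \<tau> = csize \<mu> + card (new_cols \<mu> \<tau>)" "csize \<tau> \<le> csize \<nu>"
      using csize_horiz_vert csize_contained vert_contained by fastforce+
    then have "csize \<nu> - csize \<tau> = (csize \<nu> - csize \<mu>) - card (new_cols \<mu> \<tau>)"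
        "card (new_cols \<mu> \<tau>) \<le> csize \<nu> - csize \<mu>" "csize \<tau> - csize \<mu> = card (new_cols \<mu> \<tau>)"
      by auto
    then show "(-1) ^ (csize \<nu> - csize \<tau>) * w (csize \<tau> - csize \<mu>) =
      (-1) ^ (csize \<nu> - csize \<mu>) * ((-1) ^ card (new_cols \<mu> \<tau>) * w (card (new_cols \<mu> \<tau>)))"
      by (simp only: minus_one_power_diff power_add mult.assoc)
  qed simp
  also have "\<dots> = (\<Sum>X\<in>valid_cols \<mu> \<nu>. (-1) ^ (csize \<nu> - csize \<mu>) * ((-1) ^ card X * w (card X)))"
    by (rule sum.reindex_bij_betw[OF bij_betw_horiz_vert[OF assms]])
  finally show ?thesis by (simp add: sum_distrib_left)
qed

text \<open>Whether the last nonempty column belongs to \<open>X\<close> is irrelevant for the validity of \<open>X\<close>.\<close>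

lemma sum_valid_cols_toggle:
  fixes w :: "nat \<Rightarrow> 'a::comm_ring_1"
  assumes ne: "new_cols \<mu> \<nu> \<noteq> {}"
  defines "M \<equiv> Max (new_cols \<mu> \<nu>)"
  shows "(\<Sum>X\<in>valid_cols \<mu> \<nu>. (-1) ^ card X * w (card X)) =
    (\<Sum>X | X \<in> valid_cols \<mu> \<nu> \<and> M \<notin> X. (-1) ^ card X * (w (card X) - w (Suc (card X))))"
proof -
  let ?W = "{X. X \<in> valid_cols \<mu> \<nu> \<and> M \<notin> X}"
  have M: "M \<in> new_cols \<mu> \<nu>" "\<And>c. c \<in> new_cols \<mu> \<nu> \<Longrightarrow> c \<le> M"
    using ne by (auto simp: M_def)
  have toggle: "insert M X \<in> valid_cols \<mu> \<nu> \<longleftrightarrow> X \<in> valid_cols \<mu> \<nu>" for X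
  proof -
    \<comment> \<open>No column of the shape lies to the right of M, so M is never the left
      neighbour of one.\<close>
    have "0 < c \<and> c - 1 \<in> insert M X \<longleftrightarrow> 0 < c \<and> c - 1 \<in> X" if "c \<in> new_cols \<mu> \<nu>" for c
      using M(2)[OF that] by auto
    then show ?thesis using M(1) by (simp add: valid_cols_def)
  qed
  have eq: "valid_cols \<mu> \<nu> = ?W \<union> insert M ` ?W"
  proof (intro equalityI subsetI)
    fix X assume X: "X \<in> valid_cols \<mu> \<nu>"
    show "X \<in> ?W \<union> insert M ` ?W"
    proof (cases "M \<in> X")
      case True
      then have "X = insert M (X - {M})" by auto
      moreover from this have "X - {M} \<in> ?W" using X toggle[of "X - {M}"] by simp
      ultimately show ?thesis by blast
    qed (use X in simp)
  qed (use toggle in auto)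
  have fin: "finite ?W" by simp
  have "(\<Sum>X\<in>valid_cols \<mu> \<nu>. (-1) ^ card X * w (card X)) =
    (\<Sum>X\<in>?W. (-1) ^ card X * w (card X)) + (\<Sum>X\<in>insert M ` ?W. (-1) ^ card X * w (card X))"
    by (subst eq, rule sum.union_disjoint) (use fin in auto)
  also have "(\<Sum>X\<in>insert M ` ?W. (-1) ^ card X * w (card X)) =
      (\<Sum>X\<in>?W. (-1) ^ card (insert M X) * w (card (insert M X)))"
    by (subst sum.reindex) (auto simp: inj_on_def)
  also have "\<dots> = (\<Sum>X\<in>?W. - ((-1) ^ card X * w (Suc (card X))))"
  proof (rule sum.cong)
    fix X assume "X \<in> ?W"
    then have "finite X" "M \<notin> X"
      using finite_subset[OF _ finite_new_cols] by (auto simp: valid_cols_def)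
    then show "(-1) ^ card (insert M X) * w (card (insert M X)) = - ((-1) ^ card X * w (Suc (card X)))"
      by simp
  qed simp
  finally show ?thesis by (simp add: right_diff_distrib sum_subtractf sum_negf)
qed

text \<open>With constant weight the two sets of a toggled pair cancel. For \<mu> = \<nu> there is
  no column to toggle and the empty set alone is valid.\<close>

lemma vert_horiz_inverse:
  "(\<Sum>\<tau> | horiz \<mu> \<tau> \<and> vert \<tau> \<nu>. (-1) ^ (csize \<nu> - csize \<tau>)) =
    (if \<mu> = \<nu> then 1 else 0 :: 'a::comm_ring_1)"
proof (cases "contained \<mu> \<nu>")
  case True
  show ?thesis
  proof (cases "\<mu> = \<nu>")
    case False
    then have "new_cols \<mu> \<nu> \<noteq> {}" using contained_eqI True by blast
    then show ?thesis
      using sum_horiz_vert_valid_cols[OF True, of "\<lambda>_. 1 :: 'a"]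
        sum_valid_cols_toggle[of \<mu> \<nu> "\<lambda>_. 1 :: 'a"] False by simp
  next
    case eq: True
    have "valid_cols \<nu> \<nu> = {{}}" by (auto simp: valid_cols_def)
    then show ?thesis
      using sum_horiz_vert_valid_cols[OF True, of "\<lambda>_. 1 :: 'a"] eq by simp
  qed
next
  case False
  then have "{\<tau>. horiz \<mu> \<tau> \<and> vert \<tau> \<nu>} = {}"
    using contained_trans horiz_contained vert_contained by blast
  moreover have "\<mu> \<noteq> \<nu>" using False by (auto simp: contained_def)
  ultimately show ?thesis by (simp only: sum.empty if_False)
qed

text \<open>With weight |X| a toggled pair contributes |X| - (|X| + 1) = -1 times its sign, hence
  the summand 1 in the exponent. The other summands are the sign of the whole shape and one factor
  -1 for each adjacent column.\<close>

lemma vert_horiz_weighted: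
  "(\<Sum>\<tau> | horiz \<mu> \<tau> \<and> vert \<tau> \<nu>. (-1) ^ (csize \<nu> - csize \<tau>) * of_nat (csize \<tau> - csize \<mu>)) =
    (if border_strip_rows \<mu> \<nu> then (-1) ^ (csize \<nu> - csize \<mu> + 1 + card (adjacent_cols \<mu> \<nu>))
     else 0 :: 'a::comm_ring_1)"
proof (cases "contained \<mu> \<nu> \<and> \<mu> \<noteq> \<nu>")
  case True
  let ?J = "new_cols \<mu> \<nu>" and ?M = "Max (new_cols \<mu> \<nu>)" and ?f = "first_row \<mu> \<nu>"
  let ?start = "\<forall>c\<in>?J. c = 0 \<or> c - 1 \<notin> ?J \<longrightarrow> col_ok \<mu> \<nu> c False"
  let ?P = "\<lambda>c x. Suc c \<in> ?J \<longrightarrow> col_ok \<mu> \<nu> (Suc c) x"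
  let ?Q = "\<lambda>c. Suc c \<in> ?J \<and> (if ?f c \<in> new_rows \<mu> \<nu> (Suc c) then col_ok \<mu> \<nu> (Suc c) True
         else col_ok \<mu> \<nu> (Suc c) False \<and> (\<exists>j\<in>new_rows \<mu> \<nu> (Suc c). j < ?f c))"
  have ne: "?J \<noteq> {}" using contained_eqI True by blast
  have M: "?M \<in> ?J" "\<And>c. c \<in> ?J \<Longrightarrow> c \<le> ?M"
    using ne by auto
  \<comment> \<open>A column whose left neighbour is outside the shape imposes a condition free of
    X; any other column c + 1 imposes one that depends only on whether c lies in X.\<close>
  have W: "X \<in> valid_cols \<mu> \<nu> \<and> ?M \<notin> X \<longleftrightarrow>
      X \<in> Pow (?J - {?M}) \<and> (?start \<and> (\<forall>c\<in>?J - {?M}. ?P c (c \<in> X)))" for X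
  proof (cases "X \<in> Pow (?J - {?M})")
    case X: True
    have "(\<forall>c\<in>?J. col_ok \<mu> \<nu> c (0 < c \<and> c - 1 \<in> X)) \<longleftrightarrow> ?start \<and> (\<forall>c\<in>?J - {?M}. ?P c (c \<in> X))"
    proof (intro iffI conjI ballI impI)
      fix c assume *: "\<forall>c\<in>?J. col_ok \<mu> \<nu> c (0 < c \<and> c - 1 \<in> X)" and c: "c \<in> ?J"
        and "c = 0 \<or> c - 1 \<notin> ?J"
      then have "\<not> (0 < c \<and> c - 1 \<in> X)" using X by auto
      then show "col_ok \<mu> \<nu> c False" using * c by metis
    next
      fix c assume *: "\<forall>c\<in>?J. col_ok \<mu> \<nu> c (0 < c \<and> c - 1 \<in> X)" and "Suc c \<in> ?J"
      then show "col_ok \<mu> \<nu> (Suc c) (c \<in> X)" by fastforce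
    next
      fix c assume *: "?start \<and> (\<forall>c\<in>?J - {?M}. ?P c (c \<in> X))" and c: "c \<in> ?J"
      show "col_ok \<mu> \<nu> c (0 < c \<and> c - 1 \<in> X)"
      proof (cases "0 < c \<and> c - 1 \<in> ?J")
        case True
        then obtain d where d: "c = Suc d" "d \<in> ?J - {?M}"
          using M(2)[OF c] by (cases c) auto
        then show ?thesis using * c by auto
      next
        case False
        then have "\<not> (0 < c \<and> c - 1 \<in> X)" using X by auto
        moreover have "col_ok \<mu> \<nu> c False" using * c False by auto
        ultimately show ?thesis by (simp only: simp_thms)
      qed
    qed
    then show ?thesis using X by (auto simp: valid_cols_def)
  qed (auto simp: valid_cols_def)
  have "(\<Sum>\<tau> | horiz \<mu> \<tau> \<and> vert \<tau> \<nu>. (-1) ^ (csize \<nu> - csize \<tau>) * of_nat (csize \<tau> - csize \<mu>)) =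
      (-1) ^ (csize \<nu> - csize \<mu> + 1) * (\<Sum>X | X \<in> valid_cols \<mu> \<nu> \<and> ?M \<notin> X. (-1) ^ card X :: 'a)"
    using sum_horiz_vert_valid_cols[of \<mu> \<nu> "of_nat :: nat \<Rightarrow> 'a"]
      sum_valid_cols_toggle[OF ne, of "of_nat :: nat \<Rightarrow> 'a"] True
    by (simp add: sum_negf)
  also have "(\<Sum>X | X \<in> valid_cols \<mu> \<nu> \<and> ?M \<notin> X. (-1) ^ card X :: 'a) =
      (\<Sum>X\<in>Pow (?J - {?M}). of_bool ?start * ((-1) ^ card X * of_bool (\<forall>c\<in>?J - {?M}. ?P c (c \<in> X))))"
    unfolding W by (rule sum_filter_of_bool) simp
  also have "\<dots> = of_bool ?start * (\<Prod>c\<in>?J - {?M}. of_bool (?P c False) - of_bool (?P c True))"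
    by (subst sum_distrib_left[symmetric],
        subst sum_Pow_signed_prod[of "?J - {?M}" ?P, OF finite_Diff[OF finite_new_cols]]) (rule refl)
  \<comment> \<open>If column c + 1 is empty, no condition involves the choice at c, and the factor
    is 1 - 1 = 0. This forces the columns of the shape to form an interval.\<close>
  also have "(\<Prod>c\<in>?J - {?M}. of_bool (?P c False) - of_bool (?P c True) :: 'a) =
      (if \<forall>c\<in>?J - {?M}. ?Q c then
        (-1) ^ card {c \<in> ?J - {?M}. ?f c \<in> new_rows \<mu> \<nu> (Suc c)} else 0)"
  proof (rule prod_pm_one)
    fix c assume c: "c \<in> ?J - {?M}"
    show "of_bool (?P c False) - of_bool (?P c True) =
      (if ?f c \<in> new_rows \<mu> \<nu> (Suc c) then - of_bool (?Q c) else of_bool (?Q c) :: 'a)"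
      using col_ok_diff[of c \<mu> \<nu>, where 'a = 'a] c by (cases "Suc c \<in> ?J") simp_all
  qed simp
  also have "{c \<in> ?J - {?M}. ?f c \<in> new_rows \<mu> \<nu> (Suc c)} = adjacent_cols \<mu> \<nu>"
  proof -
    have "Suc ?M \<notin> ?J" using M(2)[of "Suc ?M"] by (metis Suc_n_not_le_n)
    then have "new_rows \<mu> \<nu> (Suc ?M) = {}" by (simp add: new_cols_def)
    then show ?thesis by (auto simp: adjacent_cols_def)
  qed
  finally have "(\<Sum>\<tau> | horiz \<mu> \<tau> \<and> vert \<tau> \<nu>. (-1) ^ (csize \<nu> - csize \<tau>) * of_nat (csize \<tau> - csize \<mu>)) =
      (-1) ^ (csize \<nu> - csize \<mu> + 1) * (of_bool ?start * (if \<forall>c\<in>?J - {?M}. ?Q c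
        then (-1) ^ card (adjacent_cols \<mu> \<nu>) else 0 :: 'a))" .
  moreover have "border_strip_rows \<mu> \<nu> \<longleftrightarrow> ?start \<and> (\<forall>c\<in>?J - {?M}. ?Q c)"
    unfolding border_strip_rows_def using True by satx
  moreover have "x * (of_bool p * (if q then y else 0)) = (if p \<and> q then x * y else 0)"
    for x y :: 'a and p q by simp
  ultimately show ?thesis by (simp only: power_add)
next
  case False
  then have "\<not> border_strip_rows \<mu> \<nu>" by (auto simp: border_strip_rows_def)
  moreover have "(\<Sum>\<tau> | horiz \<mu> \<tau> \<and> vert \<tau> \<nu>.
      (-1) ^ (csize \<nu> - csize \<tau>) * of_nat (csize \<tau> - csize \<mu>)) = (0 :: 'a)"
  proof (cases "\<mu> = \<nu>")
    case True
    then have "\<tau> = \<mu>" if "horiz \<mu> \<tau>" "vert \<tau> \<nu>" for \<tau>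
      using that horiz_contained vert_contained by (metis contained_def col_inject subset_antisym)
    then have "csize \<tau> - csize \<mu> = 0" if "horiz \<mu> \<tau>" "vert \<tau> \<nu>" for \<tau>
      using that by fastforce
    then show ?thesis by (intro sum.neutral) simp
  next
    case ne: False
    then have "{\<tau>. horiz \<mu> \<tau> \<and> vert \<tau> \<nu>} = {}"
      using False contained_trans horiz_contained vert_contained by blast
    then show ?thesis by (simp only: sum.empty)
  qed
  ultimately show ?thesis by simp
qed

section \<open>The order on compositions\<close>

lemma nth_parts_rowlen: "p < len \<mu> \<Longrightarrow> parts \<mu> ! p = rowlen \<mu> (len \<mu> - Suc p)"
  by (cases "len \<mu>") (auto simp: rowlen_def len_def rev_nth)

lemma csize_mono: "contained \<mu> \<nu> \<Longrightarrow> csize \<mu> \<le> csize \<nu>"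
  using csize_contained[of \<mu> \<nu>] by linarith

lemma csize_less: "contained \<mu> \<nu> \<Longrightarrow> \<mu> \<noteq> \<nu> \<Longrightarrow> csize \<mu> < csize \<nu>"
  using csize_mono[of \<mu> \<nu>] contained_csize_eq[of \<mu> \<nu>] by linarith

lemma rowlen_Cons:
  assumes "parts \<xi> = k # parts \<mu>"
  shows "rowlen \<xi> = (rowlen \<mu>)(len \<mu> := k)"
  using assms by (auto simp: rowlen_def len_def fun_eq_iff nth_append)

lemma parts_Cons:
  assumes "rowlen \<xi> = (rowlen \<mu>)(len \<mu> := k)" "0 < k"
  shows "parts \<xi> = k # parts \<mu>"
proof -
  have p: "parts (Comp (k # parts \<mu>)) = k # parts \<mu>"
    using assms(2) by (simp add: parts_Comp)
  then show ?thesis using rowlen_Cons[OF p] assms(1) by (metis rowlen_inject)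
qed

text \<open>Reversal turns the part with index p into row \<open>len \<mu> - Suc p\<close>. A new
  top row is the prolongation of row \<open>len \<mu>\<close>, which has length 0; any other box is
  put on the highest row of its length.\<close>

lemma cover_c_rowlen:
  "cover_c \<mu> \<xi> \<longleftrightarrow> (\<exists>j. rowlen \<xi> = (rowlen \<mu>)(j := Suc (rowlen \<mu> j)) \<and>
     (j = len \<mu> \<or> j < len \<mu> \<and> (\<forall>i>j. rowlen \<mu> i \<noteq> rowlen \<mu> j)))"
proof -
  have row: "rowlen \<xi> = (rowlen \<mu>)(len \<mu> := Suc (rowlen \<mu> (len \<mu>)))" if "parts \<xi> = 1 # parts \<mu>" for \<xi>
    using rowlen_Cons[OF that] by (simp add: rowlen_def)
  have box: "rowlen \<xi> = (rowlen \<mu>)(j := Suc (rowlen \<mu> j))"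
    if p: "p < len \<mu>" "parts \<xi> = (parts \<mu>)[p := parts \<mu> ! p + 1]" and j: "j = len \<mu> - Suc p" for \<xi> p j
  proof
    fix i
    have "len \<xi> = len \<mu>" using p(2) by (simp add: len_def)
    then show "rowlen \<xi> i = ((rowlen \<mu>)(j := Suc (rowlen \<mu> j))) i"
      using p j by (auto simp: rowlen_def len_def rev_nth nth_list_update)
  qed
  have cond: "(\<forall>k<p. parts \<mu> ! k \<noteq> parts \<mu> ! p) \<longleftrightarrow> (\<forall>i>j. rowlen \<mu> i \<noteq> rowlen \<mu> j)"
    if p: "p < len \<mu>" and j: "j = len \<mu> - Suc p" for p j
  proof -
    have pj: "parts \<mu> ! p = rowlen \<mu> j" using nth_parts_rowlen[OF p] j by simp
    have pos: "rowlen \<mu> j \<noteq> 0" using p j by simp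
    show ?thesis
    proof (intro iffI allI impI)
      fix i assume *: "\<forall>k<p. parts \<mu> ! k \<noteq> parts \<mu> ! p" and "i > j"
      show "rowlen \<mu> i \<noteq> rowlen \<mu> j"
      proof (cases "i < len \<mu>")
        case True
        then have "len \<mu> - Suc i < p" "len \<mu> - Suc (len \<mu> - Suc i) = i" using \<open>i > j\<close> j by auto
        then show ?thesis
          using * nth_parts_rowlen[of "len \<mu> - Suc i" \<mu>] p pj by (metis order.strict_trans)
      next
        case False
        then have "rowlen \<mu> i = 0" by simp
        then show ?thesis using pos by metis
      qed
    next
      fix k assume *: "\<forall>i>j. rowlen \<mu> i \<noteq> rowlen \<mu> j" and "k < p"
      then have "len \<mu> - Suc k > j" using p j by auto
      then show "parts \<mu> ! k \<noteq> parts \<mu> ! p"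
        using * nth_parts_rowlen[of k \<mu>] \<open>k < p\<close> p pj by (metis order.strict_trans)
    qed
  qed
  show ?thesis
  proof
    assume "cover_c \<mu> \<xi>"
    then consider "parts \<xi> = 1 # parts \<mu>"
      | p where "p < len \<mu>" "parts \<xi> = (parts \<mu>)[p := parts \<mu> ! p + 1]" "\<forall>k<p. parts \<mu> ! k \<noteq> parts \<mu> ! p"
      by (auto simp: cover_c_def)
    then show "\<exists>j. rowlen \<xi> = (rowlen \<mu>)(j := Suc (rowlen \<mu> j)) \<and>
        (j = len \<mu> \<or> j < len \<mu> \<and> (\<forall>i>j. rowlen \<mu> i \<noteq> rowlen \<mu> j))"
    proof cases
      case 1
      then show ?thesis using row by blast
    next
      case (2 p)
      then have "len \<mu> - Suc p < len \<mu>" by auto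
      then show ?thesis using box[OF 2(1,2) refl] cond[OF 2(1) refl] 2(3) by blast
    qed
  next
    assume "\<exists>j. rowlen \<xi> = (rowlen \<mu>)(j := Suc (rowlen \<mu> j)) \<and>
        (j = len \<mu> \<or> j < len \<mu> \<and> (\<forall>i>j. rowlen \<mu> i \<noteq> rowlen \<mu> j))"
    then obtain j where g: "rowlen \<xi> = (rowlen \<mu>)(j := Suc (rowlen \<mu> j))"
      and j: "j = len \<mu> \<or> j < len \<mu> \<and> (\<forall>i>j. rowlen \<mu> i \<noteq> rowlen \<mu> j)" by blast
    show "cover_c \<mu> \<xi>"
    proof (cases "j = len \<mu>")
      case True
      have "parts \<xi> = 1 # parts \<mu>"
        by (rule parts_Cons) (use g True in \<open>simp_all add: rowlen_def\<close>)
      then show ?thesis by (simp add: cover_c_def)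
    next
      case False
      define p where "p = len \<mu> - Suc j"
      have pj: "p < len \<mu>" "j = len \<mu> - Suc p" using j False by (auto simp: p_def)
      let ?xs = "(parts \<mu>)[p := parts \<mu> ! p + 1]"
      have p: "parts (Comp ?xs) = ?xs"
        by (rule parts_Comp) (auto dest: set_update_subset_insert[THEN subsetD])
      have "rowlen (Comp ?xs) = rowlen \<xi>"
        using box[OF pj(1) p pj(2)] g by simp
      then have "parts \<xi> = ?xs" using p by (simp add: rowlen_inject)
      then show ?thesis
        using pj cond[OF pj] j False unfolding cover_c_def by blast
    qed
  qed
qed

lemma cover_c_col:
  assumes "cover_c \<mu> \<xi>"
  obtains c j where "\<And>d. col \<xi> (Suc d) = col \<mu> (Suc d) \<union> (if d = c then {j} else {})"
    "j \<notin> col \<mu> (Suc c)" "\<And>i. 0 < c \<Longrightarrow> j < i \<Longrightarrow> i \<in> col \<mu> c \<Longrightarrow> i \<in> col \<mu> (Suc c)"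
proof -
  obtain j where g: "rowlen \<xi> = (rowlen \<mu>)(j := Suc (rowlen \<mu> j))"
      and j: "j = len \<mu> \<or> j < len \<mu> \<and> (\<forall>i>j. rowlen \<mu> i \<noteq> rowlen \<mu> j)"
    using assms unfolding cover_c_rowlen by blast
  show thesis
  proof (rule that)
    show "col \<xi> (Suc d) = col \<mu> (Suc d) \<union> (if d = rowlen \<mu> j then {j} else {})" for d
      by (auto simp: col_def g)
    show "j \<notin> col \<mu> (Suc (rowlen \<mu> j))" by (simp add: col_def)
    fix i assume i: "0 < rowlen \<mu> j" "j < i" "i \<in> col \<mu> (rowlen \<mu> j)"
    then have "rowlen \<mu> i \<noteq> rowlen \<mu> j" using j by auto
    then show "i \<in> col \<mu> (Suc (rowlen \<mu> j))" using i by (simp add: col_def)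
  qed
qed

lemma cover_c_exists:
  assumes "j \<in> col \<mu> c" "j \<notin> col \<mu> (Suc c)" "c = 0 \<Longrightarrow> j = len \<mu>"
    "\<And>i. 0 < c \<Longrightarrow> j < i \<Longrightarrow> i \<in> col \<mu> c \<Longrightarrow> i \<in> col \<mu> (Suc c)"
  obtains \<xi> where "cover_c \<mu> \<xi>" "\<And>d. col \<xi> (Suc d) = col \<mu> (Suc d) \<union> (if d = c then {j} else {})"
proof -
  have c: "rowlen \<mu> j = c" using assms(1,2) by (simp add: col_def)
  let ?f = "(rowlen \<mu>)(j := Suc (rowlen \<mu> j))"
  have j: "j = len \<mu> \<or> j < len \<mu> \<and> (\<forall>i>j. rowlen \<mu> i \<noteq> rowlen \<mu> j)"
  proof (cases "c = 0")
    case False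
    then have "rowlen \<mu> i \<noteq> rowlen \<mu> j" if "i > j" for i
      using assms(4)[of i] that c by (auto simp: col_def)
    then show ?thesis using False c by (metis gr0I rowlen_pos_iff)
  qed (use assms in simp)
  have "0 < ?f i \<longleftrightarrow> i < (if j = len \<mu> then Suc (len \<mu>) else len \<mu>)" for i
    using j by auto
  then obtain \<xi> where g: "rowlen \<xi> = ?f" by (rule rowlen_of_fun)
  show thesis
  proof (rule that)
    show "cover_c \<mu> \<xi>" unfolding cover_c_rowlen using g j by blast
    show "col \<xi> (Suc d) = col \<mu> (Suc d) \<union> (if d = c then {j} else {})" for d
      by (auto simp: col_def g c)
  qed
qed

text \<open>The trace of the order on a shape: a box enters column c only when no higher row ends
  just before that column, so every higher row of \<mu> that reaches this point has been prolonged
  by then.\<close>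

definition rows_above_full :: "composition \<Rightarrow> composition \<Rightarrow> bool" where
  "rows_above_full \<mu> \<nu> \<longleftrightarrow>
     (\<forall>c>0. \<forall>j\<in>new_rows \<mu> \<nu> c. \<forall>i>j. i \<in> col \<mu> c \<longrightarrow> i \<in> col \<nu> (Suc c))"

lemma less_cD:
  assumes "less_c \<mu> \<nu>"
  shows "contained \<mu> \<nu>" "\<mu> \<noteq> \<nu>" "rows_above_full \<mu> \<nu>"
proof -
  have cov: "contained \<mu> \<nu> \<and> csize \<mu> < csize \<nu> \<and> rows_above_full \<mu> \<nu>" if cover: "cover_c \<mu> \<nu>" for \<mu> \<nu>
  proof -
    obtain c j where c: "\<And>d. col \<nu> (Suc d) = col \<mu> (Suc d) \<union> (if d = c then {j} else {})"
    "j \<notin> col \<mu> (Suc c)" "\<And>i. 0 < c \<Longrightarrow> j < i \<Longrightarrow> i \<in> col \<mu> c \<Longrightarrow> i \<in> col \<mu> (Suc c)"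
      using cover_c_col[OF cover] by metis
    have con: "contained \<mu> \<nu>" by (rule containedI) (auto simp: c(1))
    moreover have "\<mu> \<noteq> \<nu>"
      using c(1)[of c] c(2) by auto
    moreover have "rows_above_full \<mu> \<nu>"
      using c by (auto simp: rows_above_full_def new_rows_def split: if_splits)
    ultimately show ?thesis using csize_less by simp
  qed
  have "contained \<mu> \<nu> \<and> csize \<mu> < csize \<nu> \<and> rows_above_full \<mu> \<nu>"
    using assms unfolding less_c_def
  proof (induction rule: tranclp_induct)
    case (step \<xi> \<nu>)
    note cv = cov[OF step(2)]
    have "contained \<mu> \<nu>" using step cv contained_trans by blast
    moreover have "rows_above_full \<mu> \<nu>"
      unfolding rows_above_full_def
    proof (intro allI impI ballI)
      fix c j i assume c: "0 < c" "j \<in> new_rows \<mu> \<nu> c" "j < i" "i \<in> col \<mu> c"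
      show "i \<in> col \<nu> (Suc c)"
      proof (cases "j \<in> col \<xi> (Suc c)")
        case True
        then have "j \<in> new_rows \<mu> \<xi> c" using c by (simp add: new_rows_def)
        then have "i \<in> col \<xi> (Suc c)" using step c by (auto simp: rows_above_full_def)
        then show ?thesis using cv by (auto simp: contained_def)
      next
        case False
        then have "j \<in> new_rows \<xi> \<nu> c" using c by (simp add: new_rows_def)
        moreover have "i \<in> col \<xi> c" using step c by (auto simp: contained_def)
        ultimately show ?thesis using cv c by (auto simp: rows_above_full_def)
      qed
    qed
    ultimately show ?case using step cv by auto
  qed (rule cov)
  then show "contained \<mu> \<nu>" "\<mu> \<noteq> \<nu>" "rows_above_full \<mu> \<nu>" by auto
qed

text \<open>Both row conditions on nc border strips in one: \<open>bef\<close> starts at the bottom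
  in the first column and at the top in the others, so the box that may have a right neighbour is
  always the first one.\<close>

definition overlaps_first :: "composition \<Rightarrow> composition \<Rightarrow> bool" where
  "overlaps_first \<mu> \<nu> \<longleftrightarrow>
     (\<forall>c. new_rows \<mu> \<nu> c \<inter> new_rows \<mu> \<nu> (Suc c) \<subseteq> {first_row \<mu> \<nu> c})"

text \<open>Starting from \<open>\<mu>\<close>, one adds the first box of the leftmost column whose first box has a right
  neighbour in the shape, or of the last column if there is no such column.\<close>

lemma less_cI:
  assumes "contained \<mu> \<nu>" "\<mu> \<noteq> \<nu>" "rows_above_full \<mu> \<nu>" "overlaps_first \<mu> \<nu>"
  shows "less_c \<mu> \<nu>"
  using assms
proof (induction "csize \<nu> - csize \<mu>" arbitrary: \<mu> rule: less_induct)
  case less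
  let ?R = "new_rows \<mu> \<nu>" and ?f = "first_row \<mu> \<nu>" and ?A = "adjacent_cols \<mu> \<nu>"
  have ne: "new_cols \<mu> \<nu> \<noteq> {}" using less contained_eqI by blast
  have finA: "finite ?A" by (simp add: adjacent_cols_def)
  define c where "c = (if ?A \<noteq> {} then Min ?A else Max (new_cols \<mu> \<nu>))"
  have cA: "c \<in> ?A" "\<And>d. d \<in> ?A \<Longrightarrow> c \<le> d" if "?A \<noteq> {}"
    using that finA by (simp_all add: c_def)
  have cM: "c \<in> new_cols \<mu> \<nu>" "\<And>d. d \<in> new_cols \<mu> \<nu> \<Longrightarrow> d \<le> c" if "?A = {}"
    using that ne by (simp_all add: c_def)
  have cJ: "c \<in> new_cols \<mu> \<nu>"
    using cA(1) cM(1) by (cases "?A = {}") (auto simp: adjacent_cols_def)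
  define j where "j = ?f c"
  have jR: "j \<in> ?R c" using first_row_in[OF cJ] by (simp add: j_def)
  \<comment> \<open>If the left neighbour were missing in \<mu>, both boxes would be new and the
    left one would be the first of its column. That column would then be adjacent and to the left of
    c, against the choice of c.\<close>
  have 1: "j \<in> col \<mu> c"
  proof (cases c)
    case (Suc d)
    show ?thesis
    proof (rule ccontr)
      assume "j \<notin> col \<mu> c"
      then have jd: "j \<in> ?R d" using jR Suc col_Suc_subset[of \<nu> c] by (auto simp: new_rows_def)
      then have "j = ?f d" using less.prems(4) jR Suc by (auto simp: overlaps_first_def)
      then have "d \<in> ?A" using jd jR Suc by (auto simp: adjacent_cols_def new_cols_def)
      then show False using cA(2)[of d] Suc by auto
    qed
  qed simp
  have 2: "c = 0 \<Longrightarrow> j = len \<mu>" using first_row_0 cJ by (simp add: j_def)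
  have 3: "i \<in> col \<mu> (Suc c)" if i: "0 < c" "j < i" "i \<in> col \<mu> c" for i
  proof (rule ccontr)
    assume "i \<notin> col \<mu> (Suc c)"
    moreover have "i \<in> col \<nu> (Suc c)"
      using less.prems(3) jR i by (auto simp: rows_above_full_def)
    ultimately have "i \<in> ?R c" by (simp add: new_rows_def)
    then show False using first_row_bef[of i \<mu> \<nu> c] i by (auto simp: j_def bef_def)
  qed
  have j_notin: "j \<notin> col \<mu> (Suc c)" using jR by (simp add: new_rows_def)
  obtain \<xi> where cov: "cover_c \<mu> \<xi>"
    and col: "\<And>d. col \<xi> (Suc d) = col \<mu> (Suc d) \<union> (if d = c then {j} else {})"
    by (rule cover_c_exists[OF 1 j_notin]) (use 2 3 in blast)+
  have R: "new_rows \<xi> \<nu> d = ?R d - (if d = c then {j} else {})" for d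
    by (auto simp: new_rows_def col)
  show ?case
  proof (cases "\<xi> = \<nu>")
    case True
    then show ?thesis using cov by (auto simp: less_c_def)
  next
    case False
    have sub: "contained \<xi> \<nu>"
      using less.prems(1) jR by (intro containedI) (auto simp: col new_rows_def contained_def)
    have "less_c \<mu> \<xi>" using cov by (auto simp: less_c_def)
    then have "contained \<mu> \<xi>" "\<mu> \<noteq> \<xi>" by (rule less_cD)+
    then have "csize \<mu> < csize \<xi>" "csize \<xi> \<le> csize \<nu>"
      using csize_less csize_mono sub by blast+
    then have lt: "csize \<nu> - csize \<xi> < csize \<nu> - csize \<mu>" by auto
    have "rows_above_full \<xi> \<nu>"
      unfolding rows_above_full_def
    proof (intro allI impI ballI)
      fix d k i assume d: "0 < d" "k \<in> new_rows \<xi> \<nu> d" "k < i" "i \<in> col \<xi> d"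
      show "i \<in> col \<nu> (Suc d)"
      proof (cases "i \<in> col \<mu> d")
        case True
        then show ?thesis using d less.prems(3) by (auto simp: rows_above_full_def R)
      next
        case False
        \<comment> \<open>Only row j newly reaches a column, namely c + 1. As a box is still to be
          added there, c is not the last column, so it was chosen as adjacent and row j is prolonged
          in \<nu>.\<close>
        then have i: "d = Suc c" "i = j" using d col[of "d - 1"] by (auto split: if_splits)
        have "?A \<noteq> {}"
        proof
          assume "?A = {}"
          moreover have "Suc c \<in> new_cols \<mu> \<nu>" using d i by (auto simp: R new_cols_def)
          ultimately show False using cM(2)[of "Suc c"] by auto
        qed
        then show ?thesis using cA(1) i by (auto simp: adjacent_cols_def j_def new_rows_def)
      qed
    qed
    \<comment> \<open>In column c the overlap with the next column was at most the box just added,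
      so it is now empty; in the other columns the first box is unchanged.\<close>
    moreover have "overlaps_first \<xi> \<nu>"
      unfolding overlaps_first_def
    proof
      fix d
      have "d \<noteq> c \<Longrightarrow> first_row \<xi> \<nu> d = ?f d" by (simp add: first_row_def R)
      then show "new_rows \<xi> \<nu> d \<inter> new_rows \<xi> \<nu> (Suc d) \<subseteq> {first_row \<xi> \<nu> d}"
        using less.prems(4) by (cases "d = c") (auto simp: overlaps_first_def R j_def)
    qed
    ultimately have "less_c \<xi> \<nu>" using less.hyps[OF lt sub False] by blast
    then show ?thesis
      using cov unfolding less_c_def by (rule tranclp_into_tranclp2[rotated])
  qed
qed

text \<open>Beyond the first column the order part of \<open>col_ok\<close> yields
  \<open>rows_above_full\<close>, and the inclusion part says that a new box with a new left
  neighbour sits in the first row of the preceding column. These are the hypotheses under which a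
  chain of covers exists. The last clause merges the two kinds of factor: an adjacent first box
  gives j = i, the other kind gives j < i.\<close>

lemma border_strip_rows_iff:
  "border_strip_rows \<mu> \<nu> \<longleftrightarrow> less_c \<mu> \<nu> \<and> overlaps_first \<mu> \<nu> \<and>
     (\<forall>c\<in>new_cols \<mu> \<nu> - {Max (new_cols \<mu> \<nu>)}. Suc c \<in> new_cols \<mu> \<nu> \<and>
        (\<exists>i\<in>new_rows \<mu> \<nu> c. \<exists>j\<in>new_rows \<mu> \<nu> (Suc c). j \<le> i))"
  (is "_ \<longleftrightarrow> _ \<and> _ \<and> ?link")
proof
  let ?J = "new_cols \<mu> \<nu>" and ?R = "new_rows \<mu> \<nu>" and ?f = "first_row \<mu> \<nu>"
  let ?M = "Max ?J"
  have M: "Suc ?M \<notin> ?J" "\<And>c. c \<in> ?J \<Longrightarrow> c \<le> ?M"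
    by (metis Max_ge Suc_n_not_le_n finite_new_cols) simp
  {
    assume b: "border_strip_rows \<mu> \<nu>"
    have step: "Suc c \<in> ?J" "?f c \<in> ?R (Suc c) \<Longrightarrow> col_ok \<mu> \<nu> (Suc c) True"
        "?f c \<notin> ?R (Suc c) \<Longrightarrow> col_ok \<mu> \<nu> (Suc c) False \<and> (\<exists>j\<in>?R (Suc c). j < ?f c)"
      if "c \<in> ?J" "c \<noteq> ?M" for c
      using b that unfolding border_strip_rows_def by auto
    have ov: "?R c \<inter> ?R (Suc c) \<subseteq> {?f c}" for c
    proof (cases "c \<in> ?J \<and> c \<noteq> ?M")
      case True
      then have "?R (Suc c) \<subseteq> col \<mu> (Suc c) \<union> {?f c}"
        using step(2,3)[of c] by (cases "?f c \<in> ?R (Suc c)") (auto simp: col_ok_def mid_col_def)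
      then show ?thesis by (auto simp: new_rows_def)
    next
      case False
      then have "?R c = {} \<or> ?R (Suc c) = {}" using M(1) by (auto simp: new_cols_def)
      then show ?thesis by auto
    qed
    have "rows_above_full \<mu> \<nu>"
      unfolding rows_above_full_def
    proof (intro allI impI ballI)
      fix c j i assume c: "0 < c" "j \<in> ?R c" "j < i" "i \<in> col \<mu> c"
      then have cJ: "c \<in> ?J" by (auto simp: new_cols_def)
      have "\<exists>x. col_ok \<mu> \<nu> c x"
      proof (cases "c - 1 \<in> ?J")
        case True
        moreover have "c - 1 \<noteq> ?M" using M(2)[OF cJ] c by auto
        ultimately show ?thesis using step(2,3)[of "c - 1"] c by auto
      next
        case False
        then show ?thesis using b cJ by (auto simp: border_strip_rows_def)
      qed
      then obtain x where x: "col_ok \<mu> \<nu> c x" ..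
      show "i \<in> col \<nu> (Suc c)"
      proof (rule ccontr)
        assume "i \<notin> col \<nu> (Suc c)"
        then have "i \<in> mid_col \<mu> \<nu> c x - col \<nu> (Suc c)" using c by (simp add: mid_col_def)
        then have "bef c j i" using x c unfolding col_ok_def by blast
        then show False using c by (simp add: bef_def)
      qed
    qed
    moreover have ?link
    proof (intro ballI conjI)
      fix c assume "c \<in> ?J - {?M}"
      then have c: "c \<in> ?J" "c \<noteq> ?M" by auto
      show "Suc c \<in> ?J" by (rule step(1)[OF c])
      show "\<exists>i\<in>?R c. \<exists>j\<in>?R (Suc c). j \<le> i"
        using step(3)[OF c] first_row_in[OF c(1)] by (cases "?f c \<in> ?R (Suc c)") (auto intro: less_imp_le)
    qed
    ultimately show "less_c \<mu> \<nu> \<and> overlaps_first \<mu> \<nu> \<and> ?link"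
      using ov b less_cI[of \<mu> \<nu>] unfolding overlaps_first_def border_strip_rows_def by blast
  }
  assume *: "less_c \<mu> \<nu> \<and> overlaps_first \<mu> \<nu> \<and> ?link"
  then have L: "contained \<mu> \<nu>" "\<mu> \<noteq> \<nu>" "rows_above_full \<mu> \<nu>"
    using less_cD by blast+
  have ov: "?R c \<inter> ?R (Suc c) \<subseteq> {?f c}" for c
    using * by (simp add: overlaps_first_def)
  have bef: "bef c j i" if "j \<in> ?R c" "i \<in> col \<mu> c" "i \<notin> col \<nu> (Suc c)" for c j i
  proof (cases "c = 0")
    case True
    then show ?thesis using that by (auto simp: bef_def new_rows_def col_Suc_0)
  next
    case False
    then have "\<not> j < i" "i \<noteq> j"
      using that L(3) by (auto simp: rows_above_full_def new_rows_def)
    then show ?thesis using False by (simp add: bef_def)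
  qed
  have inR: "j \<in> col \<mu> (Suc c) \<or> j \<in> ?R c" if "j \<in> ?R (Suc c)" for j c
    using that col_Suc_subset[of \<nu> "Suc c"] by (auto simp: new_rows_def)
  show "border_strip_rows \<mu> \<nu>"
    unfolding border_strip_rows_def
  proof (intro conjI ballI impI)
    show "contained \<mu> \<nu>" "\<mu> \<noteq> \<nu>" by (fact L)+
  next
    fix c assume c: "c \<in> ?J" "c = 0 \<or> c - 1 \<notin> ?J"
    have "?R c \<subseteq> col \<mu> c"
      using c inR[of _ "c - 1"] by (cases c) (auto simp: new_cols_def)
    then show "col_ok \<mu> \<nu> c False"
      using bef by (auto simp: col_ok_def mid_col_def)
  next
    fix c assume "c \<in> ?J - {?M}"
    then have c: "c \<in> ?J" and S: "Suc c \<in> ?J" and e: "\<exists>i\<in>?R c. \<exists>j\<in>?R (Suc c). j \<le> i"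
      using * by auto
    show "Suc c \<in> ?J" by (fact S)
    show "if ?f c \<in> ?R (Suc c) then col_ok \<mu> \<nu> (Suc c) True
         else col_ok \<mu> \<nu> (Suc c) False \<and> (\<exists>j\<in>?R (Suc c). j < ?f c)"
    proof (cases "?f c \<in> ?R (Suc c)")
      case True
      have "?R (Suc c) \<subseteq> col \<mu> (Suc c) \<union> {?f c}" using inR ov by blast
      moreover have "?f c \<in> col \<nu> (Suc (Suc c))" using True by (simp add: new_rows_def)
      ultimately have "col_ok \<mu> \<nu> (Suc c) True"
        using bef by (auto simp: col_ok_def mid_col_def)
      with True show ?thesis by simp
    next
      case False
      have sub: "?R (Suc c) \<subseteq> col \<mu> (Suc c)" using inR ov False by blast
      obtain i j where ij: "i \<in> ?R c" "j \<in> ?R (Suc c)" "j \<le> i" using e by blast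
      \<comment> \<open>In the first column the first new row is the lowest, so j \<le> i does not
        suffice; but row j belongs to \<mu> and hence lies below row \<open>len \<mu>\<close>. In
        later columns the first new row is the highest.\<close>
      have "j < ?f c"
      proof (cases "c = 0")
        case True
        then show ?thesis using ij sub c first_row_0[of \<mu> \<nu>] by (auto simp: col_Suc_0)
      next
        case False
        then have "j \<le> ?f c" using first_row_bef[OF ij(1)] ij by (auto simp: bef_def)
        moreover have "j \<noteq> ?f c" using \<open>?f c \<notin> ?R (Suc c)\<close> ij by auto
        ultimately show ?thesis by simp
      qed
      moreover have "col_ok \<mu> \<nu> (Suc c) False"
        using bef sub by (auto simp: col_ok_def mid_col_def)
      ultimately show ?thesis using False ij by auto
    qed
  qed
qed

section \<open>Border strips without north-east columns\<close>

lemma mem_diagram: "(i, c) \<in> diagram \<mu> \<longleftrightarrow> 1 \<le> i \<and> i \<le> len \<mu> \<and> 1 \<le> c \<and> len \<mu> - i \<in> col \<mu> c"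
  using nth_parts_rowlen[of "i - 1" \<mu>] by (auto simp: diagram_def col_def)

text \<open>Row i from the top of \<nu> is row \<open>len \<nu> - i\<close> from the bottom. Moving
  \<mu> down aligns the bottom rows, so the shift disappears in the latter index.\<close>

lemma mem_skew_shape:
  assumes "contained \<mu> \<nu>"
  shows "(i, c) \<in> skew_shape \<nu> \<mu> \<longleftrightarrow> 1 \<le> i \<and> i \<le> len \<nu> \<and> 1 \<le> c \<and> len \<nu> - i \<in> new_rows \<mu> \<nu> (c - 1)"
proof -
  have "{..<len \<mu>} \<subseteq> {..<len \<nu>}"
    using assms unfolding contained_def col_Suc_0[symmetric] by blast
  then have le: "len \<mu> \<le> len \<nu>" by simp
  have "(i, c) \<in> (\<lambda>(i, c). (i + (len \<nu> - len \<mu>), c)) ` diagram \<mu> \<longleftrightarrow>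
      (i - (len \<nu> - len \<mu>), c) \<in> diagram \<mu> \<and> len \<nu> - len \<mu> \<le> i"
    by (force simp: image_iff)
  also have "\<dots> \<longleftrightarrow> 1 \<le> c \<and> len \<nu> - i \<in> col \<mu> c" if "1 \<le> i" "i \<le> len \<nu>"
  proof (cases "len \<nu> - len \<mu> < i")
    case True
    then have "len \<mu> - (i - (len \<nu> - len \<mu>)) = len \<nu> - i" using le that by auto
    then show ?thesis using True le that by (auto simp: mem_diagram)
  next
    case False
    then have "\<not> len \<nu> - i < len \<mu>" using le that by auto
    then have "len \<nu> - i \<notin> col \<mu> (Suc 0)" by (simp add: col_Suc_0)
    then have "1 \<le> c \<Longrightarrow> len \<nu> - i \<notin> col \<mu> c" using col_antimono[of 1 c \<mu>] by auto
    then show ?thesis using False by (auto simp: mem_diagram)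
  qed
  finally have "1 \<le> i \<Longrightarrow> i \<le> len \<nu> \<Longrightarrow> (i, c) \<in> (\<lambda>(i, c). (i + (len \<nu> - len \<mu>), c)) ` diagram \<mu> \<longleftrightarrow>
      1 \<le> c \<and> len \<nu> - i \<in> col \<mu> c" .
  then show ?thesis
    unfolding skew_shape_def Diff_iff mem_diagram new_rows_def by (cases c) auto
qed

lemma mem_skew_shape_Suc:
  assumes "contained \<mu> \<nu>" "k < len \<nu>"
  shows "(len \<nu> - k, Suc c) \<in> skew_shape \<nu> \<mu> \<longleftrightarrow> k \<in> new_rows \<mu> \<nu> c"
  using assms by (auto simp: mem_skew_shape)

lemma new_rows_less: "k \<in> new_rows \<mu> \<nu> c \<Longrightarrow> k < len \<nu>"
  using col_antimono[of "Suc 0" "Suc c" \<nu>] by (auto simp: new_rows_def col_Suc_0)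

lemma skew_shape_image:
  assumes "contained \<mu> \<nu>"
  shows "skew_shape \<nu> \<mu> = (\<lambda>(c, k). (len \<nu> - k, Suc c)) ` (SIGMA c : new_cols \<mu> \<nu>. new_rows \<mu> \<nu> c)"
proof (intro equalityI subsetI)
  fix x assume "x \<in> skew_shape \<nu> \<mu>"
  then obtain i c where x: "x = (i, Suc c)" "1 \<le> i" "i \<le> len \<nu>" "len \<nu> - i \<in> new_rows \<mu> \<nu> c"
    by (cases x) (auto simp: mem_skew_shape[OF assms] gr0_conv_Suc Suc_le_eq)
  then have "x = (\<lambda>(c, k). (len \<nu> - k, Suc c)) (c, len \<nu> - i)" by simp
  moreover have "(c, len \<nu> - i) \<in> (SIGMA c : new_cols \<mu> \<nu>. new_rows \<mu> \<nu> c)"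
    using x by (auto simp: new_cols_def)
  ultimately show "x \<in> (\<lambda>(c, k). (len \<nu> - k, Suc c)) ` (SIGMA c : new_cols \<mu> \<nu>. new_rows \<mu> \<nu> c)"
    by (rule image_eqI)
next
  fix x assume "x \<in> (\<lambda>(c, k). (len \<nu> - k, Suc c)) ` (SIGMA c : new_cols \<mu> \<nu>. new_rows \<mu> \<nu> c)"
  then obtain c k where x: "x = (len \<nu> - k, Suc c)" "k \<in> new_rows \<mu> \<nu> c" by auto
  then show "x \<in> skew_shape \<nu> \<mu>"
    using mem_skew_shape_Suc[OF assms] new_rows_less by simp
qed

lemma card_skew_shape:
  assumes "contained \<mu> \<nu>"
  shows "card (skew_shape \<nu> \<mu>) = csize \<nu> - csize \<mu>"
proof -
  have "inj_on (\<lambda>(c, k). (len \<nu> - k, Suc c)) (SIGMA c : new_cols \<mu> \<nu>. new_rows \<mu> \<nu> c)"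
    by (auto intro!: inj_onI dest!: new_rows_less)
  then show ?thesis
    by (simp add: skew_shape_image[OF assms] card_image csize_contained[OF assms])
qed

lemma rows_skew_shape:
  assumes "contained \<mu> \<nu>"
  shows "card (fst ` skew_shape \<nu> \<mu>) = card (\<Union>c\<in>new_cols \<mu> \<nu>. new_rows \<mu> \<nu> c)"
proof -
  have "fst ` skew_shape \<nu> \<mu> = (\<lambda>k. len \<nu> - k) ` (\<Union>c\<in>new_cols \<mu> \<nu>. new_rows \<mu> \<nu> c)"
    by (force simp: skew_shape_image[OF assms])
  moreover have "inj_on (\<lambda>k. len \<nu> - k) (\<Union>c\<in>new_cols \<mu> \<nu>. new_rows \<mu> \<nu> c)"
    by (auto intro!: inj_onI dest!: new_rows_less)
  ultimately show ?thesis by (simp add: card_image)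
qed

lemma cols_skew_shape:
  assumes "contained \<mu> \<nu>"
  shows "snd ` skew_shape \<nu> \<mu> = Suc ` new_cols \<mu> \<nu>"
  by (force simp: skew_shape_image[OF assms] new_cols_def image_iff)

lemma interval_skew_shape:
  assumes "contained \<mu> \<nu>" "\<mu> \<noteq> \<nu>"
  shows "interval_shape (skew_shape \<nu> \<mu>) \<longleftrightarrow>
    (\<forall>c\<in>new_cols \<mu> \<nu> - {Max (new_cols \<mu> \<nu>)}. Suc c \<in> new_cols \<mu> \<nu>)"
  unfolding interval_shape_def cols_skew_shape[OF assms(1)]
proof
  let ?J = "new_cols \<mu> \<nu>"
  have "?J \<noteq> {}" using assms contained_eqI by blast
  then have M: "Max ?J \<in> ?J" "Min ?J \<in> ?J" "\<And>c. c \<in> ?J \<Longrightarrow> c \<le> Max ?J" "\<And>c. c \<in> ?J \<Longrightarrow> Min ?J \<le> c"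
    by simp_all
  {
    assume "\<exists>a b. Suc ` ?J = {a..b}"
    then obtain a b where ab: "Suc ` ?J = {a..b}" by blast
    show "\<forall>c\<in>?J - {Max ?J}. Suc c \<in> ?J"
    proof
      fix c assume c: "c \<in> ?J - {Max ?J}"
      have "Suc c \<in> {a..b}" "Suc (Max ?J) \<in> {a..b}" using c M(1) unfolding ab[symmetric] by auto
      moreover have "c < Max ?J" using c M(3) by (metis DiffD1 DiffD2 insertI1 le_neq_implies_less)
      ultimately have "Suc (Suc c) \<in> {a..b}" by auto
      then show "Suc c \<in> ?J" unfolding ab[symmetric] by auto
    qed
  }
  assume *: "\<forall>c\<in>?J - {Max ?J}. Suc c \<in> ?J"
  have "c \<in> ?J" if "Min ?J \<le> c" "c \<le> Max ?J" for c
    using that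
  proof (induction c rule: dec_induct)
    case (step c)
    then show ?case using * by auto
  qed (rule M(2))
  then have "?J = {Min ?J..Max ?J}" using M(3,4) unfolding set_eq_iff atLeastAtMost_iff by blast
  then show "\<exists>a b. Suc ` ?J = {a..b}" by (metis image_Suc_atLeastAtMost)
qed

lemma overlap_first_row:
  "(\<forall>i\<in>new_rows \<mu> \<nu> c \<inter> new_rows \<mu> \<nu> (Suc c). \<forall>k\<in>new_rows \<mu> \<nu> c. k = i \<or> bef c i k) \<longleftrightarrow>
    new_rows \<mu> \<nu> c \<inter> new_rows \<mu> \<nu> (Suc c) \<subseteq> {first_row \<mu> \<nu> c}"
proof
  assume *: "\<forall>i\<in>new_rows \<mu> \<nu> c \<inter> new_rows \<mu> \<nu> (Suc c). \<forall>k\<in>new_rows \<mu> \<nu> c. k = i \<or> bef c i k"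
  show "new_rows \<mu> \<nu> c \<inter> new_rows \<mu> \<nu> (Suc c) \<subseteq> {first_row \<mu> \<nu> c}"
  proof
    fix i assume i: "i \<in> new_rows \<mu> \<nu> c \<inter> new_rows \<mu> \<nu> (Suc c)"
    then have "first_row \<mu> \<nu> c \<in> new_rows \<mu> \<nu> c" by (intro first_row_in) (auto simp: new_cols_def)
    then have "first_row \<mu> \<nu> c = i \<or> bef c i (first_row \<mu> \<nu> c)" using * i by simp
    then show "i \<in> {first_row \<mu> \<nu> c}"
      using i first_row_bef[of i \<mu> \<nu> c] bef_asym[of c i "first_row \<mu> \<nu> c"] by auto
  qed
next
  assume *: "new_rows \<mu> \<nu> c \<inter> new_rows \<mu> \<nu> (Suc c) \<subseteq> {first_row \<mu> \<nu> c}"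
  show "\<forall>i\<in>new_rows \<mu> \<nu> c \<inter> new_rows \<mu> \<nu> (Suc c). \<forall>k\<in>new_rows \<mu> \<nu> c. k = i \<or> bef c i k"
  proof (intro ballI)
    fix i k assume "i \<in> new_rows \<mu> \<nu> c \<inter> new_rows \<mu> \<nu> (Suc c)" "k \<in> new_rows \<mu> \<nu> c"
    then show "k = i \<or> bef c i k" using * first_row_bef[of k \<mu> \<nu> c] by auto
  qed
qed

lemma nc_border_strip_skew_shape:
  assumes "contained \<mu> \<nu>" "\<mu> \<noteq> \<nu>"
  shows "nc_border_strip (skew_shape \<nu> \<mu>) \<longleftrightarrow> overlaps_first \<mu> \<nu> \<and>
    (\<forall>c\<in>new_cols \<mu> \<nu> - {Max (new_cols \<mu> \<nu>)}. Suc c \<in> new_cols \<mu> \<nu>)"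
proof -
  let ?S = "skew_shape \<nu> \<mu>" and ?R = "new_rows \<mu> \<nu>" and ?f = "first_row \<mu> \<nu>"
  note S = mem_skew_shape_Suc[OF assms(1)]
  have rows: "1 \<le> i \<and> i \<le> len \<nu>" if "(i, c) \<in> ?S" for i c
    using that by (simp add: mem_skew_shape[OF assms(1)])
  \<comment> \<open>Reversing the rows reverses comparisons, and the first column compares in the
    direction opposite to the others. An arbitrary comparison, P before and Q after the reversal,
    covers both cases.\<close>
  have boxes: "(\<forall>i. (i, Suc c) \<in> ?S \<and> (i, Suc (Suc c)) \<in> ?S \<longrightarrow> (\<forall>k. (k, Suc c) \<in> ?S \<longrightarrow> P i k)) \<longleftrightarrow>
      (\<forall>i\<in>?R c \<inter> ?R (Suc c). \<forall>k\<in>?R c. Q i k)"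
    if PQ: "\<And>i k. i < len \<nu> \<Longrightarrow> k < len \<nu> \<Longrightarrow> P (len \<nu> - i) (len \<nu> - k) \<longleftrightarrow> Q i k" for P Q c
  proof (intro iffI ballI allI impI)
    fix i k assume *: "\<forall>i. (i, Suc c) \<in> ?S \<and> (i, Suc (Suc c)) \<in> ?S \<longrightarrow> (\<forall>k. (k, Suc c) \<in> ?S \<longrightarrow> P i k)"
      and ik: "i \<in> ?R c \<inter> ?R (Suc c)" "k \<in> ?R c"
    then have lt: "i < len \<nu>" "k < len \<nu>" using new_rows_less by auto
    then have "P (len \<nu> - i) (len \<nu> - k)" using * ik S by blast
    then show "Q i k" using PQ lt by simp
  next
    fix i k assume *: "\<forall>i\<in>?R c \<inter> ?R (Suc c). \<forall>k\<in>?R c. Q i k"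
      and ik: "(i, Suc c) \<in> ?S \<and> (i, Suc (Suc c)) \<in> ?S" "(k, Suc c) \<in> ?S"
    then have i: "len \<nu> - i \<in> ?R c \<inter> ?R (Suc c)" "len \<nu> - k \<in> ?R c"
      by (simp_all add: mem_skew_shape[OF assms(1)])
    then have "Q (len \<nu> - i) (len \<nu> - k)" using * by blast
    moreover have "len \<nu> - i < len \<nu>" "len \<nu> - k < len \<nu>" using i new_rows_less by auto
    ultimately have "P (len \<nu> - (len \<nu> - i)) (len \<nu> - (len \<nu> - k))" using PQ by blast
    then show "P i k" using rows ik by (metis diff_diff_cancel)
  qed
  have zero: "(\<forall>i. (i, 1) \<in> ?S \<and> (i, 2) \<in> ?S \<longrightarrow> (\<forall>k. (k, 1) \<in> ?S \<longrightarrow> k \<le> i)) \<longleftrightarrow>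
      ?R 0 \<inter> ?R (Suc 0) \<subseteq> {?f 0}"
    unfolding numeral_2_eq_2 One_nat_def
    by (subst overlap_first_row[symmetric], rule boxes) (auto simp: bef_def)
  have suc: "(\<forall>i. (i, Suc c) \<in> ?S \<and> (i, Suc c + 1) \<in> ?S \<longrightarrow> (\<forall>k. (k, Suc c) \<in> ?S \<longrightarrow> i \<le> k)) \<longleftrightarrow>
      ?R c \<inter> ?R (Suc c) \<subseteq> {?f c}" if "0 < c" for c
    unfolding Suc_eq_plus1[symmetric]
    by (subst overlap_first_row[symmetric], rule boxes) (use that in \<open>auto simp: bef_def\<close>)
  have "(\<forall>i j. 2 \<le> j \<and> (i, j) \<in> ?S \<and> (i, j + 1) \<in> ?S \<longrightarrow> (\<forall>k. (k, j) \<in> ?S \<longrightarrow> i \<le> k)) \<longleftrightarrow>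
      (\<forall>j\<ge>2. \<forall>i. (i, j) \<in> ?S \<and> (i, j + 1) \<in> ?S \<longrightarrow> (\<forall>k. (k, j) \<in> ?S \<longrightarrow> i \<le> k))"
    by blast
  also have "\<dots> \<longleftrightarrow> (\<forall>c>0. \<forall>i. (i, Suc c) \<in> ?S \<and> (i, Suc c + 1) \<in> ?S \<longrightarrow> (\<forall>k. (k, Suc c) \<in> ?S \<longrightarrow> i \<le> k))"
  proof -
    have "(\<forall>j\<ge>2. P j) \<longleftrightarrow> (\<forall>c>0. P (Suc c))" for P :: "nat \<Rightarrow> bool"
    proof (intro iffI allI impI)
      fix j :: nat assume "\<forall>c>0. P (Suc c)" "j \<ge> 2"
      then show "P j" by (cases j) auto
    qed auto
    then show ?thesis .
  qed
  also have "\<dots> \<longleftrightarrow> (\<forall>c>0. ?R c \<inter> ?R (Suc c) \<subseteq> {?f c})"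
    using suc by simp
  finally have pos: "(\<forall>i j. 2 \<le> j \<and> (i, j) \<in> ?S \<and> (i, j + 1) \<in> ?S \<longrightarrow> (\<forall>k. (k, j) \<in> ?S \<longrightarrow> i \<le> k)) \<longleftrightarrow>
      (\<forall>c>0. ?R c \<inter> ?R (Suc c) \<subseteq> {?f c})" .
  have "overlaps_first \<mu> \<nu> \<longleftrightarrow> ?R 0 \<inter> ?R (Suc 0) \<subseteq> {?f 0} \<and> (\<forall>c>0. ?R c \<inter> ?R (Suc c) \<subseteq> {?f c})"
    unfolding overlaps_first_def by (metis neq0_conv)
  then show ?thesis
    unfolding nc_border_strip_def interval_skew_shape[OF assms] zero pos by blast
qed

text \<open>With rows counted from the bottom, column c + 1 is north-east of column c when each of
  its rows exceeds each row of column c; the right-hand side negates this.\<close>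

lemma NE_skew_shape:
  assumes "contained \<mu> \<nu>"
  shows "NE (skew_shape \<nu> \<mu>) = {} \<longleftrightarrow> (\<forall>c\<in>new_cols \<mu> \<nu>. Suc c \<in> new_cols \<mu> \<nu> \<longrightarrow>
    (\<exists>i\<in>new_rows \<mu> \<nu> c. \<exists>j\<in>new_rows \<mu> \<nu> (Suc c). j \<le> i))"
proof -
  let ?S = "skew_shape \<nu> \<mu>" and ?R = "new_rows \<mu> \<nu>"
  note S = mem_skew_shape_Suc[OF assms]
  have ex: "(\<exists>i. (i, Suc c) \<in> ?S) \<longleftrightarrow> c \<in> new_cols \<mu> \<nu>" for c
  proof -
    have "(\<exists>i. (i, Suc c) \<in> ?S) \<longleftrightarrow> Suc c \<in> snd ` ?S" by force
    then show ?thesis by (auto simp: cols_skew_shape[OF assms])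
  qed
  have all: "(\<forall>i1 i2. (i1, Suc (Suc c)) \<in> ?S \<and> (i2, Suc c) \<in> ?S \<longrightarrow> i1 < i2) \<longleftrightarrow>
      (\<forall>i\<in>?R c. \<forall>j\<in>?R (Suc c). i < j)" for c
  proof (intro iffI ballI allI impI)
    fix i j assume *: "\<forall>i1 i2. (i1, Suc (Suc c)) \<in> ?S \<and> (i2, Suc c) \<in> ?S \<longrightarrow> i1 < i2"
      and ij: "i \<in> ?R c" "j \<in> ?R (Suc c)"
    then have "len \<nu> - j < len \<nu> - i" using S new_rows_less by blast
    then show "i < j" by auto
  next
    fix i1 i2 assume *: "\<forall>i\<in>?R c. \<forall>j\<in>?R (Suc c). i < j"
      and "(i1, Suc (Suc c)) \<in> ?S \<and> (i2, Suc c) \<in> ?S"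
    then have i: "1 \<le> i1" "i1 \<le> len \<nu>" "len \<nu> - i1 \<in> ?R (Suc c)" "i2 \<le> len \<nu>" "len \<nu> - i2 \<in> ?R c"
      by (auto simp: mem_skew_shape[OF assms])
    then have "len \<nu> - i2 < len \<nu> - i1" using * by blast
    then show "i1 < i2" using i by auto
  qed
  have no0: "(i, 0) \<notin> ?S" for i by (simp add: mem_skew_shape[OF assms])
  have "Suc c \<in> NE ?S \<longleftrightarrow> c \<in> new_cols \<mu> \<nu> \<and> Suc c \<in> new_cols \<mu> \<nu> \<and> (\<forall>i\<in>?R c. \<forall>j\<in>?R (Suc c). i < j)" for c
    using ex[of c] ex[of "Suc c"] all[of c] by (simp add: NE_def)
  moreover have "0 \<notin> NE ?S" by (simp add: NE_def no0)
  moreover have "NE ?S = {} \<longleftrightarrow> (\<forall>c. c \<notin> NE ?S)" by blast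
  moreover have "(\<forall>c. c \<notin> NE ?S) \<longleftrightarrow> 0 \<notin> NE ?S \<and> (\<forall>c. Suc c \<notin> NE ?S)"
    by (metis not0_implies_Suc)
  ultimately show ?thesis by (simp add: not_less) blast
qed

lemma NCB0_iff:
  assumes "r \<ge> 1"
  shows "NCB0 r \<nu> \<mu> \<longleftrightarrow> border_strip_rows \<mu> \<nu> \<and> csize \<nu> = csize \<mu> + r"
proof (cases "less_c \<mu> \<nu>")
  case True
  note L = less_cD[OF True]
  have "csize \<mu> \<le> csize \<nu>" using L by (simp add: csize_mono)
  have "Suc (Max (new_cols \<mu> \<nu>)) \<notin> new_cols \<mu> \<nu>"
    by (metis Max_ge Suc_n_not_le_n finite_new_cols)
  then show ?thesis
    using True \<open>csize \<mu> \<le> csize \<nu>\<close>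
    unfolding NCB0_def border_strip_rows_iff nc_border_strip_skew_shape[OF L(1,2)]
      NE_skew_shape[OF L(1)] card_skew_shape[OF L(1)] by auto
next
  case False
  then show ?thesis by (simp add: NCB0_def border_strip_rows_iff)
qed

text \<open>Count each row of the shape by its rightmost new box. The new boxes of a row are
  consecutive, so the boxes left over in column c are those with a right neighbour in the shape;
  there is at most one, and it exists exactly in adjacent columns. Hence the number of boxes is the
  number of rows plus the number a of adjacent columns, and the exponent exceeds the height by 2 (a
  + 1).\<close>

lemma border_strip_rows_sign:
  assumes "border_strip_rows \<mu> \<nu>"
  shows "(-1) ^ (csize \<nu> - csize \<mu> + 1 + card (adjacent_cols \<mu> \<nu>)) =
    (-1 :: 'a::comm_ring_1) ^ ht_nc (skew_shape \<nu> \<mu>)"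
proof -
  let ?J = "new_cols \<mu> \<nu>" and ?R = "new_rows \<mu> \<nu>" and ?f = "first_row \<mu> \<nu>"
  let ?A = "adjacent_cols \<mu> \<nu>"
  have sub: "contained \<mu> \<nu>" and ne: "\<mu> \<noteq> \<nu>" using assms by (auto simp: border_strip_rows_def)
  have ov: "?R c \<inter> ?R (Suc c) \<subseteq> {?f c}" for c
    using assms by (simp add: border_strip_rows_iff overlaps_first_def)
  have Un: "(\<Union>c\<in>?J. ?R c) = (\<Union>c\<in>?J. ?R c - ?R (Suc c))"
  proof (intro equalityI subsetI)
    fix k assume "k \<in> (\<Union>c\<in>?J. ?R c)"
    then have ne: "{c \<in> ?J. k \<in> ?R c} \<noteq> {}" by auto
    let ?c = "Max {c \<in> ?J. k \<in> ?R c}"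
    have "?c \<in> {c \<in> ?J. k \<in> ?R c}" using ne by (intro Max_in) auto
    moreover have "k \<notin> ?R (Suc ?c)"
    proof
      assume "k \<in> ?R (Suc ?c)"
      then have "Suc ?c \<in> {c \<in> ?J. k \<in> ?R c}" by (auto simp: new_cols_def)
      then have "Suc ?c \<le> ?c" by (intro Max_ge) auto
      then show False by simp
    qed
    ultimately show "k \<in> (\<Union>c\<in>?J. ?R c - ?R (Suc c))" by blast
  qed auto
  have disj: "(?R c - ?R (Suc c)) \<inter> (?R d - ?R (Suc d)) = {}" if "c < d" for c d
    using col_antimono[of "Suc (Suc c)" "Suc d" \<nu>] col_antimono[of "Suc c" "Suc (Suc c)" \<mu>] that
    by (auto simp: new_rows_def)
  have card1: "card (?R c) = card (?R c - ?R (Suc c)) + of_bool (c \<in> ?A)" if "c \<in> ?J" for c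
  proof (cases "c \<in> ?A")
    case True
    then have "?R c - ?R (Suc c) = ?R c - {?f c}" "?f c \<in> ?R c"
      using ov[of c] first_row_in[OF that] by (auto simp: adjacent_cols_def)
    then show ?thesis using True card_Suc_Diff1[of "?R c" "?f c"] by simp
  next
    case False
    then have "?R c - ?R (Suc c) = ?R c"
      using ov[of c] that by (auto simp: adjacent_cols_def)
    then show ?thesis using False by simp
  qed
  have "csize \<nu> - csize \<mu> = (\<Sum>c\<in>?J. card (?R c))"
    using csize_contained[OF sub] by simp
  also have "\<dots> = (\<Sum>c\<in>?J. card (?R c - ?R (Suc c)) + of_bool (c \<in> ?A))"
    using card1 by (intro sum.cong) auto
  also have "\<dots> = (\<Sum>c\<in>?J. card (?R c - ?R (Suc c))) + card ?A"
  proof -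
    have "?J \<inter> ?A = ?A" by (auto simp: adjacent_cols_def)
    then show ?thesis by (simp add: sum.distrib)
  qed
  also have "(\<Sum>c\<in>?J. card (?R c - ?R (Suc c))) = card (\<Union>c\<in>?J. ?R c)"
    unfolding Un using disj by (intro card_UN_disjoint[symmetric]) (simp_all, metis linorder_neqE_nat inf_commute)
  finally have n: "csize \<nu> - csize \<mu> = card (\<Union>c\<in>?J. ?R c) + card ?A" .
  obtain c where "c \<in> ?J" using sub ne contained_eqI by blast
  then have "?f c \<in> (\<Union>c\<in>?J. ?R c)" using first_row_in by blast
  then have "card (\<Union>c\<in>?J. ?R c) \<noteq> 0" by (auto simp: card_eq_0_iff)
  then obtain m where m: "card (\<Union>c\<in>?J. ?R c) = Suc m" using not0_implies_Suc by blast
  have "csize \<nu> - csize \<mu> + 1 + card ?A = m + 2 * (card ?A + 1)"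
    using n m by simp
  moreover have "ht_nc (skew_shape \<nu> \<mu>) = m"
    by (simp add: ht_nc_def rows_skew_shape[OF sub] m)
  ultimately show ?thesis by (simp only: power_add power_mult) simp
qed

section \<open>Counting tableaux\<close>

definition horiz_set :: "composition \<Rightarrow> nat \<Rightarrow> composition set" where
  "horiz_set \<nu> n = {\<mu>. horiz \<mu> \<nu> \<and> csize \<nu> = csize \<mu> + n}"

lemma finite_horiz_set [simp]: "finite (horiz_set \<nu> n)"
  by (rule finite_subset[OF _ finite_csize_le[of "csize \<nu>"]]) (auto simp: horiz_set_def)

text \<open>The number of tableaux of shape \<nu> whose content is the given list, the head
  belonging to the entry 1. The smallest entry is stripped first because left multiplication by H_n
  prepends n to the index.\<close>

primrec kostka :: "nat list \<Rightarrow> composition \<Rightarrow> nat" where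
  "kostka [] \<nu> = of_bool (\<nu> = 0)"
| "kostka (n # ns) \<nu> = (\<Sum>\<mu>\<in>horiz_set \<nu> n. kostka ns \<mu>)"

lemma horiz_set_0 [simp]: "horiz_set \<nu> 0 = {\<nu>}"
  by (auto simp: horiz_set_def dest: contained_csize_eq[OF horiz_contained])

lemma kostka_filter: "kostka (filter (\<lambda>n. n \<noteq> 0) ns) \<nu> = kostka ns \<nu>"
  by (induction ns arbitrary: \<nu>) auto

text \<open>A filling with rows and columns counted from 0 and rows counted from the bottom.\<close>

definition row_tableau :: "composition \<Rightarrow> (nat \<Rightarrow> nat \<Rightarrow> nat) \<Rightarrow> bool" where
  "row_tableau \<nu> t \<longleftrightarrow> (\<forall>i c. 0 < t i c \<longleftrightarrow> i \<in> col \<nu> (Suc c)) \<and> (\<forall>i c. t i (Suc c) \<le> t i c) \<and>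
     (\<forall>i j. i < j \<and> j < len \<nu> \<longrightarrow> t j 0 < t i 0) \<and>
     (\<forall>i j c. i < j \<and> 0 < t i (Suc c) \<and> t j (Suc c) \<le> t i (Suc c) \<longrightarrow> t j c < t i (Suc c))"

text \<open>The value 0 marks an absent box, so \<open>m v\<close> is the multiplicity of the entry
  \<open>Suc v\<close>; lowering all entries by one shifts m.\<close>

definition tableaux :: "composition \<Rightarrow> (nat \<Rightarrow> nat) \<Rightarrow> (nat \<Rightarrow> nat \<Rightarrow> nat) set" where
  "tableaux \<nu> m = {t. row_tableau \<nu> t \<and> (\<forall>v. card {(i, c). t i c = Suc v} = m v)}"

lemma row_tableauD:
  assumes "row_tableau \<nu> t"
  shows "0 < t i c \<longleftrightarrow> i \<in> col \<nu> (Suc c)" "t i (Suc c) \<le> t i c"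
    "i < j \<Longrightarrow> j < len \<nu> \<Longrightarrow> t j 0 < t i 0"
    "i < j \<Longrightarrow> 0 < t i (Suc c) \<Longrightarrow> t j (Suc c) \<le> t i (Suc c) \<Longrightarrow> t j c < t i (Suc c)"
  using assms unfolding row_tableau_def by blast+

lemma card_new_boxes:
  assumes "contained \<mu> \<nu>"
  shows "csize \<nu> = csize \<mu> + card {(i, c). i \<in> new_rows \<mu> \<nu> c}"
proof -
  have "{(i, c). i \<in> new_rows \<mu> \<nu> c} = (\<lambda>(c, i). (i, c)) ` (SIGMA c : new_cols \<mu> \<nu>. new_rows \<mu> \<nu> c)"
    by (auto simp: new_cols_def image_iff)
  moreover have "inj_on (\<lambda>(c, i). (i, c)) (SIGMA c : new_cols \<mu> \<nu>. new_rows \<mu> \<nu> c)"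
    by (auto simp: inj_on_def)
  ultimately have "card {(i, c). i \<in> new_rows \<mu> \<nu> c} = card (SIGMA c : new_cols \<mu> \<nu>. new_rows \<mu> \<nu> c)"
    by (simp add: card_image)
  then show ?thesis using csize_contained[OF assms] by simp
qed

lemma finite_boxes: "finite {(i, c). i \<in> col \<nu> (Suc c)}"
proof -
  have "{(i, c). i \<in> col \<nu> (Suc c)} \<subseteq> {..<len \<nu>} \<times> {..<csize \<nu>}"
  proof clarify
    fix i c assume i: "i \<in> col \<nu> (Suc c)"
    then have "i \<in> col \<nu> (Suc 0)" using col_antimono[of "Suc 0" "Suc c" \<nu>] by auto
    moreover have "c < csize \<nu>" using i col_empty[of \<nu> c] by (metis empty_iff not_less)
    ultimately show "i \<in> {..<len \<nu>} \<and> c \<in> {..<csize \<nu>}" by (simp add: col_Suc_0)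
  qed
  then show ?thesis by (rule finite_subset) simp
qed

text \<open>Rows weakly decrease, so the entries 1 stand at the ends of rows, and in the first
  column one can occur only in the top row; what remains is a diagram. The triple condition survives
  the subtraction because it is then invoked only at entries exceeding 1.\<close>

lemma row_tableau_remove_ones:
  assumes t: "row_tableau \<nu> t"
  obtains \<mu> where "row_tableau \<mu> (\<lambda>i c. t i c - 1)" "horiz \<mu> \<nu>"
    "\<And>c. new_rows \<mu> \<nu> c = {i. t i c = 1}"
proof -
  note T = row_tableauD[OF t]
  define C where "C c = (if c = 0 then UNIV else {i. 2 \<le> t i (c - 1)})" for c
  define n where "n = (if 0 < len \<nu> \<and> t (len \<nu> - 1) 0 < 2 then len \<nu> - 1 else len \<nu>)"
  have "C (Suc c) \<subseteq> C c" for c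
    using T(2)[of _ "c - 1"] by (cases c) (auto simp: C_def intro: order_trans)
  moreover have "C (Suc 0) = {..<n}"
  proof -
    have pos: "0 < t i 0 \<longleftrightarrow> i < len \<nu>" for i using T(1)[of i 0] by (simp add: col_Suc_0)
    have big: "2 \<le> t i 0" if "i < len \<nu> - 1" for i
      using T(3)[of i "Suc i"] pos[of "Suc i"] that by auto
    have "2 \<le> t i 0 \<longleftrightarrow> i < n" for i
    proof (cases "i < len \<nu> - 1")
      case True
      then show ?thesis using big by (auto simp: n_def)
    next
      case False
      then have "i = len \<nu> - 1 \<and> 0 < len \<nu> \<or> \<not> i < len \<nu>" by auto
      then show ?thesis using pos[of i] by (auto simp: n_def)
    qed
    then show ?thesis by (auto simp: C_def)
  qed
  moreover have "C (Suc (csize \<nu>)) = {}"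
    using T(1)[of _ "csize \<nu>"] by (auto simp: C_def col_empty)
  ultimately obtain \<mu> where \<mu>: "\<And>c. col \<mu> (Suc c) = C (Suc c)"
    by (rule composition_of_cols) blast
  have col: "i \<in> col \<mu> (Suc c) \<longleftrightarrow> 2 \<le> t i c" for i c
    by (simp add: \<mu> C_def)
  have R: "new_rows \<mu> \<nu> c = {i. t i c = 1}" for c
  proof -
    have "i \<in> new_rows \<mu> \<nu> c \<longleftrightarrow> 0 < t i c \<and> \<not> 2 \<le> t i c" for i
      by (simp add: new_rows_def col T(1))
    then show ?thesis by (intro set_eqI) (simp, arith)
  qed
  have len: "j < len \<mu> \<longleftrightarrow> 2 \<le> t j 0" for j
    using col[of j 0] by (simp add: col_Suc_0)
  have len': "j < len \<nu> \<longleftrightarrow> 0 < t j 0" for j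
    using T(1)[of j 0] by (simp add: col_Suc_0)
  show thesis
  proof (rule that)
    show "row_tableau \<mu> (\<lambda>i c. t i c - 1)"
      unfolding row_tableau_def
    proof (intro conjI allI impI)
      show "0 < t i c - 1 \<longleftrightarrow> i \<in> col \<mu> (Suc c)" for i c by (auto simp: col)
      show "t i (Suc c) - 1 \<le> t i c - 1" for i c using T(2)[of i c] by (rule diff_le_mono)
      show "t j 0 - 1 < t i 0 - 1" if "i < j \<and> j < len \<mu>" for i j
        using T(3)[of i j] that len[of j] len'[of j] by auto
      show "t j c - 1 < t i (Suc c) - 1"
        if "i < j \<and> 0 < t i (Suc c) - 1 \<and> t j (Suc c) - 1 \<le> t i (Suc c) - 1" for i j c
      proof -
        have "t j (Suc c) \<le> t i (Suc c)" "1 < t i (Suc c)" using that by arith+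
        then have "t j c < t i (Suc c)" using T(4)[of i j c] that by simp
        then show ?thesis using \<open>1 < t i (Suc c)\<close> by arith
      qed
    qed
    show "horiz \<mu> \<nu>"
      unfolding horiz_def R
    proof (intro allI conjI ballI)
      show "col \<mu> (Suc c) \<subseteq> col \<nu> (Suc c)" for c
      proof
        fix i assume "i \<in> col \<mu> (Suc c)"
        then have "0 < t i c" by (simp add: col)
        then show "i \<in> col \<nu> (Suc c)" by (simp only: T(1))
      qed
      fix c j i assume j: "j \<in> {i. t i c = 1}" and i: "i \<in> col \<nu> c - col \<mu> (Suc c)"
      show "i = j \<or> bef c j i"
      proof (cases c)
        case 0
        then have "t i 0 \<le> 1" "t j 0 = 1" using i j by (auto simp: col)
        then have "\<not> i < j" using T(3)[of i j] len'[of j] by auto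
        then show ?thesis using 0 by (auto simp: bef_def)
      next
        case (Suc d)
        then have "t i (Suc d) \<le> 1" "t j (Suc d) = 1" "0 < t i d" using i j T(1)[of i d] by (auto simp: col)
        then have "\<not> j < i" using T(4)[of j i d] by auto
        then show ?thesis using Suc by (auto simp: bef_def)
      qed
    qed
    show "new_rows \<mu> \<nu> c = {i. t i c = 1}" for c by (rule R)
  qed
qed

text \<open>In the triple condition the entry of the lower row is an old one raised by 1 or a new 1.
  In the second case horizontality puts every higher row that reaches the preceding column into
  \<mu> at this column; its entry there exceeds 1, so the hypothesis of the condition fails.\<close>

lemma row_tableau_add_ones:
  assumes s: "row_tableau \<mu> s" and h: "horiz \<mu> \<nu>"
  shows "row_tableau \<nu> (\<lambda>i c. if i \<in> col \<nu> (Suc c) then Suc (s i c) else 0)"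
proof -
  note S = row_tableauD[OF s]
  have sub: "i \<in> col \<mu> c \<Longrightarrow> i \<in> col \<nu> c" for i c
    using horiz_contained[OF h] by (auto simp: contained_def)
  show ?thesis
    unfolding row_tableau_def
  proof (intro conjI allI impI)
    fix i c
    show "(if i \<in> col \<nu> (Suc (Suc c)) then Suc (s i (Suc c)) else 0) \<le>
      (if i \<in> col \<nu> (Suc c) then Suc (s i c) else 0)"
      using S(2)[of i c] col_Suc_subset[of \<nu> "Suc c"] by auto
  next
    fix i j assume ij: "i < j \<and> j < len \<nu>"
    have "s j 0 < s i 0"
    proof (cases "j < len \<mu>")
      case True
      then show ?thesis using S(3) ij by blast
    next
      case False
      then have "j \<in> new_rows \<mu> \<nu> 0" using ij by (simp add: new_rows_def col_Suc_0)
      then have "i \<in> col \<mu> (Suc 0)" using horizD[OF h, of j 0 i] ij by (auto simp: bef_def)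
      then have "0 < s i 0" using S(1)[of i 0] by simp
      moreover have "s j 0 = 0" using S(1)[of j 0] False by (simp add: col_Suc_0)
      ultimately show ?thesis by simp
    qed
    then show "(if j \<in> col \<nu> (Suc 0) then Suc (s j 0) else 0) < (if i \<in> col \<nu> (Suc 0) then Suc (s i 0) else 0)"
      using ij by (auto simp: col_Suc_0)
  next
    fix i j c
    assume *: "i < j \<and> 0 < (if i \<in> col \<nu> (Suc (Suc c)) then Suc (s i (Suc c)) else 0) \<and>
      (if j \<in> col \<nu> (Suc (Suc c)) then Suc (s j (Suc c)) else 0) \<le>
      (if i \<in> col \<nu> (Suc (Suc c)) then Suc (s i (Suc c)) else 0)"
    then have i: "i \<in> col \<nu> (Suc (Suc c))" by (auto split: if_splits)
    have "s j c < s i (Suc c)" if j: "j \<in> col \<nu> (Suc c)"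
    proof (cases "i \<in> col \<mu> (Suc (Suc c))")
      case True
      then have pos: "0 < s i (Suc c)" using S(1)[of i "Suc c"] by simp
      have "s j (Suc c) \<le> s i (Suc c)"
      proof (cases "j \<in> col \<nu> (Suc (Suc c))")
        case False
        then have "s j (Suc c) = 0" using S(1)[of j "Suc c"] sub by blast
        then show ?thesis by simp
      qed (use * i in auto)
      then show ?thesis using S(4)[of i j c] pos * by blast
    next
      case False
      then have "i \<in> new_rows \<mu> \<nu> (Suc c)" using i by (simp add: new_rows_def)
      then have "j \<in> col \<mu> (Suc (Suc c))"
        using horizD[OF h, of i "Suc c" j] j * by (auto simp: bef_def)
      then have "0 < s j (Suc c)" "j \<in> col \<nu> (Suc (Suc c))" using S(1)[of j "Suc c"] sub by auto
      moreover have "s i (Suc c) = 0" using S(1)[of i "Suc c"] False by blast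
      ultimately show ?thesis using * i by auto
    qed
    then show "(if j \<in> col \<nu> (Suc c) then Suc (s j c) else 0) <
        (if i \<in> col \<nu> (Suc (Suc c)) then Suc (s i (Suc c)) else 0)"
      using i by simp
  qed auto
qed

text \<open>Truncated subtraction erases the entries 1, but \<nu> tells which zeros of the image
  stem from them, so nothing is lost.\<close>

lemma bij_betw_remove_ones:
  "bij_betw (\<lambda>t i c. t i c - 1) (tableaux \<nu> m) (\<Union>\<mu>\<in>horiz_set \<nu> (m 0). tableaux \<mu> (\<lambda>v. m (Suc v)))"
  unfolding bij_betw_def
proof (intro conjI equalityI subsetI)
  show "inj_on (\<lambda>t i c. t i c - 1) (tableaux \<nu> m)"
  proof (rule inj_onI)
    fix t u assume "t \<in> tableaux \<nu> m" "u \<in> tableaux \<nu> m" and eq: "(\<lambda>i c. t i c - 1) = (\<lambda>i c. u i c - 1)"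
    then have tu: "row_tableau \<nu> t" "row_tableau \<nu> u"
      by (simp_all add: tableaux_def)
    have "0 < t i c \<longleftrightarrow> 0 < u i c" for i c
      using row_tableauD(1)[OF tu(1)] row_tableauD(1)[OF tu(2)] by simp
    moreover have "t i c - 1 = u i c - 1" for i c using fun_cong[OF fun_cong[OF eq]] .
    ultimately have "t i c = u i c" for i c
      by (metis Suc_pred' gr0I One_nat_def)
    then show "t = u" by blast
  qed
next
  fix s assume "s \<in> (\<lambda>t i c. t i c - 1) ` tableaux \<nu> m"
  then obtain t where s: "s = (\<lambda>i c. t i c - 1)" and t: "row_tableau \<nu> t"
    and m: "\<And>v. card {(i, c). t i c = Suc v} = m v"
    by (auto simp: tableaux_def)
  from t obtain \<mu> where \<mu>: "row_tableau \<mu> (\<lambda>i c. t i c - 1)" "horiz \<mu> \<nu>"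
    "\<And>c. new_rows \<mu> \<nu> c = {i. t i c = 1}" by (rule row_tableau_remove_ones) blast
  have "csize \<nu> = csize \<mu> + m 0"
    using card_new_boxes[OF horiz_contained[OF \<mu>(2)]] m[of 0] by (simp add: \<mu>(3))
  moreover have "{(i, c). t i c - 1 = Suc v} = {(i, c). t i c = Suc (Suc v)}" for v
    by auto
  ultimately show "s \<in> (\<Union>\<mu>\<in>horiz_set \<nu> (m 0). tableaux \<mu> (\<lambda>v. m (Suc v)))"
    using \<mu> m by (auto simp: s horiz_set_def tableaux_def)
next
  fix s assume "s \<in> (\<Union>\<mu>\<in>horiz_set \<nu> (m 0). tableaux \<mu> (\<lambda>v. m (Suc v)))"
  then obtain \<mu> where h: "horiz \<mu> \<nu>" "csize \<nu> = csize \<mu> + m 0" and s: "row_tableau \<mu> s"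
    and m: "\<And>v. card {(i, c). s i c = Suc v} = m (Suc v)"
    by (auto simp: horiz_set_def tableaux_def)
  let ?t = "\<lambda>i c. if i \<in> col \<nu> (Suc c) then Suc (s i c) else 0"
  have sub: "0 < s i c \<Longrightarrow> i \<in> col \<nu> (Suc c)" for i c
    using horiz_contained[OF h(1)] row_tableauD(1)[OF s] by (auto simp: contained_def)
  have "card {(i, c). ?t i c = Suc v} = m v" for v
  proof (cases v)
    case 0
    have "{(i, c). ?t i c = Suc 0} = {(i, c). i \<in> new_rows \<mu> \<nu> c}"
      by (auto simp: new_rows_def row_tableauD(1)[OF s, symmetric] split: if_splits)
    then show ?thesis using card_new_boxes[OF horiz_contained[OF h(1)]] h(2) 0 by simp
  next
    case (Suc w)
    have "?t i c = Suc v \<longleftrightarrow> s i c = Suc w" for i c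
      using sub[of i c] Suc by auto
    then show ?thesis using m[of w] Suc by simp
  qed
  then have "?t \<in> tableaux \<nu> m"
    using row_tableau_add_ones[OF s h(1)] by (simp add: tableaux_def)
  moreover have "s = (\<lambda>i c. ?t i c - 1)"
    using sub by (auto simp: fun_eq_iff)
  ultimately show "s \<in> (\<lambda>t i c. t i c - 1) ` tableaux \<nu> m"
    using image_eqI[where f = "\<lambda>t i c. t i c - 1" and x = ?t and b = s] by simp
qed

lemma tableaux_zero: "tableaux \<nu> (\<lambda>v. 0) = (if \<nu> = 0 then {\<lambda>i c. 0} else {})"
proof -
  have fin: "finite {(i, c). t i c = Suc v}" if "row_tableau \<nu> t" for t v
    by (rule finite_subset[OF _ finite_boxes[of \<nu>]]) (auto simp: row_tableauD(1)[OF that, symmetric])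
  have zero: "t = (\<lambda>i c. 0) \<and> \<nu> = 0" if "t \<in> tableaux \<nu> (\<lambda>v. 0)" for t
  proof -
    have t: "row_tableau \<nu> t" "\<And>v. {(i, c). t i c = Suc v} = {}"
      using that fin[of t] by (auto simp: tableaux_def)
    have "t i c = 0" for i c using t(2)[of "t i c - 1"] by (cases "t i c") auto
    then have "col \<nu> (Suc c) = {}" for c using row_tableauD(1)[OF t(1)] by auto
    then have "\<nu> = 0" by (intro col_inject) (simp add: col_empty)
    then show ?thesis using \<open>\<And>i c. t i c = 0\<close> by auto
  qed
  have "row_tableau 0 (\<lambda>i c. 0)" by (simp add: row_tableau_def col_empty len_def)
  then have "\<nu> = 0 \<Longrightarrow> (\<lambda>i c. 0) \<in> tableaux \<nu> (\<lambda>v. 0)" by (simp add: tableaux_def)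
  then show ?thesis using zero by auto
qed

lemma card_tableaux:
  assumes "\<And>v. n \<le> v \<Longrightarrow> m v = 0"
  shows "finite (tableaux \<nu> m) \<and> card (tableaux \<nu> m) = kostka (map m [0..<n]) \<nu>"
  using assms
proof (induction n arbitrary: m \<nu>)
  case 0
  then have "m = (\<lambda>v. 0)" by auto
  then show ?case by (simp add: tableaux_zero)
next
  case (Suc n)
  let ?m = "\<lambda>v. m (Suc v)"
  have IH: "finite (tableaux \<mu> ?m)" "card (tableaux \<mu> ?m) = kostka (map ?m [0..<n]) \<mu>" for \<mu>
    using Suc.IH[of ?m \<mu>] Suc.prems by auto
  have disj: "tableaux \<mu> ?m \<inter> tableaux \<xi> ?m = {}" if "\<mu> \<noteq> \<xi>" for \<mu> \<xi>
  proof (rule ccontr)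
    assume "tableaux \<mu> ?m \<inter> tableaux \<xi> ?m \<noteq> {}"
    then obtain t where "row_tableau \<mu> t" "row_tableau \<xi> t" by (auto simp: tableaux_def)
    then have "col \<mu> (Suc c) = col \<xi> (Suc c)" for c by (auto simp flip: row_tableauD(1))
    then show False using that col_inject by blast
  qed
  note bij = bij_betw_remove_ones[of \<nu> m]
  have "card (tableaux \<nu> m) = (\<Sum>\<mu>\<in>horiz_set \<nu> (m 0). card (tableaux \<mu> ?m))"
    unfolding bij_betw_same_card[OF bij] using IH disj by (intro card_UN_disjoint) auto
  moreover have "finite (tableaux \<nu> m)"
    unfolding bij_betw_finite[OF bij] using IH by auto
  moreover have "map m [0..<Suc n] = m 0 # map ?m [0..<n]"
    by (simp only: upt_rec[of 0] map_Suc_upt[symmetric]) (simp add: comp_def)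
  ultimately show ?case by (simp add: IH del: upt_Suc)
qed

section \<open>From fillings of the diagram to coefficients of quasisymmetric Schur
  functions\<close>

abbreviation "lookup \<equiv> Poly_Mapping.lookup"
abbreviation "keys \<equiv> Poly_Mapping.keys"
abbreviation "single \<equiv> Poly_Mapping.single"

text \<open>For i \<ge> \<open>len \<nu>\<close> truncated subtraction reads row 0, where a tableau
  has the value 0 that an absent box requires.\<close>

definition bottom_rows :: "composition \<Rightarrow> (nat \<times> nat \<Rightarrow> nat) \<Rightarrow> nat \<Rightarrow> nat \<Rightarrow> nat" where
  "bottom_rows \<nu> T i c = T (len \<nu> - i, Suc c)"

text \<open>\<open>bottom_rows\<close> ignores column 0 and everything below the last row of the
  diagram; prescribing zeros there makes it injective.\<close>

definition supported_on_boxes :: "composition \<Rightarrow> (nat \<times> nat \<Rightarrow> nat) \<Rightarrow> bool" where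
  "supported_on_boxes \<nu> T \<longleftrightarrow> (\<forall>i c. T (i, c) \<noteq> 0 \<longrightarrow> 1 \<le> i \<and> i \<le> len \<nu> \<and> 1 \<le> c)"

lemma composition_tableau_iff:
  "composition_tableau \<nu> T \<longleftrightarrow> supported_on_boxes \<nu> T \<and> row_tableau \<nu> (bottom_rows \<nu> T)"
proof
  assume ct: "composition_tableau \<nu> T"
  then have d: "0 < T (i, c) \<longleftrightarrow> 1 \<le> i \<and> i \<le> len \<nu> \<and> 1 \<le> c \<and> len \<nu> - i \<in> col \<nu> c" for i c
    unfolding composition_tableau_def mem_diagram[symmetric] by blast
  have row: "T (i, c + 1) \<le> T (i, c)" if "1 \<le> c" for i c
  proof (cases "0 < T (i, c + 1)")
    case True
    then have "0 < T (i, c)" using d[of i c] d[of i "c + 1"] that col_Suc_subset[of \<nu> c] by auto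
    then show ?thesis using True ct unfolding composition_tableau_def by blast
  qed simp
  have "row_tableau \<nu> (bottom_rows \<nu> T)"
    unfolding row_tableau_def bottom_rows_def
  proof (intro conjI allI impI)
    fix i c
    show "0 < T (len \<nu> - i, Suc c) \<longleftrightarrow> i \<in> col \<nu> (Suc c)"
    proof (cases "i < len \<nu>")
      case True
      then show ?thesis using d[of "len \<nu> - i" "Suc c"] by auto
    next
      case False
      then have "i \<notin> col \<nu> (Suc 0)" by (simp add: col_Suc_0)
      then have "i \<notin> col \<nu> (Suc c)" using col_antimono[of "Suc 0" "Suc c" \<nu>] by auto
      then show ?thesis using False d[of "len \<nu> - i" "Suc c"] by auto
    qed
    show "T (len \<nu> - i, Suc (Suc c)) \<le> T (len \<nu> - i, Suc c)" using row[of "Suc c"] by simp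
  next
    fix i j assume "i < j \<and> j < len \<nu>"
    then have "1 \<le> len \<nu> - j \<and> len \<nu> - j < len \<nu> - i \<and> len \<nu> - i \<le> len \<nu>" by auto
    then show "T (len \<nu> - j, Suc 0) < T (len \<nu> - i, Suc 0)"
      using ct unfolding composition_tableau_def One_nat_def by blast
  next
    fix i j c
    assume *: "i < j \<and> 0 < T (len \<nu> - i, Suc (Suc c)) \<and> T (len \<nu> - j, Suc (Suc c)) \<le> T (len \<nu> - i, Suc (Suc c))"
    show "T (len \<nu> - j, Suc c) < T (len \<nu> - i, Suc (Suc c))"
    proof (cases "j < len \<nu>")
      case True
      then have "1 \<le> len \<nu> - j \<and> len \<nu> - j < len \<nu> - i \<and> len \<nu> - i \<le> len \<nu> \<and> 2 \<le> Suc (Suc c)"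
        using * by auto
      then have "T (len \<nu> - j, Suc (Suc c) - 1) < T (len \<nu> - i, Suc (Suc c))"
        using ct * unfolding composition_tableau_def by blast
      then show ?thesis by simp
    next
      case False
      then show ?thesis using * d[of "len \<nu> - j" "Suc c"] by auto
    qed
  qed
  moreover have "supported_on_boxes \<nu> T"
    using d unfolding supported_on_boxes_def neq0_conv by blast
  ultimately show "supported_on_boxes \<nu> T \<and> row_tableau \<nu> (bottom_rows \<nu> T)" by blast
next
  assume *: "supported_on_boxes \<nu> T \<and> row_tableau \<nu> (bottom_rows \<nu> T)"
  then have t: "row_tableau \<nu> (bottom_rows \<nu> T)" by blast
  note R = row_tableauD[OF t, unfolded bottom_rows_def]
  have sup: "0 < T (i, c) \<Longrightarrow> 1 \<le> i \<and> i \<le> len \<nu> \<and> 1 \<le> c" for i c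
    using * unfolding supported_on_boxes_def neq0_conv by blast
  have flip: "len \<nu> - (len \<nu> - i) = i" if "i \<le> len \<nu>" for i using that by simp
  show "composition_tableau \<nu> T"
    unfolding composition_tableau_def
  proof (intro conjI allI impI)
    fix b :: "nat \<times> nat"
    obtain i c where b: "b = (i, c)" by (cases b)
    show "b \<in> diagram \<nu> \<longleftrightarrow> 0 < T b"
    proof (cases "1 \<le> i \<and> i \<le> len \<nu> \<and> 1 \<le> c")
      case True
      then have "0 < T (i, c) \<longleftrightarrow> len \<nu> - i \<in> col \<nu> c"
        using R(1)[of "len \<nu> - i" "c - 1"] by simp
      then show ?thesis using True by (simp add: b mem_diagram)
    next
      case False
      then show ?thesis using sup[of i c] by (auto simp: b mem_diagram)
    qed
  next
    fix i c assume "(i, c) \<in> diagram \<nu> \<and> (i, c + 1) \<in> diagram \<nu>"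
    then show "T (i, c + 1) \<le> T (i, c)"
      using R(2)[of "len \<nu> - i" "c - 1"] by (auto simp: mem_diagram)
  next
    fix i j assume "1 \<le> i \<and> i < j \<and> j \<le> len \<nu>"
    then show "T (i, 1) < T (j, 1)"
      using R(3)[of "len \<nu> - j" "len \<nu> - i"] by auto
  next
    fix i j c assume "1 \<le> i \<and> i < j \<and> j \<le> len \<nu> \<and> 2 \<le> c" "T (j, c) \<noteq> 0 \<and> T (i, c) \<le> T (j, c)"
    moreover from this obtain d where "c = Suc (Suc d)"
      by (metis Suc_1 Suc_le_D add_2_eq_Suc le_Suc_ex)
    ultimately show "T (i, c - 1) < T (j, c)"
      using R(4)[of "len \<nu> - j" "len \<nu> - i" d] by auto
  qed
qed

lemma lookup_content:
  assumes "composition_tableau \<nu> T"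
  shows "lookup (content \<nu> T) v = (if v = 0 then 0 else card {(i, c). bottom_rows \<nu> T i c = v})"
proof -
  have D: "b \<in> diagram \<nu> \<longleftrightarrow> 0 < T b" for b
    using assms unfolding composition_tableau_def by blast
  have fin: "finite (diagram \<nu>)"
  proof (rule finite_subset)
    show "diagram \<nu> \<subseteq> {..len \<nu>} \<times> {..csize \<nu>}"
    proof clarify
      fix i c assume "(i, c) \<in> diagram \<nu>"
      then have "i \<le> len \<nu>" "c \<le> rowlen \<nu> (len \<nu> - i)" by (auto simp: mem_diagram col_def)
      then show "i \<in> {..len \<nu>} \<and> c \<in> {..csize \<nu>}" using rowlen_le_csize[of \<nu> "len \<nu> - i"] by simp
    qed
  qed simp
  have "lookup (content \<nu> T) v = (\<Sum>b\<in>diagram \<nu>. if T b = v then 1 else 0)"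
    by (simp only: content_def Poly_Mapping.lookup_sum lookup_single when_def)
  also have "\<dots> = card {b \<in> diagram \<nu>. T b = v}"
    unfolding card_eq_sum by (rule sum.inter_filter[OF fin, symmetric])
  also have "\<dots> = (if v = 0 then 0 else card {(i, c). bottom_rows \<nu> T i c = v})"
  proof (cases "v = 0")
    case True
    then show ?thesis by (auto simp: D intro: card_eq_0_iff[THEN iffD2])
  next
    case False
    have "{b \<in> diagram \<nu>. T b = v} = (\<lambda>(i, c). (len \<nu> - i, Suc c)) ` {(i, c). bottom_rows \<nu> T i c = v}"
    proof (intro equalityI subsetI)
      fix b assume b: "b \<in> {b \<in> diagram \<nu>. T b = v}"
      then obtain i c where ic: "b = (i, c)" "1 \<le> i" "i \<le> len \<nu>" "1 \<le> c" "T (i, c) = v"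
        by (cases b) (auto simp: mem_diagram)
      then have "b = (\<lambda>(i, c). (len \<nu> - i, Suc c)) (len \<nu> - i, c - 1)"
        "(len \<nu> - i, c - 1) \<in> {(i, c). bottom_rows \<nu> T i c = v}" by (auto simp: bottom_rows_def)
      then show "b \<in> (\<lambda>(i, c). (len \<nu> - i, Suc c)) ` {(i, c). bottom_rows \<nu> T i c = v}"
        by (rule image_eqI)
    qed (use False in \<open>auto simp: bottom_rows_def D\<close>)
    moreover have "inj_on (\<lambda>(i, c). (len \<nu> - i, Suc c)) {(i, c). bottom_rows \<nu> T i c = v}"
    proof (rule inj_onI)
      fix p q
      assume *: "p \<in> {(i, c). bottom_rows \<nu> T i c = v}" "q \<in> {(i, c). bottom_rows \<nu> T i c = v}"
        "(\<lambda>(i, c). (len \<nu> - i, Suc c)) p = (\<lambda>(i, c). (len \<nu> - i, Suc c)) q"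
      obtain i c k d where pq: "p = (i, c)" "q = (k, d)" by (cases p, cases q)
      then have "(len \<nu> - i, Suc c) \<in> diagram \<nu>" "len \<nu> - i = len \<nu> - k" "c = d"
        using * False by (auto simp: bottom_rows_def D)
      then show "p = q" by (auto simp: pq mem_diagram)
    qed
    ultimately show ?thesis using False by (simp add: card_image)
  qed
  finally show ?thesis .
qed

section \<open>Coordinates in the monomial quasisymmetric basis\<close>

definition exponents :: "(nat \<Rightarrow>\<^sub>0 nat) \<Rightarrow> composition" where
  "exponents m = Comp (map (lookup m) (sorted_list_of_set (keys m)))"

lemma parts_exponents:
  "parts (exponents m) = map (lookup m) (sorted_list_of_set (keys m))"
  unfolding exponents_def by (rule parts_Comp) (auto simp: in_keys_iff image_iff)

lemma bij_betw_bottom_rows: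
  assumes "lookup m 0 = 0"
  shows "bij_betw (bottom_rows \<nu>) {T. composition_tableau \<nu> T \<and> content \<nu> T = m}
    (tableaux \<nu> (\<lambda>v. lookup m (Suc v)))"
  unfolding bij_betw_def
proof (intro conjI equalityI subsetI)
  show "inj_on (bottom_rows \<nu>) {T. composition_tableau \<nu> T \<and> content \<nu> T = m}"
  proof (rule inj_onI)
    fix T U assume *: "T \<in> {T. composition_tableau \<nu> T \<and> content \<nu> T = m}"
      "U \<in> {T. composition_tableau \<nu> T \<and> content \<nu> T = m}" "bottom_rows \<nu> T = bottom_rows \<nu> U"
    then have "supported_on_boxes \<nu> T" "supported_on_boxes \<nu> U"
      by (auto simp: composition_tableau_iff)
    moreover have "T (i, c) = U (i, c)" if "1 \<le> i" "i \<le> len \<nu>" "1 \<le> c" for i c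
      using fun_cong[OF fun_cong[OF *(3), of "len \<nu> - i"], of "c - 1"] that by (simp add: bottom_rows_def)
    ultimately have "T (i, c) = U (i, c)" for i c unfolding supported_on_boxes_def by metis
    then show "T = U" by (simp add: fun_eq_iff)
  qed
next
  fix t assume "t \<in> bottom_rows \<nu> ` {T. composition_tableau \<nu> T \<and> content \<nu> T = m}"
  then obtain T where T: "composition_tableau \<nu> T" "content \<nu> T = m" "t = bottom_rows \<nu> T" by blast
  then show "t \<in> tableaux \<nu> (\<lambda>v. lookup m (Suc v))"
    using lookup_content[OF T(1), of "Suc _"] by (simp add: tableaux_def composition_tableau_iff)
next
  fix t assume t: "t \<in> tableaux \<nu> (\<lambda>v. lookup m (Suc v))"
  let ?T = "\<lambda>(i, c). if 1 \<le> i \<and> i \<le> len \<nu> \<and> 1 \<le> c then t (len \<nu> - i) (c - 1) else 0"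
  have row: "row_tableau \<nu> t" using t by (simp add: tableaux_def)
  have bt: "bottom_rows \<nu> ?T = t"
  proof (intro ext)
    fix i c
    show "bottom_rows \<nu> ?T i c = t i c"
    proof (cases "i < len \<nu>")
      case False
      then have "i \<notin> col \<nu> (Suc 0)" by (simp add: col_Suc_0)
      then have "i \<notin> col \<nu> (Suc c)" using col_antimono[of "Suc 0" "Suc c" \<nu>] by auto
      then have "t i c = 0" using row_tableauD(1)[OF row, of i c] by simp
      then show ?thesis using False by (simp add: bottom_rows_def)
    qed (simp add: bottom_rows_def Suc_le_eq)
  qed
  then have T: "composition_tableau \<nu> ?T"
    unfolding composition_tableau_iff by (simp add: row supported_on_boxes_def)
  have "content \<nu> ?T = m"
  proof (rule poly_mapping_eqI)
    fix v
    show "lookup (content \<nu> ?T) v = lookup m v"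
      unfolding lookup_content[OF T] bt using t assms by (cases v) (auto simp: tableaux_def)
  qed
  then show "t \<in> bottom_rows \<nu> ` {T. composition_tableau \<nu> T \<and> content \<nu> T = m}"
    using T bt by (intro image_eqI[of _ _ ?T]) simp_all
qed

text \<open>Variables that do not occur in m give zeros in the content list, which
  \<open>kostka_filter\<close> removes; hence the coefficient depends only on the sequence of
  nonzero exponents.\<close>

lemma quasi_schur_kostka:
  "quasi_schur \<nu> m = (if lookup m 0 = 0
     then of_nat (kostka (parts (exponents m)) \<nu>) else 0)"
proof (cases "lookup m 0 = 0")
  case True
  \<comment> \<open>The inserted 0 keeps the maximum defined for the monomial 1.\<close>
  define n where "n = Suc (Max (insert 0 (keys m)))"
  have n: "v < n" if "v \<in> keys m" for v
    unfolding n_def less_Suc_eq_le by (rule Max_ge) (use that in auto)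
  let ?f = "\<lambda>v. lookup m (Suc v)"
  have "card {T. composition_tableau \<nu> T \<and> content \<nu> T = m} = card (tableaux \<nu> ?f)"
    by (rule bij_betw_same_card[OF bij_betw_bottom_rows[OF True]])
  also have "\<dots> = kostka (map ?f [0..<n]) \<nu>"
  proof -
    have "?f v = 0" if "n \<le> v" for v
      using n[of "Suc v"] that by (auto simp: in_keys_iff)
    then show ?thesis by (simp add: card_tableaux)
  qed
  also have "\<dots> = kostka (filter (\<lambda>n. n \<noteq> 0) (map ?f [0..<n])) \<nu>"
    by (simp only: kostka_filter)
  also have "filter (\<lambda>n. n \<noteq> 0) (map ?f [0..<n]) =
      map (lookup m) (map Suc (filter (\<lambda>v. ?f v \<noteq> 0) [0..<n]))"
    by (simp add: filter_map comp_def)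
  also have "map Suc (filter (\<lambda>v. ?f v \<noteq> 0) [0..<n]) = sorted_list_of_set (keys m)"
  proof (rule sorted_distinct_set_unique)
    show "sorted (map Suc (filter (\<lambda>v. ?f v \<noteq> 0) [0..<n]))"
      using sorted_filter[of "\<lambda>x. x" "[0..<n]"] by (simp add: sorted_map)
    show "distinct (map Suc (filter (\<lambda>v. ?f v \<noteq> 0) [0..<n]))"
      by (simp add: distinct_map)
    show "set (map Suc (filter (\<lambda>v. ?f v \<noteq> 0) [0..<n])) = set (sorted_list_of_set (keys m))"
    proof (intro equalityI subsetI)
      fix v assume v: "v \<in> set (sorted_list_of_set (keys m))"
      then have "v \<in> keys m" by simp
      then have "v \<noteq> 0" "v < n" using True n by (metis in_keys_iff)+
      then obtain w where "v = Suc w" "w < n" using not0_implies_Suc by auto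
      then show "v \<in> set (map Suc (filter (\<lambda>v. ?f v \<noteq> 0) [0..<n]))"
        using v by (auto simp: in_keys_iff)
    qed (auto simp: in_keys_iff)
  qed simp_all
  finally show ?thesis using True by (simp add: quasi_schur_def parts_exponents)
next
  case False
  then have "{T. composition_tableau \<nu> T \<and> content \<nu> T = m} = {}"
    using lookup_content[of \<nu> _ 0] by auto
  then show ?thesis unfolding quasi_schur_def using False by (simp only: card.empty) simp
qed

lemma monomial_qsym_exponents:
  "monomial_qsym \<xi> m = of_bool (lookup m 0 = 0 \<and> exponents m = \<xi>)"
proof -
  let ?sum = "\<lambda>is. \<Sum>k<len \<xi>. single (is ! k) (parts \<xi> ! k)"
  have "(\<exists>is. length is = len \<xi> \<and> sorted_wrt (<) is \<and> 0 \<notin> set is \<and> m = ?sum is) \<longleftrightarrow>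
      lookup m 0 = 0 \<and> exponents m = \<xi>"
  proof
    assume "\<exists>is. length is = len \<xi> \<and> sorted_wrt (<) is \<and> 0 \<notin> set is \<and> m = ?sum is"
    then obtain xs where xs: "length xs = len \<xi>" "sorted_wrt (<) xs" "0 \<notin> set xs" "m = ?sum xs"
      by blast
    have dist: "distinct xs" using xs(2) by (simp add: strict_sorted_iff)
    have at: "lookup m (xs ! k) = parts \<xi> ! k" if "k < len \<xi>" for k
    proof -
      have "lookup m (xs ! k) = (\<Sum>l<len \<xi>. if l = k then parts \<xi> ! l else 0)"
        unfolding xs(4) Poly_Mapping.lookup_sum lookup_single when_def
        using that xs(1) dist by (intro sum.cong) (auto simp: nth_eq_iff_index_eq)
      then show ?thesis using that by simp
    qed
    have off: "lookup m v = 0" if "v \<notin> set xs" for v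
      unfolding xs(4) Poly_Mapping.lookup_sum lookup_single when_def
      using that xs(1) by (intro sum.neutral) auto
    have keys: "keys m = set xs"
    proof (intro equalityI subsetI)
      fix v assume "v \<in> set xs"
      then obtain k where k: "k < len \<xi>" "v = xs ! k" using xs(1) by (auto simp: in_set_conv_nth)
      have "parts \<xi> ! k \<in> set (parts \<xi>)" using k by (simp add: len_def)
      then have "parts \<xi> ! k \<noteq> 0" by (metis zero_notin_parts)
      then show "v \<in> keys m" using at k by (simp add: in_keys_iff)
    next
      fix v assume "v \<in> keys m"
      then show "v \<in> set xs" using off by (metis in_keys_iff)
    qed
    have "sorted_list_of_set (keys m) = xs"
      using xs(2) by (simp add: keys strict_sorted_iff sorted_list_of_set.idem_if_sorted_distinct)
    then have "parts (exponents m) = parts \<xi>"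
      using at xs(1) by (simp add: parts_exponents list_eq_iff_nth_eq len_def)
    then show "lookup m 0 = 0 \<and> exponents m = \<xi>"
      using off xs(3) by (simp add: parts_inject)
  next
    assume *: "lookup m 0 = 0 \<and> exponents m = \<xi>"
    let ?xs = "sorted_list_of_set (keys m)"
    have p: "parts \<xi> = map (lookup m) ?xs"
      using * parts_exponents by blast
    have len: "len \<xi> = length ?xs" by (simp add: len_def p)
    have dist: "distinct ?xs" by simp
    have "m = ?sum ?xs"
    proof (rule poly_mapping_eqI)
      fix v
      have "lookup (?sum ?xs) v =
          (\<Sum>k<length ?xs. if ?xs ! k = v then lookup m v else 0)"
        unfolding Poly_Mapping.lookup_sum lookup_single when_def len
        by (intro sum.cong) (auto simp: p)
      also have "\<dots> = (\<Sum>w\<in>set ?xs. if w = v then lookup m v else 0)"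
        using sum.reindex_bij_betw[OF bij_betw_nth[OF dist refl refl], of "\<lambda>w. if w = v then lookup m v else 0"]
        by (simp only:)
      also have "\<dots> = lookup m v"
        by (simp add: in_keys_iff)
      finally show "lookup m v = lookup (?sum ?xs) v" ..
    qed
    moreover have "sorted_wrt (<) ?xs" "0 \<notin> set ?xs"
      using * by (simp_all add: in_keys_iff)
    ultimately show "\<exists>is. length is = len \<xi> \<and> sorted_wrt (<) is \<and> 0 \<notin> set is \<and> m = ?sum is"
      using len by metis
  qed
  then show ?thesis by (simp add: monomial_qsym_def)
qed

lemma exponents_surj: "\<exists>m. lookup m 0 = 0 \<and> exponents m = \<xi>"
proof -
  have "length [1..<Suc (len \<xi>)] = len \<xi>" "sorted_wrt (<) [1..<Suc (len \<xi>)]" "0 \<notin> set [1..<Suc (len \<xi>)]"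
    by (simp_all del: upt_Suc)
  then have "monomial_qsym \<xi> (\<Sum>k<len \<xi>. single ([1..<Suc (len \<xi>)] ! k) (parts \<xi> ! k)) = (1 :: int)"
    unfolding monomial_qsym_def by metis
  then show ?thesis
    unfolding monomial_qsym_exponents of_bool_eq_1_iff by (rule exI)
qed

text \<open>A monomial without the index 0 occurs in exactly one M, the one indexed by its exponent
  sequence, and every composition is such a sequence. So the values of f determine its
  coordinates.\<close>

lemma lookup_M_coords:
  assumes f: "\<And>m. f m = (if lookup m 0 = 0 then F (exponents m) else 0)"
    and fin: "finite {\<xi>. F \<xi> \<noteq> 0}"
  shows "lookup (M_coords f) \<xi> = F \<xi>"
proof -
  have expand: "(\<Sum>\<nu>\<in>keys c. lookup c \<nu> * monomial_qsym \<nu> m) =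
      (if lookup m 0 = 0 then lookup c (exponents m) else 0)" for c m
    by (auto simp: monomial_qsym_exponents of_bool_def if_distrib[of "(*) _"] in_keys_iff cong: if_cong)
  let ?c = "Poly_Mapping.Abs_poly_mapping F"
  have c: "lookup ?c = F" using fin by (simp add: Abs_poly_mapping_inverse)
  have "M_coords f = ?c"
    unfolding M_coords_def expand
  proof (rule the_equality)
    show "\<forall>m. f m = (if lookup m 0 = 0 then lookup ?c (exponents m) else 0)"
      by (simp add: f c)
    fix d assume d: "\<forall>m. f m = (if lookup m 0 = 0 then lookup d (exponents m) else 0)"
    show "d = ?c"
    proof (rule poly_mapping_eqI)
      fix \<xi> obtain m where "lookup m 0 = 0" "exponents m = \<xi>" using exponents_surj by blast
      then show "lookup d \<xi> = lookup ?c \<xi>"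
        using spec[OF d, of m] by (simp add: f c)
    qed
  qed
  then show ?thesis by (simp add: c)
qed

lemma kostka_csize: "kostka ns \<nu> \<noteq> 0 \<Longrightarrow> csize \<nu> = sum_list ns"
proof (induction ns arbitrary: \<nu>)
  case (Cons n ns)
  then obtain \<mu> where "\<mu> \<in> horiz_set \<nu> n" "kostka ns \<mu> \<noteq> 0" by (auto elim: sum.not_neutral_contains_not_neutral)
  then show ?case using Cons.IH by (auto simp: horiz_set_def)
qed (auto split: if_splits)

lemma lookup_M_coords_quasi_schur:
  "lookup (M_coords (quasi_schur \<nu> :: 'a::comm_ring_1 power_series)) \<xi> =
    of_nat (kostka (parts \<xi>) \<nu>)"
proof (rule lookup_M_coords)
  show "finite {\<xi>. of_nat (kostka (parts \<xi>) \<nu>) \<noteq> (0 :: 'a)}"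
  proof (rule finite_subset[OF _ finite_csize_eq[of "csize \<nu>"]], clarify)
    fix \<xi> assume "of_nat (kostka (parts \<xi>) \<nu>) \<noteq> (0 :: 'a)"
    then have "kostka (parts \<xi>) \<nu> \<noteq> 0" by (metis of_nat_0)
    then show "csize \<xi> = csize \<nu>" using kostka_csize by (simp add: csize_def)
  qed
qed (simp add: quasi_schur_kostka)

section \<open>Unitriangularity of the numbers of tableaux\<close>

lemma len_mono: "contained \<mu> \<nu> \<Longrightarrow> len \<mu> \<le> len \<nu>"
  by (metis contained_def col_Suc_0 lessThan_subset_iff)

lemma horiz_len: "horiz \<mu> \<nu> \<Longrightarrow> len \<nu> = len \<mu> \<or> len \<nu> = Suc (len \<mu>)"
proof (rule ccontr)
  assume h: "horiz \<mu> \<nu>" and "\<not> (len \<nu> = len \<mu> \<or> len \<nu> = Suc (len \<mu>))"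
  then have "Suc (len \<mu>) < len \<nu>" using len_mono[OF horiz_contained[OF h]] by auto
  then have "Suc (len \<mu>) \<in> new_rows \<mu> \<nu> 0" by (simp add: new_rows_def col_Suc_0)
  then show False using horizD[OF h, of "Suc (len \<mu>)" 0 "len \<mu>"] by (auto simp: col_Suc_0 bef_def)
qed

text \<open>A horizontal strip that creates the top row contains all of it.\<close>

lemma horiz_top_row:
  assumes h: "\<mu> \<in> horiz_set \<nu> n" and len: "len \<nu> = Suc (len \<mu>)"
  shows "rowlen \<nu> (len \<mu>) \<le> n" "rowlen \<nu> (len \<mu>) = n \<Longrightarrow> parts \<nu> = n # parts \<mu>"
proof -
  let ?k = "rowlen \<nu> (len \<mu>)" and ?D = "{(i, c). i \<in> new_rows \<mu> \<nu> c}"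
  have sub: "contained \<mu> \<nu>" and size: "csize \<nu> = csize \<mu> + n"
    using h horiz_contained by (auto simp: horiz_set_def)
  have D: "card ?D = n" using card_new_boxes[OF sub] size by simp
  have fin: "finite ?D"
    by (rule finite_subset[OF _ finite_boxes[of \<nu>]]) (auto simp: new_rows_def)
  have top: "{len \<mu>} \<times> {..<?k} \<subseteq> ?D"
    by (auto simp: new_rows_def col_def rowlen_def)
  have card_top: "card ({len \<mu>} \<times> {..<?k}) = ?k" by simp
  show "?k \<le> n" using card_mono[OF fin top] D card_top by simp
  assume "?k = n"
  then have eq: "?D = {len \<mu>} \<times> {..<?k}"
    using card_subset_eq[OF fin top] D card_top by metis
  have R: "new_rows \<mu> \<nu> c = (if c < ?k then {len \<mu>} else {})" for c
  proof -
    have "i \<in> new_rows \<mu> \<nu> c \<longleftrightarrow> (i, c) \<in> ?D" for i by simp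
    then show ?thesis unfolding eq by auto
  qed
  have "rowlen \<nu> i = rowlen \<mu> i" if "i \<noteq> len \<mu>" for i
  proof -
    have "i \<in> col \<nu> c \<longleftrightarrow> i \<in> col \<mu> c" for c
    proof (cases c)
      case (Suc d)
      have "i \<notin> new_rows \<mu> \<nu> d" using R[of d] that by (auto split: if_splits)
      then show ?thesis using sub Suc by (auto simp: new_rows_def contained_def)
    qed simp
    then have "c \<le> rowlen \<nu> i \<longleftrightarrow> c \<le> rowlen \<mu> i" for c by (simp add: col_def)
    then show ?thesis by (meson antisym order_refl)
  qed
  then have "rowlen \<nu> = (rowlen \<mu>)(len \<mu> := ?k)" by auto
  moreover have "0 < ?k" using len by simp
  ultimately show "parts \<nu> = n # parts \<mu>" using parts_Cons \<open>?k = n\<close> by simp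
qed

lemma horiz_Cons:
  assumes "parts \<nu> = n # parts \<xi>"
  shows "\<xi> \<in> horiz_set \<nu> n"
proof -
  have row: "rowlen \<nu> = (rowlen \<xi>)(len \<xi> := n)" by (rule rowlen_Cons[OF assms])
  have len: "len \<nu> = Suc (len \<xi>)" using assms by (simp add: len_def)
  have R: "j = len \<xi>" if "j \<in> new_rows \<xi> \<nu> c" for j c
    using that by (auto simp: new_rows_def col_def row split: if_splits)
  have "horiz \<xi> \<nu>"
    unfolding horiz_def
  proof (intro allI conjI ballI)
    show "col \<xi> (Suc c) \<subseteq> col \<nu> (Suc c)" for c
      by (auto simp: col_def row rowlen_def)
    fix c j i assume "j \<in> new_rows \<xi> \<nu> c" and i: "i \<in> col \<nu> c - col \<xi> (Suc c)"
    then have j: "j = len \<xi>" using R by blast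
    show "i = j \<or> bef c j i"
    proof (cases c)
      case 0
      then show ?thesis using i j by (auto simp: bef_def col_Suc_0)
    next
      case (Suc d)
      then have "i \<in> col \<nu> (Suc 0)" using i col_antimono[of "Suc 0" c \<nu>] by auto
      then show ?thesis using Suc len j by (auto simp: bef_def col_Suc_0)
    qed
  qed
  then show ?thesis using assms by (simp add: horiz_set_def csize_def)
qed

text \<open>A horizontal strip adds at most one row, so \<nu> has at most as many parts as the list.
  In case of equality each strip creates a top row, of at most n boxes, and of exactly n only if
  that row is the whole strip; then induction compares the rest. Comparing lengths first keeps the
  order well-founded.\<close>

lemma kostka_lenlex:
  assumes "0 \<notin> set ns" "kostka ns \<nu> \<noteq> 0"
  shows "parts \<nu> = ns \<or> (parts \<nu>, ns) \<in> lenlex less_than"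
  using assms
proof (induction ns arbitrary: \<nu>)
  case (Cons n ns)
  then obtain \<mu> where \<mu>: "\<mu> \<in> horiz_set \<nu> n" "kostka ns \<mu> \<noteq> 0"
    by (auto elim: sum.not_neutral_contains_not_neutral)
  then have IH: "parts \<mu> = ns \<or> (parts \<mu>, ns) \<in> lenlex less_than" using Cons by simp
  then have le: "len \<mu> \<le> length ns" by (auto simp: len_def lenlex_conv)
  have "len \<nu> = len \<mu> \<or> len \<nu> = Suc (len \<mu>)" using \<mu> horiz_len by (auto simp: horiz_set_def)
  then consider "len \<nu> < Suc (length ns)" | "len \<nu> = Suc (len \<mu>)" "len \<mu> = length ns"
    using le by linarith
  then show ?case
  proof cases
    case 1
    then show ?thesis by (auto simp: lenlex_conv len_def)
  next
    case 2
    note top = horiz_top_row[OF \<mu>(1) 2(1)]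
    show ?thesis
    proof (cases "rowlen \<nu> (len \<mu>) = n")
      case True
      then show ?thesis using top(2) IH by (auto simp: Cons_lenlex_iff)
    next
      case False
      then have "rowlen \<nu> (len \<mu>) < n" using top(1) by simp
      moreover obtain k ps where p: "parts \<nu> = k # ps" "length ps = length ns"
        using 2 by (cases "parts \<nu>") (auto simp: len_def)
      moreover have "rowlen \<nu> (len \<mu>) = k"
        using nth_parts_rowlen[of 0 \<nu>] 2 p by simp
      ultimately show ?thesis by (simp add: Cons_lenlex_iff)
    qed
  qed
qed (auto simp: parts_zero split: if_splits)

text \<open>Equality of length and of the first part forces the strip to be the entire top row, so a
  single summand remains.\<close>

lemma kostka_self: "kostka (parts \<nu>) \<nu> = 1"
proof (induction "len \<nu>" arbitrary: \<nu>)
  case 0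
  then have p: "parts \<nu> = []" by (simp add: len_def)
  then have "\<nu> = 0" by (simp flip: parts_inject)
  then show ?case using p by simp
next
  case (Suc l)
  then obtain n ns where ns: "parts \<nu> = n # ns" by (cases "parts \<nu>") (auto simp: len_def)
  have z: "0 \<notin> set ns" using zero_notin_parts[of \<nu>] by (simp add: ns)
  define \<xi> where "\<xi> = Comp ns"
  have \<xi>: "parts \<xi> = ns" using z by (simp add: \<xi>_def parts_Comp)
  have in_set: "\<xi> \<in> horiz_set \<nu> n" using horiz_Cons ns \<xi> by simp
  have "kostka ns \<mu> = 0" if \<mu>: "\<mu> \<in> horiz_set \<nu> n" "\<mu> \<noteq> \<xi>" for \<mu>
  proof (rule ccontr)
    assume "kostka ns \<mu> \<noteq> 0"
    then have "len \<mu> \<le> length ns"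
      using kostka_lenlex[OF z, of \<mu>] by (auto simp: len_def lenlex_conv)
    moreover have "len \<nu> = Suc (length ns)" by (simp add: len_def ns)
    ultimately have len: "len \<nu> = Suc (len \<mu>)" using horiz_len[of \<mu> \<nu>] \<mu> by (auto simp: horiz_set_def)
    have "rowlen \<nu> (len \<mu>) = n" using nth_parts_rowlen[of 0 \<nu>] len ns by simp
    then have "parts \<nu> = n # parts \<mu>" using horiz_top_row(2)[OF \<mu>(1) len] by simp
    then show False using \<mu>(2) ns \<xi> by (simp flip: parts_inject)
  qed
  then have "kostka (n # ns) \<nu> = kostka ns \<xi>"
    using in_set by (simp add: sum.remove[of _ \<xi>] sum.neutral)
  also have "\<dots> = 1" using Suc.hyps(1)[of \<xi>] Suc.hyps(2) \<xi> ns by (simp add: len_def)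
  finally show ?case by (simp add: ns)
qed

section \<open>Noncommutative Schur functions\<close>

lemma poly_mapping_sum_singles: "u = (\<Sum>k\<in>keys u. single k (lookup u k))"
  by (rule poly_mapping_eqI) (simp add: Poly_Mapping.lookup_sum lookup_single when_def in_keys_iff)

lemma poly_mapping_additive_induct:
  fixes P :: "('k \<Rightarrow>\<^sub>0 'a::comm_monoid_add) \<Rightarrow> bool"
  assumes "P 0" "\<And>k x. P (single k x)" "\<And>u v. P u \<Longrightarrow> P v \<Longrightarrow> P (u + v)"
  shows "P u"
proof -
  have "P (\<Sum>k\<in>A. single k (f k))" if "finite A" for A f
    using that by (induction A rule: finite_induct) (simp_all add: assms)
  then show ?thesis by (subst poly_mapping_sum_singles) simp
qed

text \<open>The coefficient is an argument of f instead of a scalar factor, so coordinates, tensor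
  products and the coproduct are all instances, whatever their values are.\<close>

definition extend :: "('k \<Rightarrow> 'a::comm_monoid_add \<Rightarrow> 'b::comm_monoid_add) \<Rightarrow> ('k \<Rightarrow>\<^sub>0 'a) \<Rightarrow> 'b" where
  "extend f u = (\<Sum>k\<in>keys u. f k (lookup u k))"

definition additive_family :: "('k \<Rightarrow> 'a::comm_monoid_add \<Rightarrow> 'b::comm_monoid_add) \<Rightarrow> bool" where
  "additive_family f \<longleftrightarrow> (\<forall>k. f k 0 = 0 \<and> (\<forall>x y. f k (x + y) = f k x + f k y))"

lemma extend_zero [simp]: "extend f 0 = 0"
  by (simp add: extend_def)

lemma extend_add: "additive_family f \<Longrightarrow> extend f (u + v) = extend f u + extend f v"
  unfolding extend_def by (rule setsum_keys_plus_distrib) (auto simp: additive_family_def)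

lemma extend_single: "additive_family f \<Longrightarrow> extend f (single k x) = f k x"
  by (auto simp: extend_def additive_family_def)

lemma additive_sum:
  assumes "F 0 = 0" "\<And>u v. F (u + v) = F u + F v"
  shows "F (sum g A) = (\<Sum>i\<in>A. F (g i))"
  by (induction A rule: infinite_finite_induct) (simp_all add: assms)

lemma additive_eqI:
  fixes F G :: "('k \<Rightarrow>\<^sub>0 'a::comm_monoid_add) \<Rightarrow> 'b::monoid_add"
  assumes "F 0 = 0" "\<And>u v. F (u + v) = F u + F v" "G 0 = 0" "\<And>u v. G (u + v) = G u + G v"
    and "\<And>k x. F (single k x) = G (single k x)"
  shows "F u = G u"
  by (rule poly_mapping_additive_induct[of "\<lambda>u. F u = G u"]) (simp_all add: assms)

text \<open>Scalars are multiples of the unit of a monoid algebra, so the same lemmas serve NSym and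
  its tensor square.\<close>

definition scalar :: "'a::zero \<Rightarrow> 'k::zero \<Rightarrow>\<^sub>0 'a" where
  "scalar c = single 0 c"

lemma scalar_times_single [simp]: "scalar c * single k x =
    (single k (c * x) :: 'k::monoid_add \<Rightarrow>\<^sub>0 'a::comm_ring_1)"
  by (simp add: scalar_def mult_single)

lemma single_times_scalar: "single k x * scalar c =
    (single k (c * x) :: 'k::monoid_add \<Rightarrow>\<^sub>0 'a::comm_ring_1)"
  by (simp add: scalar_def mult_single mult.commute)

lemma scalar_commute: "u * scalar c = scalar c * (u :: 'k::monoid_add \<Rightarrow>\<^sub>0 'a::comm_ring_1)"
  by (rule additive_eqI[of "\<lambda>u. u * scalar c" "\<lambda>u. scalar c * u"])
     (simp_all add: algebra_simps single_times_scalar)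

lemma scalar_left_commute: "u * (scalar c * v) = scalar c * (u * v :: 'k::monoid_add \<Rightarrow>\<^sub>0 'a::comm_ring_1)"
  by (metis mult.assoc scalar_commute)

lemma scalar_0 [simp]: "scalar 0 = 0"
  by (simp add: scalar_def)

lemma scalar_1 [simp]: "scalar 1 = (1 :: 'k::monoid_add \<Rightarrow>\<^sub>0 'a::comm_ring_1)"
  by (simp add: scalar_def)

lemma scalar_add: "scalar (c + d) = scalar c + scalar d"
  by (simp add: scalar_def single_add)

lemma scalar_mult: "scalar (c * d) = scalar c * (scalar d :: 'k::monoid_add \<Rightarrow>\<^sub>0 'a::comm_ring_1)"
  by (simp add: scalar_def mult_single)

lemma scalar_uminus: "scalar (- c) = - (scalar c :: 'k::monoid_add \<Rightarrow>\<^sub>0 'a::comm_ring_1)"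
  by (simp add: scalar_def single_uminus)

lemma scalar_power: "scalar (c ^ n) = (scalar c :: 'k::monoid_add \<Rightarrow>\<^sub>0 'a::comm_ring_1) ^ n"
  by (induction n) (simp_all add: scalar_mult)

lemma scalar_of_nat: "scalar (of_nat n) = (of_nat n :: 'k::monoid_add \<Rightarrow>\<^sub>0 'a::comm_ring_1)"
  by (simp add: scalar_def)

lemma scalar_minus_one_power:
  "scalar ((-1) ^ n) = ((-1) ^ n :: 'k::monoid_add \<Rightarrow>\<^sub>0 'a::comm_ring_1)"
  by (simp add: scalar_power scalar_uminus)

lemma scalar_sum: "scalar (sum f A) = (\<Sum>i\<in>A. scalar (f i))"
  by (rule additive_sum) (simp_all add: scalar_add)

text \<open>The coefficient of the noncommutative Schur function indexed by \<open>\<nu>\<close>.\<close>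

definition coord :: "composition \<Rightarrow> 'a::comm_ring_1 nsym \<Rightarrow> 'a" where
  "coord \<nu> = extend (\<lambda>\<xi> x. x * of_nat (kostka (parts \<xi>) \<nu>))"

lemma pairing_quasi_schur: "pairing u (quasi_schur \<nu>) = coord \<nu> u"
  by (simp add: pairing_def coord_def extend_def lookup_M_coords_quasi_schur)

lemma coord_add: "coord \<nu> (u + v) = coord \<nu> u + coord \<nu> v"
  unfolding coord_def by (rule extend_add) (simp add: additive_family_def algebra_simps)

lemma coord_single: "coord \<nu> (single \<xi> x) = x * of_nat (kostka (parts \<xi>) \<nu>)"
  unfolding coord_def by (rule extend_single) (simp add: additive_family_def algebra_simps)

lemma coord_0 [simp]: "coord \<nu> 0 = 0"
  by (simp add: coord_def)

lemma coord_sum: "coord \<nu> (sum f A) = (\<Sum>i\<in>A. coord \<nu> (f i))"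
  by (rule additive_sum) (simp_all add: coord_add)

lemma coord_scalar: "coord \<nu> (scalar c * u) = c * coord \<nu> u"
  by (rule additive_eqI[of "\<lambda>u. coord \<nu> (scalar c * u)" "\<lambda>u. c * coord \<nu> u"])
     (simp_all add: coord_add coord_single algebra_simps)

lemma coord_uminus: "coord \<nu> (- u) = - coord \<nu> u"
  using coord_add[of \<nu> u "- u"] by (simp add: add_eq_0_iff)

lemma coord_diff: "coord \<nu> (u - v) = coord \<nu> u - coord \<nu> v"
  using coord_add[of \<nu> u "- v"] by (simp add: coord_uminus)

lemma coord_Hcomp: "coord \<nu> (Hcomp \<xi>) = of_nat (kostka (parts \<xi>) \<nu>)"
  by (simp add: Hcomp_def coord_single)

lemma kostka_support: "{\<nu>. kostka (parts \<xi>) \<nu> \<noteq> 0} \<subseteq> {\<nu>. csize \<nu> = csize \<xi>}"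
  using kostka_csize by (auto simp: csize_def)

lemma finite_kostka_support: "finite {\<nu>. \<nu> \<noteq> \<xi> \<and> kostka (parts \<xi>) \<nu> \<noteq> 0}"
  by (rule finite_subset[OF _ finite_csize_eq[of "csize \<xi>"]]) (use kostka_support in auto)

text \<open>The matrix of the numbers \<open>kostka (parts \<xi>) \<nu>\<close> is unitriangular, so the expansion of \<open>H\<^sub>\<xi>\<close>
  can be solved for the noncommutative Schur functions.\<close>

function dual_basis :: "composition \<Rightarrow> 'a::comm_ring_1 nsym" where
  "dual_basis \<xi> = Hcomp \<xi> - (\<Sum>\<nu> | \<nu> \<noteq> \<xi> \<and> kostka (parts \<xi>) \<nu> \<noteq> 0.
     scalar (of_nat (kostka (parts \<xi>) \<nu>)) * dual_basis \<nu>)"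
  by auto
termination
proof (relation "inv_image (lenlex less_than) parts")
  show "wf (inv_image (lenlex less_than) parts)"
    by (intro wf_inv_image wf_lenlex wf_less_than)
  fix \<xi> \<nu> :: composition
  assume "\<nu> \<in> {\<nu>. \<nu> \<noteq> \<xi> \<and> kostka (parts \<xi>) \<nu> \<noteq> 0}"
  then show "(\<nu>, \<xi>) \<in> inv_image (lenlex less_than) parts"
    using kostka_lenlex[of "parts \<xi>" \<nu>] by (auto simp: parts_inject)
qed

declare dual_basis.simps [simp del]

lemma coord_dual_basis:
  "coord \<tau> (dual_basis \<xi> :: 'a::comm_ring_1 nsym) = (if \<xi> = \<tau> then 1 else 0)"
proof (induction \<xi> rule: dual_basis.induct)
  case (1 \<xi>)
  let ?B = "{\<nu>. \<nu> \<noteq> \<xi> \<and> kostka (parts \<xi>) \<nu> \<noteq> 0}"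
  have "coord \<tau> (dual_basis \<xi> :: 'a nsym) = of_nat (kostka (parts \<xi>) \<tau>) -
      (\<Sum>\<nu>\<in>?B. of_nat (kostka (parts \<xi>) \<nu>) * coord \<tau> (dual_basis \<nu> :: 'a nsym))"
    by (subst dual_basis.simps) (simp add: coord_diff coord_Hcomp coord_sum coord_scalar)
  also have "(\<Sum>\<nu>\<in>?B. of_nat (kostka (parts \<xi>) \<nu>) * coord \<tau> (dual_basis \<nu> :: 'a nsym)) =
      (\<Sum>\<nu>\<in>?B. if \<nu> = \<tau> then of_nat (kostka (parts \<xi>) \<tau>) else 0)"
  proof (rule sum.cong)
    fix \<nu> assume "\<nu> \<in> ?B"
    then have "coord \<tau> (dual_basis \<nu> :: 'a nsym) = (if \<nu> = \<tau> then 1 else 0)" by (rule 1)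
    then show "of_nat (kostka (parts \<xi>) \<nu>) * coord \<tau> (dual_basis \<nu> :: 'a nsym) =
        (if \<nu> = \<tau> then of_nat (kostka (parts \<xi>) \<tau>) else 0)" by simp
  qed simp
  also have "\<dots> = (if \<tau> \<in> ?B then of_nat (kostka (parts \<xi>) \<tau>) else 0)"
    by (rule sum.delta[OF finite_kostka_support])
  finally show ?case by (auto simp: kostka_self)
qed

text \<open>The defining recursion solved for \<open>Hcomp \<xi>\<close>, the diagonal coefficient
  being 1. The set B is left open so that expansions of several elements can be added over one index
  set.\<close>

lemma Hcomp_dual_basis:
  assumes "finite B" "{\<nu>. csize \<nu> = csize \<xi>} \<subseteq> B"
  shows "Hcomp \<xi> = (\<Sum>\<nu>\<in>B. scalar (of_nat (kostka (parts \<xi>) \<nu>)) * (dual_basis \<nu> :: 'a::comm_ring_1 nsym))"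
proof -
  have "(\<Sum>\<nu>\<in>B. scalar (of_nat (kostka (parts \<xi>) \<nu>)) * (dual_basis \<nu> :: 'a nsym)) =
      dual_basis \<xi> + (\<Sum>\<nu>\<in>B - {\<xi>}. scalar (of_nat (kostka (parts \<xi>) \<nu>)) * dual_basis \<nu>)"
    using assms by (subst sum.remove[of B \<xi>]) (auto simp: kostka_self)
  also have "(\<Sum>\<nu>\<in>B - {\<xi>}. scalar (of_nat (kostka (parts \<xi>) \<nu>)) * (dual_basis \<nu> :: 'a nsym)) =
      (\<Sum>\<nu> | \<nu> \<noteq> \<xi> \<and> kostka (parts \<xi>) \<nu> \<noteq> 0. scalar (of_nat (kostka (parts \<xi>) \<nu>)) * dual_basis \<nu>)"
  proof (rule sum.mono_neutral_right)
    show "{\<nu>. \<nu> \<noteq> \<xi> \<and> kostka (parts \<xi>) \<nu> \<noteq> 0} \<subseteq> B - {\<xi>}"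
      using assms(2) kostka_support[of \<xi>] by blast
    show "\<forall>\<nu>\<in>B - {\<xi>} - {\<nu>. \<nu> \<noteq> \<xi> \<and> kostka (parts \<xi>) \<nu> \<noteq> 0}.
        scalar (of_nat (kostka (parts \<xi>) \<nu>)) * (dual_basis \<nu> :: 'a nsym) = 0"
    proof
      fix \<nu> assume "\<nu> \<in> B - {\<xi>} - {\<nu>. \<nu> \<noteq> \<xi> \<and> kostka (parts \<xi>) \<nu> \<noteq> 0}"
      then have "kostka (parts \<xi>) \<nu> = 0" by blast
      then show "scalar (of_nat (kostka (parts \<xi>) \<nu>)) * (dual_basis \<nu> :: 'a nsym) = 0" by simp
    qed
  qed (use assms in simp)
  finally show ?thesis by (simp add: dual_basis.simps[of \<xi>])
qed

lemma dual_basis_expansion: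
  assumes "finite B" "{\<nu>. \<exists>\<xi>\<in>keys u. csize \<nu> = csize \<xi>} \<subseteq> B"
  shows "u = (\<Sum>\<nu>\<in>B. scalar (coord \<nu> u) * dual_basis \<nu>)"
proof -
  let ?k = "\<lambda>\<xi> \<nu>. of_nat (kostka (parts \<xi>) \<nu>)"
  have "(\<Sum>\<nu>\<in>B. scalar (coord \<nu> u) * dual_basis \<nu>) =
      (\<Sum>\<nu>\<in>B. \<Sum>\<xi>\<in>keys u. scalar (lookup u \<xi>) * (scalar (?k \<xi> \<nu>) * dual_basis \<nu>))"
    by (simp add: coord_def extend_def scalar_sum scalar_mult sum_distrib_right mult.assoc)
  also have "\<dots> = (\<Sum>\<xi>\<in>keys u. scalar (lookup u \<xi>) *
      (\<Sum>\<nu>\<in>B. scalar (?k \<xi> \<nu>) * dual_basis \<nu>))"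
    by (subst sum.swap) (simp add: sum_distrib_left)
  also have "\<dots> = (\<Sum>\<xi>\<in>keys u. scalar (lookup u \<xi>) * Hcomp \<xi>)"
    using assms by (intro sum.cong refl arg_cong[where f = "(*) _"] Hcomp_dual_basis[symmetric]) auto
  also have "\<dots> = u"
    by (subst (3) poly_mapping_sum_singles[of u]) (simp add: Hcomp_def)
  finally show ?thesis ..
qed

lemma finite_csize_keys: "finite {\<nu>. \<exists>\<xi>\<in>keys u. csize \<nu> = csize (f \<xi>)}"
proof -
  have "{\<nu>. \<exists>\<xi>\<in>keys u. csize \<nu> = csize (f \<xi>)} =
      (\<Union>\<xi>\<in>keys u. {\<nu>. csize \<nu> = csize (f \<xi>)})" by auto
  then show ?thesis by (simp add: finite_csize_eq)
qed

lemma coord_inject: "(\<And>\<nu>. coord \<nu> u = coord \<nu> v) \<Longrightarrow> u = v"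
proof -
  assume eq: "\<And>\<nu>. coord \<nu> u = coord \<nu> v"
  let ?B = "{\<nu>. \<exists>\<xi>\<in>keys u. csize \<nu> = csize \<xi>} \<union> {\<nu>. \<exists>\<xi>\<in>keys v. csize \<nu> = csize \<xi>}"
  have fin: "finite ?B" using finite_csize_keys[of u "\<lambda>x. x"] finite_csize_keys[of v "\<lambda>x. x"] by simp
  have "u = (\<Sum>\<nu>\<in>?B. scalar (coord \<nu> u) * dual_basis \<nu>)"
    by (rule dual_basis_expansion[OF fin]) simp
  also have "\<dots> = (\<Sum>\<nu>\<in>?B. scalar (coord \<nu> v) * dual_basis \<nu>)"
    by (simp only: eq)
  also have "\<dots> = v"
    by (rule dual_basis_expansion[OF fin, symmetric]) simp
  finally show ?thesis .
qed

lemma nc_schur_eq: "nc_schur = dual_basis"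
  unfolding nc_schur_def pairing_quasi_schur
proof (rule the_equality)
  show "\<forall>\<mu> \<nu>. coord \<nu> (dual_basis \<mu>) = (if \<mu> = \<nu> then 1 else 0)"
    by (simp add: coord_dual_basis)
  fix s assume "\<forall>\<mu> \<nu>. coord \<nu> (s \<mu>) = (if \<mu> = \<nu> then 1 else 0)"
  then show "s = dual_basis"
    by (intro ext coord_inject) (simp add: coord_dual_basis)
qed

section \<open>Multiplication by the power sums\<close>

definition vert_set :: "composition \<Rightarrow> nat \<Rightarrow> composition set" where
  "vert_set \<nu> n = {\<mu>. vert \<mu> \<nu> \<and> csize \<nu> = csize \<mu> + n}"

lemma finite_vert_set [simp]: "finite (vert_set \<nu> n)"
  by (rule finite_subset[OF _ finite_csize_le[of "csize \<nu>"]]) (auto simp: vert_set_def)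

lemma vert_set_0 [simp]: "vert_set \<nu> 0 = {\<nu>}"
  by (auto simp: vert_set_def dest: contained_csize_eq[OF vert_contained])

text \<open>Both sides range over chains from \<mu> through \<tau> to \<nu>. The index i is
  recovered as the size of the vertical strip, so \<tau> may run over everything between fixed
  ends.\<close>

lemma sum_vert_horiz:
  fixes g :: "nat \<Rightarrow> composition \<Rightarrow> 'a::comm_ring_1"
  shows "(\<Sum>i\<le>n. \<Sum>\<tau>\<in>vert_set \<nu> i. \<Sum>\<mu>\<in>horiz_set \<tau> (n - i). g i \<mu>) =
    (\<Sum>\<mu> | csize \<nu> = csize \<mu> + n. \<Sum>\<tau> | horiz \<mu> \<tau> \<and> vert \<tau> \<nu>. g (csize \<nu> - csize \<tau>) \<mu>)"
proof -
  let ?S = "SIGMA i : {..n}. SIGMA \<tau> : vert_set \<nu> i. horiz_set \<tau> (n - i)"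
  let ?T = "SIGMA \<mu> : {\<mu>. csize \<nu> = csize \<mu> + n}. {\<tau>. horiz \<mu> \<tau> \<and> vert \<tau> \<nu>}"
  have fin: "finite {\<mu>. csize \<nu> = csize \<mu> + n}"
    by (rule finite_subset[OF _ finite_csize_le[of "csize \<nu>"]]) auto
  have "(\<Sum>i\<le>n. \<Sum>\<tau>\<in>vert_set \<nu> i. \<Sum>\<mu>\<in>horiz_set \<tau> (n - i). g i \<mu>) = (\<Sum>(i, \<tau>, \<mu>)\<in>?S. g i \<mu>)"
    by (simp add: sum.Sigma)
  also have "\<dots> = (\<Sum>(\<mu>, \<tau>)\<in>?T. g (csize \<nu> - csize \<tau>) \<mu>)"
  proof (rule sum.reindex_bij_witness[where
        i = "\<lambda>(\<mu>, \<tau>). (csize \<nu> - csize \<tau>, \<tau>, \<mu>)" and j = "\<lambda>(i, \<tau>, \<mu>). (\<mu>, \<tau>)"])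
    fix x assume "x \<in> ?T"
    then obtain \<mu> \<tau> where x: "x = (\<mu>, \<tau>)" "csize \<nu> = csize \<mu> + n" "horiz \<mu> \<tau>" "vert \<tau> \<nu>" by auto
    have "csize \<mu> \<le> csize \<tau>" "csize \<tau> \<le> csize \<nu>"
      using x csize_mono horiz_contained vert_contained by blast+
    then show "(case x of (\<mu>, \<tau>) \<Rightarrow> (csize \<nu> - csize \<tau>, \<tau>, \<mu>)) \<in> ?S"
      using x by (auto simp: vert_set_def horiz_set_def)
  qed (auto simp: vert_set_def horiz_set_def)
  also have "\<dots> = (\<Sum>\<mu> | csize \<nu> = csize \<mu> + n. \<Sum>\<tau> | horiz \<mu> \<tau> \<and> vert \<tau> \<nu>. g (csize \<nu> - csize \<tau>) \<mu>)"
    using fin finite_horiz_vert by (subst sum.Sigma) auto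
  finally show ?thesis .
qed

section \<open>The complete functions, their inverse series and hook ribbons\<close>

definition hcomp :: "nat \<Rightarrow> composition" where
  "hcomp n = (if n = 0 then 0 else Comp [n])"

lemma parts_hcomp: "parts (hcomp n) = (if n = 0 then [] else [n])"
  by (simp add: hcomp_def parts_Comp)

lemma csize_hcomp [simp]: "csize (hcomp n) = n"
  by (simp add: csize_def parts_hcomp)

lemma H_Hcomp: "H n = Hcomp (hcomp n)"
  by (simp add: H_def hcomp_def Hcomp_def)

lemma H_0 [simp]: "H 0 = 1"
  by (simp add: H_def)

lemma Hcomp_mult: "Hcomp \<mu> * Hcomp \<nu> = Hcomp (\<mu> + \<nu>)"
  by (simp add: Hcomp_def mult_single)

text \<open>On basis elements this is the recursion of \<open>kostka\<close>, as H_n H_\<xi> has n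
  in front of the parts of \<xi>.\<close>

lemma coord_H_mult: "coord \<nu> (H n * u) = (\<Sum>\<mu>\<in>horiz_set \<nu> n. coord \<mu> u)"
proof (rule additive_eqI[of "\<lambda>u. coord \<nu> (H n * u)" "\<lambda>u. \<Sum>\<mu>\<in>horiz_set \<nu> n. coord \<mu> u"])
  fix \<xi> and x :: 'a
  show "coord \<nu> (H n * single \<xi> x) = (\<Sum>\<mu>\<in>horiz_set \<nu> n. coord \<mu> (single \<xi> x))"
    by (cases "n = 0")
       (simp_all add: H_Hcomp Hcomp_def mult_single coord_single parts_hcomp sum_distrib_left)
qed (simp_all add: coord_add algebra_simps sum.distrib)

text \<open>The coefficients of the inverse of the generating series of the \<open>H\<^sub>n\<close>.\<close>

definition eh :: "nat \<Rightarrow> 'a::comm_ring_1 nsym" where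
  "eh n = (\<Sum>\<nu> | csize \<nu> = n. (-1) ^ len \<nu> * Hcomp \<nu>)"

text \<open>The last part n - i is split off; it is at least b exactly when i \<le> n - b. The case
  b = 1 covers all compositions of n and gives the recursion for \<open>eh\<close>; general b serves
  hook ribbons.\<close>

lemma sum_last_part:
  fixes F :: "composition \<Rightarrow> 'b::comm_monoid_add"
  assumes "1 \<le> b" "b \<le> n"
  shows "(\<Sum>\<nu> | csize \<nu> = n \<and> parts \<nu> \<noteq> [] \<and> b \<le> last (parts \<nu>). F \<nu>) =
    (\<Sum>i\<le>n - b. \<Sum>\<nu> | csize \<nu> = i. F (\<nu> + hcomp (n - i)))"
proof -
  have "(\<Sum>i\<le>n - b. \<Sum>\<nu> | csize \<nu> = i. F (\<nu> + hcomp (n - i))) =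
      (\<Sum>(i, \<nu>)\<in>(SIGMA i : {..n - b}. {\<nu>. csize \<nu> = i}). F (\<nu> + hcomp (n - i)))"
    by (simp add: sum.Sigma finite_csize_eq)
  also have "\<dots> = (\<Sum>\<nu> | csize \<nu> = n \<and> parts \<nu> \<noteq> [] \<and> b \<le> last (parts \<nu>). F \<nu>)"
  proof (rule sum.reindex_bij_witness[where j = "\<lambda>(i, \<nu>). \<nu> + hcomp (n - i)"
        and i = "\<lambda>\<nu>. (n - last (parts \<nu>), Comp (butlast (parts \<nu>)))"])
    fix x assume "x \<in> (SIGMA i : {..n - b}. {\<nu>. csize \<nu> = i})"
    then obtain \<nu> where x: "x = (csize \<nu>, \<nu>)" "csize \<nu> \<le> n - b" by auto
    then have p: "parts (\<nu> + hcomp (n - csize \<nu>)) = parts \<nu> @ [n - csize \<nu>]"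
      using assms by (simp add: parts_hcomp)
    show "(\<lambda>\<nu>. (n - last (parts \<nu>), Comp (butlast (parts \<nu>)))) ((\<lambda>(i, \<nu>). \<nu> + hcomp (n - i)) x) = x"
      using x p assms by (simp add: parts_inverse)
    show "(\<lambda>(i, \<nu>). \<nu> + hcomp (n - i)) x \<in> {\<nu>. csize \<nu> = n \<and> parts \<nu> \<noteq> [] \<and> b \<le> last (parts \<nu>)}"
      using x p assms by simp
  next
    fix \<nu> assume "\<nu> \<in> {\<nu>. csize \<nu> = n \<and> parts \<nu> \<noteq> [] \<and> b \<le> last (parts \<nu>)}"
    then have \<nu>: "csize \<nu> = n" "parts \<nu> \<noteq> []" "b \<le> last (parts \<nu>)" by auto
    let ?l = "last (parts \<nu>)" and ?\<xi> = "Comp (butlast (parts \<nu>))"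
    have p: "parts ?\<xi> = butlast (parts \<nu>)"
      by (rule parts_Comp) (metis in_set_butlastD zero_notin_parts)
    have eq: "parts \<nu> = parts ?\<xi> @ [?l]" using \<nu>(2) p by simp
    then have size: "csize ?\<xi> + ?l = n" using \<nu>(1) unfolding csize_def by (metis sum_list_append sum_list.Cons sum_list.Nil add_0_right)
    then have "n - (n - ?l) = ?l" by auto
    then have "parts (?\<xi> + hcomp (n - (n - ?l))) = parts \<nu>" using eq \<nu>(3) assms by (simp add: parts_hcomp)
    then show "(\<lambda>(i, \<nu>). \<nu> + hcomp (n - i)) (n - ?l, ?\<xi>) = \<nu>"
      unfolding prod.case by (rule parts_inject[THEN iffD1])
    show "(n - ?l, ?\<xi>) \<in> (SIGMA i : {..n - b}. {\<nu>. csize \<nu> = i})"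
      using size \<nu>(3) by auto
  qed auto
  finally show ?thesis ..
qed

lemma eh_0 [simp]: "eh 0 = 1"
proof -
  have "{\<nu>. csize \<nu> = 0} = {0}"
  proof (intro equalityI subsetI)
    fix \<nu> assume "\<nu> \<in> {\<nu>. csize \<nu> = 0}"
    then have "rowlen \<nu> 0 = 0" using rowlen_le_csize[of \<nu> 0] by (simp del: rowlen_eq_0_iff)
    then have "len \<nu> = 0" by simp
    then show "\<nu> \<in> {0}" by (simp add: len_def flip: parts_inject)
  qed simp
  then show ?thesis by (simp add: eh_def Hcomp_def len_def)
qed

lemma eh_rec:
  assumes "0 < n"
  shows "eh n = - (\<Sum>i<n. eh i * (H (n - i) :: 'a::comm_ring_1 nsym))"
proof -
  have "{\<nu>. csize \<nu> = n} = {\<nu>. csize \<nu> = n \<and> parts \<nu> \<noteq> [] \<and> 1 \<le> last (parts \<nu>)}"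
  proof -
    have "parts \<nu> \<noteq> [] \<and> 1 \<le> last (parts \<nu>)" if "csize \<nu> = n" for \<nu>
    proof -
      have "parts \<nu> \<noteq> []" using that assms by (auto simp: csize_def)
      moreover from this have "last (parts \<nu>) \<noteq> 0" by (metis last_in_set zero_notin_parts)
      ultimately show ?thesis by simp
    qed
    then show ?thesis by blast
  qed
  then have "eh n = (\<Sum>\<nu> | csize \<nu> = n \<and> parts \<nu> \<noteq> [] \<and> 1 \<le> last (parts \<nu>). (-1) ^ len \<nu> * Hcomp \<nu> :: 'a nsym)"
    by (simp add: eh_def)
  also have "\<dots> = (\<Sum>i\<le>n - 1. \<Sum>\<nu> | csize \<nu> = i. (-1) ^ len (\<nu> + hcomp (n - i)) * Hcomp (\<nu> + hcomp (n - i)))"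
    by (rule sum_last_part) (use assms in auto)
  also have "\<dots> = (\<Sum>i\<le>n - 1. - (eh i * H (n - i)))"
  proof (rule sum.cong)
    fix i assume "i \<in> {..n - 1}"
    then have "len (\<nu> + hcomp (n - i)) = Suc (len \<nu>)" for \<nu>
      using assms by (simp add: len_def parts_hcomp)
    then show "(\<Sum>\<nu> | csize \<nu> = i. (-1) ^ len (\<nu> + hcomp (n - i)) * Hcomp (\<nu> + hcomp (n - i))) =
        - (eh i * H (n - i) :: 'a nsym)"
      by (simp add: eh_def H_Hcomp sum_distrib_right mult.assoc Hcomp_mult sum_negf)
  qed simp
  also have "{..n - 1} = {..<n}" using assms by auto
  finally show ?thesis by (simp add: sum_negf)
qed

lemma coord_minus_one_power: "coord \<nu> ((-1) ^ n * u) = (-1) ^ n * coord \<nu> u"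
  unfolding scalar_minus_one_power[symmetric] by (rule coord_scalar)

lemma coord_of_nat_mult: "coord \<nu> (of_nat n * u) = of_nat n * coord \<nu> u"
  unfolding scalar_of_nat[symmetric] by (rule coord_scalar)

text \<open>By \<open>eh_rec\<close> and induction the left side is minus the sum, over i < n, of
  signed vertical strips of size i followed by horizontal ones of size n - i. The term i = n, with
  empty horizontal strip, completes it to a sum that vanishes by \<open>vert_horiz_inverse\<close>,
  as removing n > 0 boxes cannot lead from \<nu> to itself.\<close>

lemma coord_eh_mult: "coord \<nu> (eh n * u) = (-1) ^ n * (\<Sum>\<tau>\<in>vert_set \<nu> n. coord \<tau> (u :: 'a::comm_ring_1 nsym))"
proof (induction n arbitrary: u rule: less_induct)
  case (less n)
  show ?case
  proof (cases "n = 0")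
    case False
    let ?t = "\<lambda>i. \<Sum>\<tau>\<in>vert_set \<nu> i. \<Sum>\<mu>\<in>horiz_set \<tau> (n - i). (-1) ^ i * coord \<mu> u"
    have "(\<Sum>i\<le>n. ?t i) = (\<Sum>\<mu> | csize \<nu> = csize \<mu> + n. coord \<mu> u *
        (\<Sum>\<tau> | horiz \<mu> \<tau> \<and> vert \<tau> \<nu>. (-1) ^ (csize \<nu> - csize \<tau>)))"
      by (simp add: sum_vert_horiz sum_distrib_left mult.commute)
    also have "\<dots> = 0"
    proof (intro sum.neutral ballI)
      fix \<mu> assume "\<mu> \<in> {\<mu>. csize \<nu> = csize \<mu> + n}"
      then have "\<mu> \<noteq> \<nu>" using False by auto
      then show "coord \<mu> u * (\<Sum>\<tau> | horiz \<mu> \<tau> \<and> vert \<tau> \<nu>. (-1) ^ (csize \<nu> - csize \<tau>)) = 0"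
        by (simp only: vert_horiz_inverse if_False mult_zero_right)
    qed
    finally have zero: "(\<Sum>i<n. ?t i) + ?t n = 0"
      by (simp add: lessThan_Suc_atMost[symmetric])
    have "eh n * u = - (\<Sum>i<n. eh i * (H (n - i) * u))"
      using False by (simp add: eh_rec[of n] sum_distrib_right mult.assoc)
    then have "coord \<nu> (eh n * u) = - (\<Sum>i<n. coord \<nu> (eh i * (H (n - i) * u)))"
      by (simp add: coord_uminus coord_sum)
    also have "(\<Sum>i<n. coord \<nu> (eh i * (H (n - i) * u))) = (\<Sum>i<n. ?t i)"
      by (rule sum.cong) (simp_all add: less.IH coord_H_mult sum_distrib_left)
    also have "- \<dots> = ?t n"
      using zero by (simp add: add_eq_0_iff)
    also have "\<dots> = (-1) ^ n * (\<Sum>\<tau>\<in>vert_set \<nu> n. coord \<tau> u)"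
      by (simp add: sum_distrib_left)
    finally show ?thesis .
  qed simp
qed

text \<open>The part b lies in the last block, which gives the bound. Conversely, for a last part l
  \<ge> b the final l - b ones are joined to b and the other ones are cut into blocks of the
  prescribed sizes.\<close>

lemma coarsening_hook:
  assumes b: "1 \<le> b" and \<xi>: "parts \<xi> = replicate a 1 @ [b]"
  shows "coarsening \<nu> \<xi> \<longleftrightarrow> csize \<nu> = a + b \<and> parts \<nu> \<noteq> [] \<and> b \<le> last (parts \<nu>)"
proof
  assume "coarsening \<nu> \<xi>"
  then obtain bl where bl: "[] \<notin> set bl" "concat bl = parts \<xi>" "map sum_list bl = parts \<nu>"
    by (auto simp: coarsening_def)
  have sz: "sum_list (map sum_list bl) = sum_list (concat bl)"
    by (induction bl) simp_all
  have ne: "bl \<noteq> []" using bl(2) \<xi> by auto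
  then have "last bl \<noteq> []" using bl(1) by (metis last_in_set)
  have "last (concat bl) = last (last bl)"
    using ne \<open>last bl \<noteq> []\<close> by (metis append_butlast_last_id concat.simps concat_append append_Nil2 last_appendR)
  then have "b \<in> set (last bl)" using bl(2) \<xi> \<open>last bl \<noteq> []\<close> by (metis last_in_set last_snoc)
  then have "b \<le> sum_list (last bl)" by (rule member_le_sum_list) simp
  moreover have "last (parts \<nu>) = sum_list (last bl)" using ne bl(3) by (metis last_map)
  moreover have "csize \<nu> = a + b"
    using sz bl \<xi> by (simp add: csize_def sum_list_replicate)
  ultimately show "csize \<nu> = a + b \<and> parts \<nu> \<noteq> [] \<and> b \<le> last (parts \<nu>)" using ne bl(3) by auto
next
  assume \<nu>: "csize \<nu> = a + b \<and> parts \<nu> \<noteq> [] \<and> b \<le> last (parts \<nu>)"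
  define xs where "xs = butlast (parts \<nu>)"
  define l where "l = last (parts \<nu>)"
  have p: "parts \<nu> = xs @ [l]" using \<nu> by (simp add: xs_def l_def)
  have l: "b \<le> l" "sum_list xs + l = a + b" using \<nu> by (simp_all add: csize_def p l_def[symmetric] flip: l_def)
  let ?bl = "map (\<lambda>x. replicate x 1) xs @ [replicate (l - b) 1 @ [b]]"
  have "0 \<notin> set xs" using zero_notin_parts[of \<nu>] by (simp add: p)
  then have "[] \<notin> set ?bl" by auto
  moreover have "concat ?bl = parts \<xi>"
  proof -
    have c: "concat (map (\<lambda>x. replicate x (1::nat)) xs) = replicate (sum_list xs) 1"
      by (induction xs) (simp_all add: replicate_add)
    have "a = sum_list xs + (l - b)" using l by simp
    then show ?thesis using c by (simp add: \<xi> replicate_add)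
  qed
  moreover have "map sum_list ?bl = parts \<nu>"
    using l by (simp add: p sum_list_replicate comp_def)
  ultimately show "coarsening \<nu> \<xi>" unfolding coarsening_def by blast
qed

lemma ribbon_hook:
  assumes "a < r"
  shows "(-1) ^ a * ribbon (Comp (replicate a 1 @ [r - a])) =
    (\<Sum>i\<le>a. eh i * (H (r - i) :: 'a::comm_ring_1 nsym))"
proof -
  let ?\<xi> = "Comp (replicate a 1 @ [r - a])"
  have p: "parts ?\<xi> = replicate a 1 @ [r - a]"
    using assms by (intro parts_Comp) (auto simp: set_replicate_conv_if)
  have len: "len ?\<xi> = Suc a" by (simp only: len_def p) simp
  have "(-1) ^ a * ribbon ?\<xi> = (\<Sum>\<nu> | csize \<nu> = r \<and> parts \<nu> \<noteq> [] \<and> r - a \<le> last (parts \<nu>).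
      (-1) ^ a * ((-1) ^ (Suc a - len \<nu>) * (Hcomp \<nu> :: 'a nsym)))"
  proof -
    have "{\<nu>. coarsening \<nu> ?\<xi>} = {\<nu>. csize \<nu> = r \<and> parts \<nu> \<noteq> [] \<and> r - a \<le> last (parts \<nu>)}"
      using coarsening_hook[OF _ p] assms by auto
    then show ?thesis by (simp only: ribbon_def len sum_distrib_left)
  qed
  also have "\<dots> = (\<Sum>i\<le>r - (r - a). \<Sum>\<nu> | csize \<nu> = i. (-1) ^ a *
      ((-1) ^ (Suc a - len (\<nu> + hcomp (r - i))) * Hcomp (\<nu> + hcomp (r - i))))"
    by (rule sum_last_part) (use assms in auto)
  also have "r - (r - a) = a" using assms by simp
  also have "(\<Sum>i\<le>a. \<Sum>\<nu> | csize \<nu> = i. (-1) ^ a *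
      ((-1) ^ (Suc a - len (\<nu> + hcomp (r - i))) * Hcomp (\<nu> + hcomp (r - i)))) =
      (\<Sum>i\<le>a. eh i * (H (r - i) :: 'a nsym))"
  proof (rule sum.cong)
    fix i assume i: "i \<in> {..a}"
    have "(-1) ^ a * ((-1) ^ (Suc a - len (\<nu> + hcomp (r - i))) * Hcomp (\<nu> + hcomp (r - i))) =
        (-1) ^ len \<nu> * Hcomp \<nu> * (H (r - i) :: 'a nsym)" if "csize \<nu> = i" for \<nu>
    proof -
      have "len (\<nu> + hcomp (r - i)) = Suc (len \<nu>)"
        using i assms by (simp add: len_def parts_hcomp)
      \<comment> \<open>This bound keeps the truncated subtraction in the exponent exact, so the two
        signs combine to the sign in \<open>eh\<close>.\<close>
      moreover have "len \<nu> \<le> a"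
      proof -
        have "len \<nu> = (\<Sum>k<len \<nu>. 1)" by simp
        also have "\<dots> \<le> csize \<nu>"
          unfolding csize_rowlen by (rule sum_mono) (simp add: Suc_le_eq)
        finally show ?thesis using that i by simp
      qed
      ultimately show ?thesis
        by (simp add: H_Hcomp Hcomp_mult minus_one_power_iff mult.assoc)
    qed
    then show "(\<Sum>\<nu> | csize \<nu> = i. (-1) ^ a *
      ((-1) ^ (Suc a - len (\<nu> + hcomp (r - i))) * Hcomp (\<nu> + hcomp (r - i)))) = eh i * (H (r - i) :: 'a nsym)"
      by (simp add: eh_def sum_distrib_right)
  qed simp
  finally show ?thesis .
qed

lemma Psi_eh: "Psi r = (\<Sum>i\<le>r. of_nat (r - i) * (eh i * (H (r - i) :: 'a::comm_ring_1 nsym)))"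
proof -
  let ?g = "\<lambda>i. eh i * (H (r - i) :: 'a nsym)"
  have "Psi r = (\<Sum>a<r. \<Sum>i\<le>a. ?g i)"
    unfolding Psi_def by (intro sum.cong refl ribbon_hook) simp
  also have "\<dots> = (\<Sum>a<r. \<Sum>i\<in>{i\<in>{..<r}. i \<le> a}. ?g i)"
    by (intro sum.cong) auto
  also have "\<dots> = (\<Sum>i<r. \<Sum>a\<in>{a\<in>{..<r}. i \<le> a}. ?g i)"
    by (rule sum.swap_restrict) simp_all
  also have "\<dots> = (\<Sum>i<r. of_nat (r - i) * ?g i)"
  proof (rule sum.cong)
    fix i assume "i \<in> {..<r}"
    have "{a\<in>{..<r}. i \<le> a} = {i..<r}" by auto
    then show "(\<Sum>a\<in>{a\<in>{..<r}. i \<le> a}. ?g i) = of_nat (r - i) * ?g i" by simp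
  qed simp
  finally show ?thesis by (simp add: lessThan_Suc_atMost[symmetric])
qed

lemma finite_NCB0:
  assumes "r \<ge> 1"
  shows "finite {\<mu>. NCB0 r \<nu> \<mu>}" "finite {\<nu>. NCB0 r \<nu> \<mu>}"
  by (rule finite_subset[OF _ finite_csize_le[of "csize \<nu>"]]; auto simp: NCB0_iff[OF assms])
     (rule finite_subset[OF _ finite_csize_le[of "csize \<mu> + r"]]; auto simp: NCB0_iff[OF assms])

text \<open>In \<open>Psi_eh\<close> the factor \<open>eh i\<close> stands on the left, so the
  vertical strip is removed from \<nu> before the horizontal one, as in
  \<open>vert_horiz_weighted\<close>. The formula is the transpose of the expansion of Psi_r times a
  noncommutative Schur function.\<close>

lemma coord_Psi_mult:
  assumes "r \<ge> 1"
  shows "coord \<nu> (Psi r * u) =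
    (\<Sum>\<mu> | NCB0 r \<nu> \<mu>. (-1) ^ ht_nc (skew_shape \<nu> \<mu>) * coord \<mu> (u :: 'a::comm_ring_1 nsym))"
proof -
  have "coord \<nu> (Psi r * u) = (\<Sum>i\<le>r. of_nat (r - i) * coord \<nu> (eh i * (H (r - i) * u)))"
    by (simp only: Psi_eh sum_distrib_right mult.assoc coord_sum coord_of_nat_mult)
  also have "\<dots> = (\<Sum>i\<le>r. \<Sum>\<tau>\<in>vert_set \<nu> i. \<Sum>\<mu>\<in>horiz_set \<tau> (r - i). of_nat (r - i) * ((-1) ^ i * coord \<mu> u))"
    by (simp add: coord_eh_mult coord_H_mult sum_distrib_left)
  also have "\<dots> = (\<Sum>\<mu> | csize \<nu> = csize \<mu> + r. \<Sum>\<tau> | horiz \<mu> \<tau> \<and> vert \<tau> \<nu>.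
      of_nat (r - (csize \<nu> - csize \<tau>)) * ((-1) ^ (csize \<nu> - csize \<tau>) * coord \<mu> u))"
    by (rule sum_vert_horiz)
  also have "\<dots> = (\<Sum>\<mu> | csize \<nu> = csize \<mu> + r.
      (if border_strip_rows \<mu> \<nu> then (-1) ^ ht_nc (skew_shape \<nu> \<mu>) else 0) * coord \<mu> u)"
  proof (rule sum.cong)
    fix \<mu> assume "\<mu> \<in> {\<mu>. csize \<nu> = csize \<mu> + r}"
    then have size: "csize \<nu> = csize \<mu> + r" by simp
    have "(\<Sum>\<tau> | horiz \<mu> \<tau> \<and> vert \<tau> \<nu>.
        of_nat (r - (csize \<nu> - csize \<tau>)) * ((-1) ^ (csize \<nu> - csize \<tau>) * coord \<mu> u)) =
      (\<Sum>\<tau> | horiz \<mu> \<tau> \<and> vert \<tau> \<nu>. (-1) ^ (csize \<nu> - csize \<tau>) * of_nat (csize \<tau> - csize \<mu>)) * coord \<mu> u"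
      unfolding sum_distrib_right
    proof (rule sum.cong)
      fix \<tau> assume "\<tau> \<in> {\<tau>. horiz \<mu> \<tau> \<and> vert \<tau> \<nu>}"
      then have "csize \<mu> \<le> csize \<tau>" "csize \<tau> \<le> csize \<nu>"
        using csize_mono horiz_contained vert_contained by blast+
      then have "r - (csize \<nu> - csize \<tau>) = csize \<tau> - csize \<mu>" using size by auto
      then show "of_nat (r - (csize \<nu> - csize \<tau>)) * ((-1) ^ (csize \<nu> - csize \<tau>) * coord \<mu> u) =
          (-1) ^ (csize \<nu> - csize \<tau>) * of_nat (csize \<tau> - csize \<mu>) * coord \<mu> u"
        by (simp add: mult_ac)
    qed simp
    then show "(\<Sum>\<tau> | horiz \<mu> \<tau> \<and> vert \<tau> \<nu>.
        of_nat (r - (csize \<nu> - csize \<tau>)) * ((-1) ^ (csize \<nu> - csize \<tau>) * coord \<mu> u)) =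
      (if border_strip_rows \<mu> \<nu> then (-1) ^ ht_nc (skew_shape \<nu> \<mu>) else 0) * coord \<mu> u"
      using border_strip_rows_sign[of \<mu> \<nu>, where 'a = 'a] by (simp only: vert_horiz_weighted split: if_split) simp
  qed simp
  also have "\<dots> = (\<Sum>\<mu> | NCB0 r \<nu> \<mu>. (-1) ^ ht_nc (skew_shape \<nu> \<mu>) * coord \<mu> u)"
  proof (rule sum.mono_neutral_cong_right)
    show "finite {\<mu>. csize \<nu> = csize \<mu> + r}"
      by (rule finite_subset[OF _ finite_csize_le[of "csize \<nu>"]]) auto
  qed (auto simp: NCB0_iff[OF assms])
  finally show ?thesis .
qed

section \<open>The coproduct\<close>

lemma tensor_extend:
  "u \<otimes> v = extend (\<lambda>\<mu> x. extend (\<lambda>\<nu> y. single (\<mu>, \<nu>) (x * y)) v) u"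
  by (simp add: tensor_def extend_def)

lemma tensor_add_left: "(u + u') \<otimes> v = u \<otimes> v + u' \<otimes> v"
  unfolding tensor_extend
  by (rule extend_add) (simp add: additive_family_def extend_def distrib_right single_add sum.distrib)

lemma tensor_add_right: "u \<otimes> (v + v') = u \<otimes> v + u \<otimes> (v' :: 'a::comm_ring_1 nsym)"
proof -
  have "extend (\<lambda>\<nu> y. single (\<mu>, \<nu>) (x * y)) (v + v') =
      extend (\<lambda>\<nu> y. single (\<mu>, \<nu>) (x * y)) v +
      extend (\<lambda>\<nu> y. single (\<mu>, \<nu>) (x * y)) v'" for \<mu> :: composition and x :: 'a
    by (rule extend_add) (simp add: additive_family_def distrib_left single_add)
  then show ?thesis unfolding tensor_extend extend_def[of _ u] by (simp add: sum.distrib)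
qed

lemma tensor_zero_left [simp]: "0 \<otimes> v = 0"
  by (simp add: tensor_def)

lemma tensor_zero_right [simp]: "u \<otimes> 0 = 0"
  by (simp add: tensor_def)

lemma tensor_single:
  "single \<mu> x \<otimes> single \<nu> y = single (\<mu>, \<nu>) (x * y)"
  by (simp add: tensor_extend extend_single additive_family_def extend_def distrib_left distrib_right single_add sum.distrib)

lemma tensor_one [simp]: "1 \<otimes> 1 = 1"
  using tensor_single[of 0 1 0 1] by (simp add: zero_prod_def[symmetric])

text \<open>Both sides are additive in all four arguments, which are freed from being basis elements
  one at a time.\<close>

lemma tensor_mult: "(u \<otimes> v) * (u' \<otimes> v') = (u * u') \<otimes> (v * (v' :: 'a::comm_ring_1 nsym))"
proof -
  let ?s = single
  have 1: "(?s a x \<otimes> ?s b y) * (?s c z \<otimes> ?s d w) = (?s a x * ?s c z) \<otimes> (?s b y * ?s d w)"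
    for a b c d and x y z w :: 'a
    by (simp add: tensor_single mult_single mult_ac)
  have 2: "(?s a x \<otimes> ?s b y) * (?s c z \<otimes> v') = (?s a x * ?s c z) \<otimes> (?s b y * v')"
    for a b c and x y z :: 'a
    by (rule additive_eqI) (simp_all add: 1 tensor_add_right distrib_left)
  have 3: "(?s a x \<otimes> ?s b y) * (u' \<otimes> v') = (?s a x * u') \<otimes> (?s b y * v')"
    for a b and x y :: 'a
    by (rule additive_eqI[where u = u']) (simp_all add: 2 tensor_add_left distrib_left)
  have 4: "(?s a x \<otimes> v) * (u' \<otimes> v') = (?s a x * u') \<otimes> (v * v')" for a and x :: 'a
    by (rule additive_eqI[where u = v]) (simp_all add: 3 tensor_add_left tensor_add_right distrib_left distrib_right)
  show ?thesis
    by (rule additive_eqI[where u = u]) (simp_all add: 4 tensor_add_left tensor_add_right distrib_left distrib_right)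
qed

lemma tensor_scalar_left: "(scalar c * u) \<otimes> v = scalar c * (u \<otimes> (v :: 'a::comm_ring_1 nsym))"
proof -
  have "scalar c \<otimes> 1 = (scalar c :: 'a nsym2)"
    unfolding scalar_def using tensor_single[of 0 c 0 1] by (simp add: zero_prod_def[symmetric])
  then show ?thesis using tensor_mult[of "scalar c" 1 u v] by simp
qed

lemma tensor_scalar_right: "u \<otimes> (scalar c * v) = scalar c * (u \<otimes> (v :: 'a::comm_ring_1 nsym))"
proof -
  have "1 \<otimes> scalar c = (scalar c :: 'a nsym2)"
    unfolding scalar_def using tensor_single[of 0 1 0 c] by (simp add: zero_prod_def[symmetric])
  then show ?thesis using tensor_mult[of 1 "scalar c" u v] by simp
qed

lemma tensor_sum_left: "sum f A \<otimes> v = (\<Sum>i\<in>A. f i \<otimes> v)"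
  by (rule additive_sum) (simp_all add: tensor_add_left)

lemma tensor_sum_right: "u \<otimes> sum f A = (\<Sum>i\<in>A. u \<otimes> f i)"
  by (rule additive_sum) (simp_all add: tensor_add_right)

section \<open>The coproduct as an algebra homomorphism, and primitivity of the power sums\<close>

lemma comult_extend:
  "comult = extend (\<lambda>\<mu> x. scalar x * prod_list (map comult_H (parts \<mu>)))"
  by (simp add: fun_eq_iff comult_def extend_def scalar_def)

lemma comult_add: "comult (u + v) = comult u + comult (v :: 'a::comm_ring_1 nsym)"
  unfolding comult_extend by (rule extend_add) (simp add: additive_family_def scalar_add distrib_right)

lemma comult_zero [simp]: "comult 0 = 0"
  by (simp add: comult_extend)

lemma comult_single:
  "comult (single \<mu> x) = scalar x * prod_list (map comult_H (parts \<mu>) :: 'a::comm_ring_1 nsym2 list)"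
  unfolding comult_extend by (rule extend_single) (simp add: additive_family_def scalar_add distrib_right)

lemma comult_mult: "comult (u * v) = comult u * comult (v :: 'a::comm_ring_1 nsym)"
proof -
  let ?s = single
  have 1: "comult (?s a x * ?s b y) = comult (?s a x) * comult (?s b y)" for a b and x y :: 'a
  proof -
    let ?p = "\<lambda>a. prod_list (map comult_H (parts a)) :: 'a nsym2"
    have "comult (?s a x * ?s b y) = scalar x * (scalar y * (?p a * ?p b))"
      by (simp add: mult_single comult_single scalar_mult mult.assoc)
    also have "scalar y * (?p a * ?p b) = ?p a * (scalar y * ?p b)"
      by (rule scalar_left_commute[symmetric])
    finally show ?thesis by (simp add: comult_single mult.assoc)
  qed
  have 2: "comult (?s a x * v) = comult (?s a x) * comult v" for a and x :: 'a
    by (rule additive_eqI[where u = v]) (simp_all add: 1 comult_add distrib_left)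
  show ?thesis
    by (rule additive_eqI[where u = u]) (simp_all add: 2 comult_add distrib_right)
qed

lemma comult_sum: "comult (sum f A) = (\<Sum>i\<in>A. comult (f i :: 'a::comm_ring_1 nsym))"
  by (rule additive_sum) (simp_all add: comult_add)

lemma comult_scalar: "comult (scalar c * u) = scalar c * comult (u :: 'a::comm_ring_1 nsym)"
proof -
  have "comult (scalar c) = (scalar c :: 'a nsym2)"
    by (subst scalar_def) (simp add: comult_single)
  then show ?thesis by (simp add: comult_mult)
qed

lemma comult_H_eq: "comult (H n) = (comult_H n :: 'a::comm_ring_1 nsym2)"
proof -
  have "comult (H n) = (prod_list (map comult_H (parts (hcomp n))) :: 'a nsym2)"
    by (simp add: H_Hcomp Hcomp_def comult_single)
  then show ?thesis by (cases "n = 0") (simp_all add: parts_hcomp comult_H_def)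
qed

text \<open>The Euler derivation z d/dz. It preserves degrees, so the logarithmic derivative of the
  H-series has Psi_n in degree n without a shift.\<close>

definition theta :: "'b::ring_1 fps \<Rightarrow> 'b fps" where
  "theta f = Abs_fps (\<lambda>n. of_nat n * fps_nth f n)"

lemma theta_mult: "theta (f * g) = theta f * g + f * theta g"
proof (rule fps_ext)
  fix n
  have "of_nat n * (fps_nth f i * fps_nth g (n - i)) =
      of_nat i * fps_nth f i * fps_nth g (n - i) + fps_nth f i * (of_nat (n - i) * fps_nth g (n - i))"
    if "i \<le> n" for i
  proof -
    have "(of_nat n :: 'a) = of_nat i + of_nat (n - i)" using that by (simp flip: of_nat_add)
    then show ?thesis by (simp only: distrib_right mult.assoc) (metis mult.assoc mult_of_nat_commute)
  qed
  then show "fps_nth (theta (f * g)) n = fps_nth (theta f * g + f * theta g) n"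
    by (simp add: theta_def fps_mult_nth sum_distrib_left flip: sum.distrib)
qed

lemma fps_unit_cancel:
  fixes f g h :: "'b::ring_1 fps"
  assumes "fps_nth f 0 = 1" "f * g = f * h"
  shows "g = h"
proof -
  have "fps_left_inverse f 1 * f = 1"
    by (rule fps_left_inverse) (simp add: assms(1))
  then show ?thesis using assms(2) by (metis mult.assoc mult_1_left)
qed

abbreviation Hseries :: "'a::comm_ring_1 nsym fps" where
  "Hseries \<equiv> Abs_fps H"

abbreviation Psi_series :: "'a::comm_ring_1 nsym fps" where
  "Psi_series \<equiv> Abs_fps Psi"

text \<open>\<open>Psi_eh\<close> says that the Psi-series is E theta(H) with E on the left. By
  \<open>eh_rec\<close>, E is a left inverse of H, and cancelling E from the left makes it
  two-sided.\<close>

lemma theta_Hseries: "theta Hseries = Hseries * (Psi_series :: 'a::comm_ring_1 nsym fps)"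
proof -
  let ?E = "Abs_fps eh :: 'a nsym fps"
  have EH: "?E * Hseries = 1"
  proof (rule fps_ext)
    fix n
    show "fps_nth (?E * Hseries) n = fps_nth 1 n"
    proof (cases "n = 0")
      case False
      have "fps_nth (?E * Hseries) n = (\<Sum>i<n. eh i * H (n - i)) + eh n"
        by (simp add: fps_mult_nth atLeast0AtMost lessThan_Suc_atMost[symmetric])
      then show ?thesis using False by (simp add: eh_rec[of n])
    qed simp
  qed
  have HE: "Hseries * ?E = 1"
    by (rule fps_unit_cancel[of ?E]) (simp_all add: mult.assoc[symmetric] EH)
  have "Psi_series = ?E * theta Hseries"
  proof (rule fps_ext)
    fix n
    have "of_nat m * (x * y) = x * (of_nat m * y)" for m and x y :: "'a nsym"
      by (metis mult.assoc mult_of_nat_commute)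
    then show "fps_nth (Psi_series :: 'a nsym fps) n = fps_nth (?E * theta Hseries) n"
      by (simp add: theta_def fps_mult_nth atLeast0AtMost Psi_eh del: of_nat_diff)
  qed
  then show ?thesis using HE by (simp add: mult.assoc[symmetric])
qed

text \<open>The generating series of the \<open>H\<^sub>n\<close> is grouplike, so its logarithmic derivative is primitive.\<close>

lemma comult_Psi: "comult (Psi n) = Psi n \<otimes> 1 + 1 \<otimes> (Psi n :: 'a::comm_ring_1 nsym)"
proof -
  define A where "A f = Abs_fps (\<lambda>n. fps_nth f n \<otimes> (1 :: 'a nsym))" for f
  define B where "B f = Abs_fps (\<lambda>n. (1 :: 'a nsym) \<otimes> fps_nth f n)" for f
  define C where "C f = Abs_fps (\<lambda>n. comult (fps_nth f n :: 'a nsym))" for f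
  have of_nat: "of_nat m * (u \<otimes> v) = (of_nat m * u) \<otimes> v" "of_nat m * (u \<otimes> v) = u \<otimes> (of_nat m * v)"
      "of_nat m * comult u = comult (of_nat m * u)" for m and u v :: "'a nsym"
    by (simp_all add: scalar_of_nat[symmetric] tensor_scalar_left tensor_scalar_right comult_scalar)
  have A_mult: "A (f * g) = A f * A g" for f g
    by (rule fps_ext) (simp add: A_def fps_mult_nth tensor_sum_left tensor_mult)
  have B_mult: "B (f * g) = B f * B g" for f g
    by (rule fps_ext) (simp add: B_def fps_mult_nth tensor_sum_right tensor_mult)
  have C_mult: "C (f * g) = C f * C g" for f g
    by (rule fps_ext) (simp add: C_def fps_mult_nth comult_sum comult_mult)
  \<comment> \<open>Elements u \<otimes> 1 and 1 \<otimes> v commute although NSym does not. Below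
    this moves \<open>A ?P\<close> past \<open>B ?H\<close>, so that \<open>C ?H\<close> becomes a
    common left factor.\<close>
  have AB_commute: "B g * A f = A f * B g" for f g
  proof (rule fps_ext)
    fix n
    have "fps_nth (B g * A f) n = (\<Sum>i=0..n. fps_nth f (n - i) \<otimes> fps_nth g i)"
      by (simp add: A_def B_def fps_mult_nth tensor_mult)
    also have "\<dots> = (\<Sum>i=0..n. fps_nth f i \<otimes> fps_nth g (n - i))"
      by (rule sum.reindex_bij_witness[where i = "\<lambda>i. n - i" and j = "\<lambda>i. n - i"]) auto
    also have "\<dots> = fps_nth (A f * B g) n"
      by (simp add: A_def B_def fps_mult_nth tensor_mult)
    finally show "fps_nth (B g * A f) n = fps_nth (A f * B g) n" .
  qed
  have theta: "theta (A f) = A (theta f)" "theta (B f) = B (theta f)" "theta (C f) = C (theta f)" for f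
    by (rule fps_ext, simp add: theta_def A_def of_nat(1), rule fps_ext, simp add: theta_def B_def of_nat(2),
        rule fps_ext, simp add: theta_def C_def of_nat(3))
  let ?H = "Hseries :: 'a nsym fps" and ?P = "Psi_series :: 'a nsym fps"
  have CAB: "C ?H = A ?H * B ?H"
    by (rule fps_ext)
       (simp add: A_def B_def C_def fps_mult_nth tensor_mult comult_H_eq comult_H_def atLeast0AtMost)
  have "C ?H * C ?P = theta (C ?H)"
    by (simp add: theta theta_Hseries C_mult)
  also have "\<dots> = A (theta ?H) * B ?H + A ?H * B (theta ?H)"
    by (simp add: CAB theta_mult theta)
  also have "\<dots> = A ?H * (A ?P * B ?H) + A ?H * B ?H * B ?P"
    by (simp add: theta_Hseries A_mult B_mult mult.assoc)
  also have "\<dots> = C ?H * (A ?P + B ?P)"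
    by (simp add: CAB distrib_left mult.assoc AB_commute[of ?H ?P])
  finally have "C ?P = A ?P + B ?P"
    by (rule fps_unit_cancel[rotated]) (simp add: C_def comult_H_eq comult_H_def)
  then have "fps_nth (C ?P) n = fps_nth (A ?P + B ?P) n" by simp
  then show ?thesis by (simp add: A_def B_def C_def)
qed

text \<open>The map id \<otimes> \<open>coord \<eta>\<close>, with values in NSym: it extracts the
  left factor that accompanies s_\<eta>.\<close>

definition right_coord :: "composition \<Rightarrow> 'a::comm_ring_1 nsym2 \<Rightarrow> 'a nsym" where
  "right_coord \<eta> = extend (\<lambda>(\<mu>, \<xi>) x. single \<mu> (x * of_nat (kostka (parts \<xi>) \<eta>)))"

lemma right_coord_add: "right_coord \<eta> (v + w) = right_coord \<eta> v + right_coord \<eta> w"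
  unfolding right_coord_def
  by (rule extend_add) (simp add: additive_family_def distrib_right single_add split: prod.split)

lemma right_coord_zero [simp]: "right_coord \<eta> 0 = 0"
  by (simp add: right_coord_def)

lemma right_coord_sum: "right_coord \<eta> (sum f A) = (\<Sum>i\<in>A. right_coord \<eta> (f i))"
  by (rule additive_sum) (simp_all add: right_coord_add)

lemma right_coord_single: "right_coord \<eta> (single (\<mu>, \<xi>) x) =
    single \<mu> (x * of_nat (kostka (parts \<xi>) \<eta>))"
  unfolding right_coord_def
  by (subst extend_single) (auto simp: additive_family_def distrib_right single_add split: prod.split)

lemma right_coord_tensor: "right_coord \<eta> (u \<otimes> v) = scalar (coord \<eta> v) * (u :: 'a::comm_ring_1 nsym)"
proof -
  have 1: "right_coord \<eta> (single \<mu> x \<otimes> v) = scalar (coord \<eta> v) * single \<mu> x"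
    for \<mu> and x :: 'a
    by (rule additive_eqI[where u = v])
       (simp_all add: right_coord_add tensor_add_right coord_add scalar_add distrib_right
          tensor_single right_coord_single coord_single mult_ac single_add del: scalar_times_single,
        simp_all add: mult_ac)
  show ?thesis
    by (rule additive_eqI[where u = u]) (simp_all add: 1 right_coord_add tensor_add_left distrib_left del: scalar_times_single)
qed

lemma right_coord_scalar: "right_coord \<eta> (scalar c * w) = scalar c * right_coord \<eta> (w :: 'a::comm_ring_1 nsym2)"
proof (rule additive_eqI[where u = w])
  fix k :: "composition \<times> composition" and x :: 'a
  show "right_coord \<eta> (scalar c * single k x) = scalar c * right_coord \<eta> (single k x)"
    by (cases k) (simp add: right_coord_single mult_ac)
qed (simp_all add: right_coord_add distrib_left)

lemma single_pair_tensor: "single k x =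
    single (fst k) (x :: 'a::comm_ring_1) \<otimes> single (snd k) 1"
  by (simp add: tensor_single)

lemma right_coord_mult_left:
  "right_coord \<eta> ((u \<otimes> 1) * w) = u * right_coord \<eta> (w :: 'a::comm_ring_1 nsym2)"
  by (rule additive_eqI[where u = w])
     (simp_all add: right_coord_add distrib_left single_pair_tensor tensor_mult right_coord_tensor
        scalar_left_commute del: scalar_times_single)

text \<open>Only right factors are affected, and there the coordinate at \<eta> is expressed through
  smaller \<mu>. This is why the second sum of the skew formula removes strips from \<eta>.\<close>

lemma right_coord_Psi_mult:
  assumes "r \<ge> 1"
  shows "right_coord \<eta> ((1 \<otimes> Psi r) * w) =
    (\<Sum>\<mu> | NCB0 r \<eta> \<mu>. (-1) ^ ht_nc (skew_shape \<eta> \<mu>) * right_coord \<mu> (w :: 'a::comm_ring_1 nsym2))"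
proof (rule additive_eqI[where u = w])
  fix k :: "composition \<times> composition" and x :: 'a
  show "right_coord \<eta> ((1 \<otimes> Psi r) * single k x) =
      (\<Sum>\<mu> | NCB0 r \<eta> \<mu>. (-1) ^ ht_nc (skew_shape \<eta> \<mu>) * right_coord \<mu> (single k x))"
    by (simp add: single_pair_tensor[of k] tensor_mult right_coord_tensor coord_Psi_mult[OF assms]
        scalar_sum scalar_mult scalar_minus_one_power sum_distrib_right mult.assoc del: scalar_times_single)
qed (simp_all add: right_coord_add distrib_left sum.distrib)

lemma right_coord_expansion:
  assumes "finite B" "{\<nu>. \<exists>k\<in>keys w. csize \<nu> = csize (snd k)} \<subseteq> B"
  shows "w = (\<Sum>\<nu>\<in>B. right_coord \<nu> w \<otimes> (dual_basis \<nu> :: 'a::comm_ring_1 nsym))"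
proof -
  have 1: "(\<Sum>\<nu>\<in>B. right_coord \<nu> (single k x) \<otimes> dual_basis \<nu>) = single k x"
    if "k \<in> keys w" for k and x :: 'a
  proof -
    have "(\<Sum>\<nu>\<in>B. right_coord \<nu> (single k x) \<otimes> dual_basis \<nu>) =
        single (fst k) x \<otimes>
          (\<Sum>\<nu>\<in>B. scalar (of_nat (kostka (parts (snd k)) \<nu>)) * dual_basis \<nu>)"
      by (simp add: single_pair_tensor[of k] right_coord_tensor coord_single tensor_sum_right
          tensor_scalar_left tensor_scalar_right del: scalar_times_single)
    also have "(\<Sum>\<nu>\<in>B. scalar (of_nat (kostka (parts (snd k)) \<nu>)) * dual_basis \<nu>) = (Hcomp (snd k) :: 'a nsym)"
      using assms that by (intro Hcomp_dual_basis[symmetric]) auto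
    finally show ?thesis by (simp add: Hcomp_def tensor_single)
  qed
  have "(\<Sum>\<nu>\<in>B. right_coord \<nu> w \<otimes> dual_basis \<nu>) = (\<Sum>\<nu>\<in>B. \<Sum>k\<in>keys w.
      right_coord \<nu> (single k (lookup w k)) \<otimes> dual_basis \<nu>)"
    by (subst poly_mapping_sum_singles[of w]) (simp only: right_coord_sum tensor_sum_left)
  also have "\<dots> = (\<Sum>k\<in>keys w. single k (lookup w k))"
    by (subst sum.swap) (simp add: 1)
  finally show ?thesis by (simp flip: poly_mapping_sum_singles)
qed

text \<open>Expanding right factors in the dual basis gives existence, with support among the
  finitely many compositions of the sizes that occur. Applying \<open>right_coord\<close> to any
  other expansion isolates a single coefficient by duality, which gives uniqueness.\<close>

lemma skew_schur_right_coord: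
  "skew_schur \<kappa> \<eta> = right_coord \<eta> (comult (nc_schur \<kappa> :: 'a::field_char_0 nsym))"
proof -
  let ?w = "comult (nc_schur \<kappa> :: 'a nsym)"
  let ?B = "{\<nu>. \<exists>k\<in>keys ?w. csize \<nu> = csize (snd k)}"
  have finB: "finite ?B" by (rule finite_csize_keys)
  have supp: "right_coord \<nu> ?w = 0" if "\<nu> \<notin> ?B" for \<nu>
  proof -
    have "right_coord \<nu> (single k x) = 0" if "k \<in> keys ?w" for k and x :: 'a
    proof -
      have "kostka (parts (snd k)) \<nu> = 0"
        using \<open>\<nu> \<notin> ?B\<close> that kostka_support[of "snd k"] by blast
      then show ?thesis by (cases k) (simp add: right_coord_single)
    qed
    then show ?thesis
      by (subst poly_mapping_sum_singles) (simp add: right_coord_sum)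
  qed
  define u where "u = Poly_Mapping.Abs_poly_mapping (\<lambda>\<nu>. right_coord \<nu> ?w)"
  have fin: "finite {\<nu>. right_coord \<nu> ?w \<noteq> 0}"
    by (rule finite_subset[OF _ finB]) (use supp in blast)
  then have u: "lookup u \<nu> = right_coord \<nu> ?w" for \<nu>
    by (simp add: u_def Abs_poly_mapping_inverse)
  have "(THE u. ?w = (\<Sum>\<nu>\<in>keys u. lookup u \<nu> \<otimes> nc_schur \<nu>)) = u"
  proof (rule the_equality)
    have "(\<Sum>\<nu>\<in>keys u. lookup u \<nu> \<otimes> nc_schur \<nu>) =
        (\<Sum>\<nu>\<in>?B. right_coord \<nu> ?w \<otimes> (nc_schur \<nu> :: 'a nsym))"
      unfolding u
    proof (rule sum.mono_neutral_left[OF finB])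
      show "keys u \<subseteq> ?B"
      proof
        fix \<nu> assume "\<nu> \<in> keys u"
        then have ne: "right_coord \<nu> ?w \<noteq> 0" by (simp only: in_keys_iff u not_False_eq_True)
        show "\<nu> \<in> ?B"
        proof (rule ccontr)
          assume "\<nu> \<notin> ?B"
          then have "right_coord \<nu> ?w = 0" by (rule supp)
          with ne show False by (rule notE)
        qed
      qed
    qed (auto simp: in_keys_iff u)
    also have "\<dots> = ?w"
      using right_coord_expansion[OF finB order_refl] unfolding nc_schur_eq by (rule sym)
    finally show "?w = (\<Sum>\<nu>\<in>keys u. lookup u \<nu> \<otimes> nc_schur \<nu>)" ..
  next
    fix v assume v: "?w = (\<Sum>\<nu>\<in>keys v. lookup v \<nu> \<otimes> nc_schur \<nu>)"
    show "v = u"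
    proof (rule poly_mapping_eqI)
      fix \<nu>
      have "right_coord \<nu> ?w = (\<Sum>\<xi>\<in>keys v. if \<xi> = \<nu> then lookup v \<nu> else 0)"
        by (subst v, unfold right_coord_sum right_coord_tensor nc_schur_eq coord_dual_basis, rule sum.cong) simp_all
      also have "\<dots> = lookup v \<nu>" by (simp add: in_keys_iff)
      finally show "lookup v \<nu> = lookup u \<nu>" by (simp add: u)
    qed
  qed
  then show ?thesis by (simp add: skew_schur_def u)
qed

lemma Psi_mult_nc_schur:
  assumes "r \<ge> 1"
  shows "Psi r * nc_schur \<kappa> =
    (\<Sum>\<rho> | NCB0 r \<rho> \<kappa>. (-1) ^ ht_nc (skew_shape \<rho> \<kappa>) * (nc_schur \<rho> :: 'a::field_char_0 nsym))"
proof (rule coord_inject)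
  fix \<nu>
  have "coord \<nu> (Psi r * nc_schur \<kappa> :: 'a nsym) =
      (\<Sum>\<mu> | NCB0 r \<nu> \<mu>. if \<kappa> = \<mu> then (-1) ^ ht_nc (skew_shape \<nu> \<kappa>) else 0)"
    by (subst coord_Psi_mult[OF assms]) (auto simp: nc_schur_eq coord_dual_basis intro: sum.cong)
  also have "\<dots> = (if NCB0 r \<nu> \<kappa> then (-1) ^ ht_nc (skew_shape \<nu> \<kappa>) else 0)"
    using finite_NCB0(1)[OF assms] by simp
  also have "\<dots> = (\<Sum>\<rho> | NCB0 r \<rho> \<kappa>. if \<rho> = \<nu> then (-1) ^ ht_nc (skew_shape \<nu> \<kappa>) else 0)"
    using finite_NCB0(2)[OF assms] by simp
  also have "\<dots> = coord \<nu> (\<Sum>\<rho> | NCB0 r \<rho> \<kappa>. (-1) ^ ht_nc (skew_shape \<rho> \<kappa>) * (nc_schur \<rho> :: 'a nsym))"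
    by (simp add: coord_sum coord_minus_one_power nc_schur_eq coord_dual_basis) (auto intro: sum.cong)
  finally show "coord \<nu> (Psi r * nc_schur \<kappa> :: 'a nsym) =
      coord \<nu> (\<Sum>\<rho> | NCB0 r \<rho> \<kappa>. (-1) ^ ht_nc (skew_shape \<rho> \<kappa>) * nc_schur \<rho>)" .
qed

theorem corollary5p2:
  fixes r :: nat and lam eta :: composition
  assumes "r \<ge> 1"
  shows "(Psi r :: 'a::field_char_0 nsym) * skew_schur lam eta =
    (\<Sum>\<rho> | NCB0 r \<rho> lam. (-1) ^ ht_nc (skew_shape \<rho> lam) * skew_schur \<rho> eta) -
    (\<Sum>\<mu> | NCB0 r eta \<mu>. (-1) ^ ht_nc (skew_shape eta \<mu>) * skew_schur lam \<mu>)"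
proof -
  let ?s = "nc_schur lam :: 'a nsym"
  \<comment> \<open>One element is evaluated twice: expanding Psi_r s_lam before the coproduct gives
    the first sum, multiplying the two coproducts gives the left side and the second sum.\<close>
  have "(\<Sum>\<rho> | NCB0 r \<rho> lam. (-1) ^ ht_nc (skew_shape \<rho> lam) * skew_schur \<rho> eta) =
      right_coord eta (comult (Psi r * ?s))"
    by (simp add: Psi_mult_nc_schur[OF assms] comult_sum right_coord_sum skew_schur_right_coord
        comult_scalar right_coord_scalar flip: scalar_minus_one_power)
  also have "\<dots> = right_coord eta ((Psi r \<otimes> 1) * comult ?s) + right_coord eta ((1 \<otimes> Psi r) * comult ?s)"
    by (simp add: comult_mult comult_Psi distrib_right right_coord_add)
  also have "\<dots> = Psi r * skew_schur lam eta +
      (\<Sum>\<mu> | NCB0 r eta \<mu>. (-1) ^ ht_nc (skew_shape eta \<mu>) * skew_schur lam \<mu>)"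
    by (simp add: right_coord_mult_left right_coord_Psi_mult[OF assms] skew_schur_right_coord)
  finally show ?thesis by simp
qed

end
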